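(* Let $A=\{1,-1,2,-2\}$ and $B=\{3,-3,4,-4\}$ with the involutions $x\mapsto -x$ (so $x^{-1}$ is written $-x$). There are exactly 541 subsets $\mathcal R\subset A\times B\times B\times A$ that are BM relation sets. Under the equivalence given by permuting the generators there are exactly 52 equivalence classes of such $\mathcal R$, and the following 52 rows give one representative for each class, together with the groups $H_1(\Gamma)$ and $C(\Gamma)$ for the corresponding BM group $\Gamma=2\times 2.j$. (In each row the four listed quadruples $(a,b,a',b')$ are the relations $aba'b'=1$. The symbol $k[q_1,\dots,q_t]$ denotes $\mathbb Z^k\oplus\mathbb Z/q_1\mathbb Z\oplus\cdots\oplus\mathbb Z/q_t\mathbb Z$.) 01: (1,3,1,-3),(1,4,1,-4),(2,3,2,-3),(2,4,2,-4); $H_1=2[2,2]$; $C=2[4,4]$. 02: (1,3,1,-3),(1,4,1,-4),(2,3,2,-3),(2,4,-2,4); $H_1=1[2,2,2]$; $C=1[4,4,4]$. 03: (1,3,1,-3),(1,4,1,-4),(2,3,2,-3),(2,4,-2,-4); $H_1=2[2,2]$; $C=2[4,4]$. 04: (1,3,1,-3),(1,4,1,-4),(2,3,2,4),(2,-3,2,-4); $H_1=1[2,4]$; $C=1[2,4,8]$. 05: (1,3,1,-3),(1,4,1,-4),(2,3,-2,3),(2,4,-2,4); $H_1=1[2,2,2]$; $C=1[4,4,4]$. 06: (1,3,1,-3),(1,4,1,-4),(2,3,-2,3),(2,4,-2,-4); $H_1=2[2,2]$; $C=2[4,4]$. 07: (1,3,1,-3),(1,4,1,-4),(2,3,-2,-3),(2,4,-2,-4);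 $H_1=3[2]$; $C=3[4]$. 08: (1,3,1,-3),(1,4,1,-4),(2,3,-2,4),(2,4,-2,3); $H_1=2[2]$; $C=2[2,4]$. 09: (1,3,1,-3),(1,4,1,-4),(2,3,-2,4),(2,4,-2,-3); $H_1=1[2,2]$; $C=1[2,2,4]$. 10: (1,3,1,-3),(1,4,-1,4),(2,3,2,-3),(2,4,-2,-4); $H_1=1[2,2,2]$; $C=1[4,4,4]$. 11: (1,3,1,-3),(1,4,-1,4),(2,3,2,4),(2,-3,2,-4); $H_1=0[2,2,4]$; $C=0[4,4,8]$. 12: (1,3,1,-3),(1,4,-1,4),(2,3,-2,3),(2,4,2,-4); $H_1=0[2,2,2,2]$; $C=0[2,2,4,4,4]$. 13: (1,3,1,-3),(1,4,-1,4),(2,3,-2,3),(2,4,-2,-4); $H_1=1[2,2,2]$; $C=1[4,4,4]$. 14: (1,3,1,-3),(1,4,-1,4),(2,3,-2,-3),(2,4,-2,-4); $H_1=2[2,2]$; $C=2[4,4]$. 15: (1,3,1,-3),(1,4,-1,4),(2,3,-2,4),(2,4,-2,3); $H_1=1[2,2]$; $C=1[4,4]$. 16: (1,3,1,-3),(1,4,-1,4),(2,3,-2,4),(2,4,-2,-3); $H_1=1[2,2]$; $C=1[4,4]$. 17: (1,3,1,-3),(1,4,-1,-4),(2,3,2,-3),(2,4,-2,-4); $H_1=2[2,2]$; $C=2[4,4]$. 18: (1,3,1,-3),(1,4,-1,-4),(2,3,2,4),(2,-3,2,-4); $H_1=1[2,4]$; $C=1[2,4,8]$. 19: (1,3,1,-3),(1,4,-1,-4),(2,3,-2,-3),(2,4,2,-4);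 $H_1=2[2,2]$; $C=2[4,4]$. 20: (1,3,1,-3),(1,4,-1,-4),(2,3,-2,-3),(2,4,-2,4); $H_1=2[2,2]$; $C=2[4,4]$. 21: (1,3,1,-3),(1,4,-1,-4),(2,3,-2,-3),(2,4,-2,-4); $H_1=3[2]$; $C=3[4]$. 22: (1,3,1,-3),(1,4,-1,-4),(2,3,-2,4),(2,4,-2,3); $H_1=2[2]$; $C=2[2,4]$. 23: (1,3,1,-3),(1,4,-1,-4),(2,3,-2,4),(2,4,-2,-3); $H_1=1[2,2]$; $C=1[2,2,4]$. 24: (1,3,1,-3),(1,4,2,4),(1,-4,2,-4),(2,3,2,-3); $H_1=1[2,4]$; $C=1[2,2,8]$. 25: (1,3,1,-3),(1,4,2,4),(1,-4,2,-4),(2,3,-2,-3); $H_1=1[2,4]$; $C=1[2,2,8]$. 26: (1,3,1,-3),(1,4,2,-4),(1,-4,2,4),(2,3,2,-3); $H_1=2[2]$; $C=2[2,2]$. 27: (1,3,1,-3),(1,4,2,-4),(1,-4,2,4),(2,3,-2,-3); $H_1=2[2]$; $C=2[2,2]$. 28: (1,3,1,-3),(1,4,2,-4),(1,-4,-2,4),(2,3,2,-3); $H_1=2[2]$; $C=2[2,2]$. 29: (1,3,1,-3),(1,4,2,-4),(1,-4,-2,4),(2,3,-2,-3); $H_1=2[2]$; $C=2[2,2]$. 30: (1,3,1,4),(1,-3,1,-4),(2,3,2,4),(2,-3,2,-4); $H_1=1[2,4]$; $C=1[2,4,8]$. 31: (1,3,1,4),(1,-3,1,-4),(2,3,2,-4),(2,-3,2,4);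 $H_1=0[2,4,4]$; $C=0[2,2,8,8]$. 32: (1,3,1,4),(1,-3,1,-4),(2,3,-2,-3),(2,4,-2,-4); $H_1=2[4]$; $C=2[2,8]$. 33: (1,3,1,4),(1,-3,1,-4),(2,3,-2,4),(2,4,-2,3); $H_1=2[2]$; $C=2[2,4]$. 34: (1,3,1,4),(1,-3,1,-4),(2,3,-2,4),(2,4,-2,-3); $H_1=1[2,2]$; $C=1[2,2,4]$. 35: (1,3,1,4),(1,-3,1,-4),(2,3,-2,-4),(2,4,-2,-3); $H_1=1[2,4]$; $C=1[2,2,8]$. 36: (1,3,1,4),(1,-3,2,-3),(1,-4,2,-4),(2,3,2,4); $H_1=0[4,8]$; $C=0[2,2,4,8]$. 37: (1,3,1,4),(1,-3,2,-3),(1,-4,-2,-4),(2,3,2,-4); $H_1=0[2,2,3,3]$; $C=0[4,4,3,3]$. 38: (1,3,1,4),(1,-3,2,-4),(1,-4,2,-3),(2,3,2,4); $H_1=1[8]$; $C=1[2,2,8]$. 39: (1,3,1,4),(1,-3,2,-4),(1,-4,-2,-3),(2,3,-2,4); $H_1=1[2]$; $C=1[2,2,2]$. 40: (1,3,1,4),(1,-3,2,-4),(1,-4,-2,-3),(2,3,-2,-4); $H_1=0[2,2,3]$; $C=0[2,2,4,3]$. 41: (1,3,-1,-3),(1,4,-1,-4),(2,3,-2,-3),(2,4,-2,-4); $H_1=4[\,]$; $C=4[\,]$. 42: (1,3,-1,-3),(1,4,-1,-4),(2,3,-2,4),(2,4,-2,3); $H_1=3[\,]$; $C=3[2]$. 43: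 (1,3,-1,-3),(1,4,-1,-4),(2,3,-2,4),(2,4,-2,-3); $H_1=2[2]$; $C=2[2,2]$. 44: (1,3,-1,4),(1,4,-1,3),(2,3,-2,4),(2,4,-2,3); $H_1=3[\,]$; $C=3[2]$. 45: (1,3,-1,4),(1,4,-1,3),(2,3,-2,4),(2,4,-2,-3); $H_1=2[2]$; $C=2[2,2]$. 46: (1,3,-1,4),(1,4,-1,3),(2,3,-2,-4),(2,4,-2,-3); $H_1=2[2]$; $C=2[2,2]$. 47: (1,3,-1,4),(1,4,-1,-3),(2,3,-2,4),(2,4,-2,-3); $H_1=2[2]$; $C=2[2,2]$. 48: (1,3,-1,4),(1,4,2,3),(1,-4,2,-3),(2,4,-2,3); $H_1=2[\,]$; $C=2[2,2]$. 49: (1,3,-1,4),(1,4,2,3),(1,-4,2,-3),(2,4,-2,-3); $H_1=1[2]$; $C=1[2,4]$. 50: (1,3,-1,4),(1,4,2,-3),(1,-4,2,3),(2,4,-2,3); $H_1=1[4]$; $C=1[2,2,4]$. 51: (1,3,2,4),(1,-3,2,-4),(1,4,2,3),(1,-4,2,-3); $H_1=2[2]$; $C=2[2,4]$. 52: (1,3,2,4),(1,-3,2,-4),(1,4,2,-3),(1,-4,2,3); $H_1=1[2,2]$; $C=1[2,2,4]$.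
   Context: **BM relation sets.** Let $A,B$ be finite sets with fixed point free involutions $a\mapsto a^{-1}$, $b\mapsto b^{-1}$. A subset $\mathcal R\subset A\times B\times B\times A$ is a BM relation set if: (i) $(a,b,b',a')\in\mathcal R$ implies $(a^{-1},b',b,a'^{-1})$, $(a'^{-1},b'^{-1},b^{-1},a^{-1})$, $(a',b^{-1},b'^{-1},a)\in\mathcal R$; (ii) the four 4-tuples in (i) are always distinct; equivalently $(a,b,b^{-1},a^{-1})\notin\mathcal R$ for all $a\in A,b\in B$; (iii) each of the four projections of $\mathcal R$ to a subproduct of the form $A\times B$ or $B\times A$ is bijective (equivalently, at least one is). The four-element set of tuples in (i) is called a BM square; for $|A|=|B|=4$, a BM relation set is a union of 4 disjoint BM squares. **BM group.** $\Gamma=\langle A\cup B\mid ab=b'a'\text{ whenever }(a,b,b',a')\in\mathcal R\rangle$, with the involutions giving inverses in $\Gamma$. $H_1(\Gamma)$ is its abelianization. A relation $aba'b'=1$ (with $a,a'\in A$, $b,b'\in B$) corresponds to the BM square containing the tuple $(a,b,b'^{-1},a'^{-1})$; each row of four relations thus determines $\mathcal R$ as the union of the four corresponding BM squares. **Equivalence.** Two relation sets (presentations) are equivalent if one is obtained from the other by permuting the generators, i.e. by a bijection $\theta$ of $A\cup B$ commuting with the involution and either preserving each of $A$ and $B$, in which case $(a,b,b',a')\mapsto(\theta a,\theta b,\theta b',\theta a')$, or interchanging $A$ and $B$, in which case $(a,b,b',a')\mapsto(\theta b',\theta a',\theta a,\theta b)$. **The group $C(\Gamma)$.** Let $M_1,M_2$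 be the $\{0,1\}$-matrices indexed by $\mathcal R\times\mathcal R$ such that, for $r=(a,b,b',a')$ and $s=(c,d,d',c')$: $M_1(s,r)=1$ iff $d'=b$ and $c\ne a^{-1}$; $M_2(s,r)=1$ iff $c=a'$ and $d\ne b^{-1}$. Then $C(\Gamma)=\operatorname{coker}\big((I-M_1,I-M_2):\mathbb Z^{\mathcal R}\oplus\mathbb Z^{\mathcal R}\to\mathbb Z^{\mathcal R}\big)$, i.e. the abelian group with generators $r\in\mathcal R$ and relations $r=\sum_s M_j(s,r)s$, $j=1,2$. *)

theory Defs
  imports "HOL-Algebra.Generated_Groups" "HOL-Algebra.Product_Groups"
begin

section \<open>Group presentations\<close>

text \<open>
  A letter \<open>(x, True)\<close> is the generator \<open>x\<close>, and \<open>(x, False)\<close> is its formal inverse.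
  A relation is a pair of words \<open>(u, v)\<close>, read as \<open>u = v\<close>.
\<close>

type_synonym 'g word = "('g \<times> bool) list"

inductive presentation_cong ::
  "'g set \<Rightarrow> ('g word \<times> 'g word) set \<Rightarrow> 'g word \<Rightarrow> 'g word \<Rightarrow> bool"
  for S :: "'g set" and rels :: "('g word \<times> 'g word) set"
where
  refl: "u \<in> lists (S \<times> UNIV) \<Longrightarrow> presentation_cong S rels u u"
| sym: "presentation_cong S rels u v \<Longrightarrow> presentation_cong S rels v u"
| trans: "presentation_cong S rels u v \<Longrightarrow> presentation_cong S rels v w \<Longrightarrow>
    presentation_cong S rels u w"
| append: "presentation_cong S rels u u' \<Longrightarrow> presentation_cong S rels v v' \<Longrightarrow>
    presentation_cong S rels (u @ v) (u' @ v')"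
| cancel: "x \<in> S \<Longrightarrow> presentation_cong S rels [(x, e), (x, \<not> e)] []"
| relation: "(u, v) \<in> rels \<Longrightarrow> u \<in> lists (S \<times> UNIV) \<Longrightarrow> v \<in> lists (S \<times> UNIV) \<Longrightarrow>
    presentation_cong S rels u v"

definition presented_group ::
  "'g set \<Rightarrow> ('g word \<times> 'g word) set \<Rightarrow> 'g word set monoid" where
  "presented_group S rels =
    (let E = {(u, v). presentation_cong S rels u v} in
      \<lparr>carrier = lists (S \<times> UNIV) // E,
       monoid.mult = (\<lambda>X Y. \<Union>u\<in>X. \<Union>v\<in>Y. E `` {u @ v}),
       one = E `` {[]}\<rparr>)"


section \<open>Abelian groups\<close>

definition abelianization :: "('a, 'b) monoid_scheme \<Rightarrow> 'a set monoid" where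
  "abelianization G = G Mod (derived G (carrier G))"

text \<open>\<open>abelian_type k [q\<^sub>1, \<dots>, q\<^sub>t]\<close> is \<open>\<int>\<^sup>k \<oplus> \<int>/q\<^sub>1\<int> \<oplus> \<dots> \<oplus> \<int>/q\<^sub>t\<int>\<close>.\<close>

definition abelian_type :: "nat \<Rightarrow> nat list \<Rightarrow> ((nat \<Rightarrow> int) \<times> (nat \<Rightarrow> int)) monoid" where
  "abelian_type k qs =
    product_group {..<k} (\<lambda>_. integer_group) \<times>\<times>
    product_group {..<length qs} (\<lambda>i. integer_mod_group (qs ! i))"

definition int_vectors :: "'i set \<Rightarrow> ('i \<Rightarrow> int) monoid" where
  "int_vectors I = product_group I (\<lambda>_. integer_group)"

definition matrix_apply :: "'i set \<Rightarrow> ('i \<Rightarrow> 'i \<Rightarrow> int) \<Rightarrow> ('i \<Rightarrow> int) \<Rightarrow> 'i \<Rightarrow> int" where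
  "matrix_apply I M v = (\<lambda>s\<in>I. \<Sum>r\<in>I. M s r * v r)"

definition coker ::
  "('a, 'c) monoid_scheme \<Rightarrow> ('b, 'd) monoid_scheme \<Rightarrow> ('a \<Rightarrow> 'b) \<Rightarrow> 'b set monoid" where
  "coker G H f = H Mod (f ` carrier G)"


section \<open>BM relation sets\<close>

type_synonym 'g quad = "'g \<times> 'g \<times> 'g \<times> 'g"

definition fixed_point_free_involution :: "('g \<Rightarrow> 'g) \<Rightarrow> 'g set \<Rightarrow> bool" where
  "fixed_point_free_involution \<iota> X \<longleftrightarrow> (\<forall>x\<in>X. \<iota> x \<in> X \<and> \<iota> (\<iota> x) = x \<and> \<iota> x \<noteq> x)"

text \<open>
  One map \<open>\<iota>\<close> carries both involutions, so \<open>A\<close> and \<open>B\<close> are taken disjoint.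
\<close>

definition BM_generators :: "('g \<Rightarrow> 'g) \<Rightarrow> 'g set \<Rightarrow> 'g set \<Rightarrow> bool" where
  "BM_generators \<iota> A B \<longleftrightarrow>
    finite A \<and> finite B \<and> A \<inter> B = {} \<and>
    fixed_point_free_involution \<iota> A \<and> fixed_point_free_involution \<iota> B"

fun BM_square :: "('g \<Rightarrow> 'g) \<Rightarrow> 'g quad \<Rightarrow> 'g quad set" where
  "BM_square \<iota> (a, b, b', a') =
    {(a, b, b', a'), (\<iota> a, b', b, \<iota> a'), (\<iota> a', \<iota> b', \<iota> b, \<iota> a), (a', \<iota> b, \<iota> b', a)}"

definition BM_relation_set :: "('g \<Rightarrow> 'g) \<Rightarrow> 'g set \<Rightarrow> 'g set \<Rightarrow> 'g quad set \<Rightarrow> bool" where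
  "BM_relation_set \<iota> A B R \<longleftrightarrow>
    BM_generators \<iota> A B \<and>
    R \<subseteq> A \<times> B \<times> B \<times> A \<and>
    (\<forall>r\<in>R. BM_square \<iota> r \<subseteq> R) \<and>
    (\<forall>r\<in>R. card (BM_square \<iota> r) = 4) \<and>
    bij_betw (\<lambda>(a, b, b', a'). (a, b)) R (A \<times> B) \<and>
    bij_betw (\<lambda>(a, b, b', a'). (a, b')) R (A \<times> B) \<and>
    bij_betw (\<lambda>(a, b, b', a'). (b, a')) R (B \<times> A) \<and>
    bij_betw (\<lambda>(a, b, b', a'). (b', a')) R (B \<times> A)"

definition BM_relation_sets :: "('g \<Rightarrow> 'g) \<Rightarrow> 'g set \<Rightarrow> 'g set \<Rightarrow> 'g quad set set" where
  "BM_relation_sets \<iota> A B = {R. BM_relation_set \<iota> A B R}"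

definition BM_equivalent ::
  "('g \<Rightarrow> 'g) \<Rightarrow> 'g set \<Rightarrow> 'g set \<Rightarrow> 'g quad set \<Rightarrow> 'g quad set \<Rightarrow> bool" where
  "BM_equivalent \<iota> A B R R' \<longleftrightarrow>
    (\<exists>\<theta>. bij_betw \<theta> (A \<union> B) (A \<union> B) \<and> (\<forall>x \<in> A \<union> B. \<theta> (\<iota> x) = \<iota> (\<theta> x)) \<and>
      (\<theta> ` A = A \<and> \<theta> ` B = B \<and>
         R' = (\<lambda>(a, b, b', a'). (\<theta> a, \<theta> b, \<theta> b', \<theta> a')) ` R \<or>
       \<theta> ` A = B \<and> \<theta> ` B = A \<and>
         R' = (\<lambda>(a, b, b', a'). (\<theta> b', \<theta> a', \<theta> a, \<theta> b)) ` R))"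

definition BM_equivalence ::
  "('g \<Rightarrow> 'g) \<Rightarrow> 'g set \<Rightarrow> 'g set \<Rightarrow> ('g quad set \<times> 'g quad set) set" where
  "BM_equivalence \<iota> A B =
    {(R, R'). R \<in> BM_relation_sets \<iota> A B \<and> R' \<in> BM_relation_sets \<iota> A B \<and>
      BM_equivalent \<iota> A B R R'}"

definition BM_group :: "('g \<Rightarrow> 'g) \<Rightarrow> 'g set \<Rightarrow> 'g set \<Rightarrow> 'g quad set \<Rightarrow> 'g word set monoid" where
  "BM_group \<iota> A B R =
    presented_group (A \<union> B)
      ({([(x, True), (\<iota> x, True)], []) | x. x \<in> A \<union> B} \<union>
       {([(a, True), (b, True)], [(b', True), (a', True)]) | a b b' a'. (a, b, b', a') \<in> R})"

fun BM_matrix1 :: "('g \<Rightarrow> 'g) \<Rightarrow> 'g quad \<Rightarrow> 'g quad \<Rightarrow> int" where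
  "BM_matrix1 \<iota> (c, d, d', c') (a, b, b', a') = (if d' = b \<and> c \<noteq> \<iota> a then 1 else 0)"

fun BM_matrix2 :: "('g \<Rightarrow> 'g) \<Rightarrow> 'g quad \<Rightarrow> 'g quad \<Rightarrow> int" where
  "BM_matrix2 \<iota> (c, d, d', c') (a, b, b', a') = (if c = a' \<and> d \<noteq> \<iota> b then 1 else 0)"

definition identity_matrix :: "'i \<Rightarrow> 'i \<Rightarrow> int" where
  "identity_matrix s r = (if s = r then 1 else 0)"

definition BM_C :: "('g \<Rightarrow> 'g) \<Rightarrow> 'g quad set \<Rightarrow> ('g quad \<Rightarrow> int) set monoid" where
  "BM_C \<iota> R =
    coker (int_vectors R \<times>\<times> int_vectors R) (int_vectors R)
      (\<lambda>(v, w).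
        matrix_apply R (\<lambda>s r. identity_matrix s r - BM_matrix1 \<iota> s r) v
          \<otimes>\<^bsub>int_vectors R\<^esub>
        matrix_apply R (\<lambda>s r. identity_matrix s r - BM_matrix2 \<iota> s r) w)"

text \<open>
  A quadruple \<open>(a, b, a', b')\<close> in the argument stands for the relation \<open>a b a' b' = 1\<close>,
  that is, \<open>a b = b'\<^sup>-\<^sup>1 a'\<^sup>-\<^sup>1\<close>.
\<close>

definition BM_from_relations :: "('g \<Rightarrow> 'g) \<Rightarrow> 'g quad list \<Rightarrow> 'g quad set" where
  "BM_from_relations \<iota> rs = (\<Union>(a, b, a', b') \<in> set rs. BM_square \<iota> (a, b, \<iota> b', \<iota> a'))"


section \<open>The table for \<open>|A| = |B| = 4\<close>\<close>

text \<open>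
  Each row consists of the four relations \<open>a b a' b' = 1\<close>, the type of the first homology
  group and the type of the group \<open>C\<close>.
\<close>

definition BM_table :: "(int quad list \<times> (nat \<times> nat list) \<times> (nat \<times> nat list)) list" where
  "BM_table = [
   ([(1,3,1,-3), (1,4,1,-4), (2,3,2,-3), (2,4,2,-4)], (2, [2, 2]), (2, [4, 4])),
   ([(1,3,1,-3), (1,4,1,-4), (2,3,2,-3), (2,4,-2,4)], (1, [2, 2, 2]), (1, [4, 4, 4])),
   ([(1,3,1,-3), (1,4,1,-4), (2,3,2,-3), (2,4,-2,-4)], (2, [2, 2]), (2, [4, 4])),
   ([(1,3,1,-3), (1,4,1,-4), (2,3,2,4), (2,-3,2,-4)], (1, [2, 4]), (1, [2, 4, 8])),
   ([(1,3,1,-3), (1,4,1,-4), (2,3,-2,3), (2,4,-2,4)], (1, [2, 2, 2]), (1, [4, 4, 4])),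
   ([(1,3,1,-3), (1,4,1,-4), (2,3,-2,3), (2,4,-2,-4)], (2, [2, 2]), (2, [4, 4])),
   ([(1,3,1,-3), (1,4,1,-4), (2,3,-2,-3), (2,4,-2,-4)], (3, [2]), (3, [4])),
   ([(1,3,1,-3), (1,4,1,-4), (2,3,-2,4), (2,4,-2,3)], (2, [2]), (2, [2, 4])),
   ([(1,3,1,-3), (1,4,1,-4), (2,3,-2,4), (2,4,-2,-3)], (1, [2, 2]), (1, [2, 2, 4])),
   ([(1,3,1,-3), (1,4,-1,4), (2,3,2,-3), (2,4,-2,-4)], (1, [2, 2, 2]), (1, [4, 4, 4])),
   ([(1,3,1,-3), (1,4,-1,4), (2,3,2,4), (2,-3,2,-4)], (0, [2, 2, 4]), (0, [4, 4, 8])),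
   ([(1,3,1,-3), (1,4,-1,4), (2,3,-2,3), (2,4,2,-4)], (0, [2, 2, 2, 2]), (0, [2, 2, 4, 4, 4])),
   ([(1,3,1,-3), (1,4,-1,4), (2,3,-2,3), (2,4,-2,-4)], (1, [2, 2, 2]), (1, [4, 4, 4])),
   ([(1,3,1,-3), (1,4,-1,4), (2,3,-2,-3), (2,4,-2,-4)], (2, [2, 2]), (2, [4, 4])),
   ([(1,3,1,-3), (1,4,-1,4), (2,3,-2,4), (2,4,-2,3)], (1, [2, 2]), (1, [4, 4])),
   ([(1,3,1,-3), (1,4,-1,4), (2,3,-2,4), (2,4,-2,-3)], (1, [2, 2]), (1, [4, 4])),
   ([(1,3,1,-3), (1,4,-1,-4), (2,3,2,-3), (2,4,-2,-4)], (2, [2, 2]), (2, [4, 4])),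
   ([(1,3,1,-3), (1,4,-1,-4), (2,3,2,4), (2,-3,2,-4)], (1, [2, 4]), (1, [2, 4, 8])),
   ([(1,3,1,-3), (1,4,-1,-4), (2,3,-2,-3), (2,4,2,-4)], (2, [2, 2]), (2, [4, 4])),
   ([(1,3,1,-3), (1,4,-1,-4), (2,3,-2,-3), (2,4,-2,4)], (2, [2, 2]), (2, [4, 4])),
   ([(1,3,1,-3), (1,4,-1,-4), (2,3,-2,-3), (2,4,-2,-4)], (3, [2]), (3, [4])),
   ([(1,3,1,-3), (1,4,-1,-4), (2,3,-2,4), (2,4,-2,3)], (2, [2]), (2, [2, 4])),
   ([(1,3,1,-3), (1,4,-1,-4), (2,3,-2,4), (2,4,-2,-3)], (1, [2, 2]), (1, [2, 2, 4])),
   ([(1,3,1,-3), (1,4,2,4), (1,-4,2,-4), (2,3,2,-3)], (1, [2, 4]), (1, [2, 2, 8])),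
   ([(1,3,1,-3), (1,4,2,4), (1,-4,2,-4), (2,3,-2,-3)], (1, [2, 4]), (1, [2, 2, 8])),
   ([(1,3,1,-3), (1,4,2,-4), (1,-4,2,4), (2,3,2,-3)], (2, [2]), (2, [2, 2])),
   ([(1,3,1,-3), (1,4,2,-4), (1,-4,2,4), (2,3,-2,-3)], (2, [2]), (2, [2, 2])),
   ([(1,3,1,-3), (1,4,2,-4), (1,-4,-2,4), (2,3,2,-3)], (2, [2]), (2, [2, 2])),
   ([(1,3,1,-3), (1,4,2,-4), (1,-4,-2,4), (2,3,-2,-3)], (2, [2]), (2, [2, 2])),
   ([(1,3,1,4), (1,-3,1,-4), (2,3,2,4), (2,-3,2,-4)], (1, [2, 4]), (1, [2, 4, 8])),
   ([(1,3,1,4), (1,-3,1,-4), (2,3,2,-4), (2,-3,2,4)], (0, [2, 4, 4]), (0, [2, 2, 8, 8])),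
   ([(1,3,1,4), (1,-3,1,-4), (2,3,-2,-3), (2,4,-2,-4)], (2, [4]), (2, [2, 8])),
   ([(1,3,1,4), (1,-3,1,-4), (2,3,-2,4), (2,4,-2,3)], (2, [2]), (2, [2, 4])),
   ([(1,3,1,4), (1,-3,1,-4), (2,3,-2,4), (2,4,-2,-3)], (1, [2, 2]), (1, [2, 2, 4])),
   ([(1,3,1,4), (1,-3,1,-4), (2,3,-2,-4), (2,4,-2,-3)], (1, [2, 4]), (1, [2, 2, 8])),
   ([(1,3,1,4), (1,-3,2,-3), (1,-4,2,-4), (2,3,2,4)], (0, [4, 8]), (0, [2, 2, 4, 8])),
   ([(1,3,1,4), (1,-3,2,-3), (1,-4,-2,-4), (2,3,2,-4)], (0, [2, 2, 3, 3]), (0, [4, 4, 3, 3])),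
   ([(1,3,1,4), (1,-3,2,-4), (1,-4,2,-3), (2,3,2,4)], (1, [8]), (1, [2, 2, 8])),
   ([(1,3,1,4), (1,-3,2,-4), (1,-4,-2,-3), (2,3,-2,4)], (1, [2]), (1, [2, 2, 2])),
   ([(1,3,1,4), (1,-3,2,-4), (1,-4,-2,-3), (2,3,-2,-4)], (0, [2, 2, 3]), (0, [2, 2, 4, 3])),
   ([(1,3,-1,-3), (1,4,-1,-4), (2,3,-2,-3), (2,4,-2,-4)], (4, []), (4, [])),
   ([(1,3,-1,-3), (1,4,-1,-4), (2,3,-2,4), (2,4,-2,3)], (3, []), (3, [2])),
   ([(1,3,-1,-3), (1,4,-1,-4), (2,3,-2,4), (2,4,-2,-3)], (2, [2]), (2, [2, 2])),
   ([(1,3,-1,4), (1,4,-1,3), (2,3,-2,4), (2,4,-2,3)], (3, []), (3, [2])),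
   ([(1,3,-1,4), (1,4,-1,3), (2,3,-2,4), (2,4,-2,-3)], (2, [2]), (2, [2, 2])),
   ([(1,3,-1,4), (1,4,-1,3), (2,3,-2,-4), (2,4,-2,-3)], (2, [2]), (2, [2, 2])),
   ([(1,3,-1,4), (1,4,-1,-3), (2,3,-2,4), (2,4,-2,-3)], (2, [2]), (2, [2, 2])),
   ([(1,3,-1,4), (1,4,2,3), (1,-4,2,-3), (2,4,-2,3)], (2, []), (2, [2, 2])),
   ([(1,3,-1,4), (1,4,2,3), (1,-4,2,-3), (2,4,-2,-3)], (1, [2]), (1, [2, 4])),
   ([(1,3,-1,4), (1,4,2,-3), (1,-4,2,3), (2,4,-2,3)], (1, [4]), (1, [2, 2, 4])),
   ([(1,3,2,4), (1,-3,2,-4), (1,4,2,3), (1,-4,2,-3)], (2, [2]), (2, [2, 4])),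
   ([(1,3,2,4), (1,-3,2,-4), (1,4,2,-3), (1,-4,2,3)], (1, [2, 2]), (1, [2, 2, 4]))
  ]"

end

theory Submission
  imports Defs "HOL-Algebra.FiniteProduct" "HOL-Combinatorics.Permutations"
begin

text \<open>
  All assertions are finite, and the proof reduces them to a few evaluations of recursive functions
  inside the logic. Mathematics enters in showing that what is evaluated means what is claimed.

  \<^bold>\<open>Counting.\<close> A BM relation set is the same as a family of pairwise disjoint BM squares whose
  tuples lie over every cell \<open>(a, b)\<close> of \<open>A \<times> B\<close> exactly once: three of the four projections are
  carried to the fourth by the symmetries of a square (\<open>BM_relation_sets_covers\<close>). These exact
  covers are counted by branching on the square that lies over the first free cell
  (\<open>card_covers\<close>), which gives 541.

  \<^bold>\<open>Classes.\<close> The renamings of generators form a group of order 128, and every element of it is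
  a product in fixed order of a subset of seven chosen involutions. Hence seven successive doublings
  starting from one relation set yield its whole class (\<open>class_subset_images\<close>). Relation sets are
  compared through an integer weight, a sum over tuples and so by construction a function of the
  relation set alone. The doubling of the 52 rows, with elements of repeated weight discarded,
  produces 541 pairwise distinct weights in all. As there are only 541 relation sets, the weight is
  injective, nothing was lost by discarding, the lists are exactly the classes, they are pairwise
  disjoint and they exhaust all relation sets (\<open>orbits_cover\<close>, \<open>class_eq\<close>). The numbers 541
  from the two computations have to agree for this argument, and this is what proves
  that the rows are both inequivalent and complete.

  \<^bold>\<open>Groups.\<close> Both \<open>H\<^sub>1\<close> and \<open>C\<close> are quotients of a free abelian group by the span of an
  explicit list of integer rows (\<open>abelianization_iso\<close>, \<open>coker_iso\<close>). The rows are diagonalized by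
  Euclidean row operations and changes of basis. Instead of tracking quotient groups through these
  steps, the target group \<open>T\<close> is kept fixed and only a generating family in \<open>T\<close> changes:
  \<open>presents T ds n S\<close> says that \<open>T\<close> is the sum of cyclic groups of orders \<open>ds\<close> and of the group
  with \<open>n\<close> generators and relations \<open>S\<close>. Reading the algorithm backwards from
  a basis of \<open>abelian_type\<close> adapted to its summands ends at the original relations
  (\<open>diagonalize_presents\<close>).

  The functions to be evaluated are written in first-order form, with decisions passed
  as Boolean arguments. Rewriting then does not revisit values that it has already computed, which
  makes evaluation by the simplifier feasible.
\<close>

section \<open>Row spans over the integers\<close>

text \<open>Integer row vectors are lists, and \<open>axpy k u v\<close> is \<open>k u + v\<close>.\<close>
fun axpy :: "int \<Rightarrow> int list \<Rightarrow> int list \<Rightarrow> int list" where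
  "axpy k (x # xs) (y # ys) = (k * x + y) # axpy k xs ys"
| "axpy k [] ys = []"
| "axpy k (x # xs) [] = []"

inductive int_span :: "nat \<Rightarrow> int list set \<Rightarrow> int list \<Rightarrow> bool" for n S where
  zero: "int_span n S (replicate n 0)"
| step: "int_span n S v \<Longrightarrow> r \<in> S \<Longrightarrow> int_span n S (axpy k r v)"

lemma length_axpy [simp]: "length (axpy k xs ys) = min (length xs) (length ys)"
  by (induction k xs ys rule: axpy.induct) auto

lemma nth_axpy: "i < length xs \<Longrightarrow> i < length ys \<Longrightarrow> axpy k xs ys ! i = k * xs ! i + ys ! i"
  by (induction k xs ys arbitrary: i rule: axpy.induct) (auto simp: nth_Cons split: nat.splits)

lemma axpy_snoc:
  "length u = length v \<Longrightarrow> axpy k (u @ [a]) (v @ [b]) = axpy k u v @ [k * a + b]"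
  by (induction u v rule: list_induct2) auto

lemma axpy_zero_left [simp]: "length v = n \<Longrightarrow> axpy k (replicate n 0) v = v"
  by (rule nth_equalityI) (auto simp: nth_axpy)

lemma axpy_axpy:
  assumes "length r = n" "length u = n" "length v = n"
  shows "axpy k (axpy j r u) v = axpy (k * j) r (axpy k u v)"
  by (rule nth_equalityI) (use assms in \<open>auto simp: nth_axpy algebra_simps\<close>)

locale int_rows =
  fixes n :: nat and S :: "int list set"
  assumes length_row: "r \<in> S \<Longrightarrow> length r = n"
begin

lemma length_span: "int_span n S v \<Longrightarrow> length v = n"
  by (induction rule: int_span.induct) (auto simp: length_row)

lemma span_axpy:
  assumes "int_span n S u" "int_span n S v"
  shows "int_span n S (axpy k u v)"
  using assms(1)
proof (induction rule: int_span.induct)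
  case zero
  then show ?case using assms(2) length_span by simp
next
  case (step u r j)
  then show ?case
    using axpy_axpy[of r n u v k j] assms(2) length_span length_row int_span.step by metis
qed

lemma row_in_span: "r \<in> S \<Longrightarrow> int_span n S r"
proof -
  assume r: "r \<in> S"
  have "axpy 1 r (replicate n 0) = r"
    by (rule nth_equalityI) (use length_row[OF r] in \<open>auto simp: nth_axpy\<close>)
  then show ?thesis using int_span.step[OF int_span.zero r, of n 1] by simp
qed

lemma span_image:
  assumes zero: "\<phi> (replicate n 0) = replicate m 0"
    and lin: "\<And>k u v. length u = n \<Longrightarrow> length v = n \<Longrightarrow> \<phi> (axpy k u v) = axpy k (\<phi> u) (\<phi> v)"
    and S': "int_rows m S'"
    and rows: "\<And>r. r \<in> S \<Longrightarrow> int_span m S' (\<phi> r)"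
    and "int_span n S v"
  shows "int_span m S' (\<phi> v)"
  using \<open>int_span n S v\<close>
proof (induction rule: int_span.induct)
  case zero
  then show ?case by (simp add: \<open>\<phi> (replicate n 0) = _\<close> int_span.zero)
next
  case (step v r k)
  then show ?case
    using lin[OF length_row[OF \<open>r \<in> S\<close>] length_span[OF \<open>int_span n S v\<close>]] rows
      int_rows.span_axpy[OF S'] by simp
qed

lemma span_mono:
  assumes "int_rows n S'" "\<And>r. r \<in> S \<Longrightarrow> int_span n S' r" "int_span n S v"
  shows "int_span n S' v"
  using span_image[of id n S' v] assms by simp

end

lemma int_span_eqI:
  assumes "int_rows n S" "int_rows n S'"
    and "\<And>r. r \<in> S \<Longrightarrow> int_span n S' r" "\<And>r. r \<in> S' \<Longrightarrow> int_span n S r"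
  shows "int_span n S = int_span n S'"
  using int_rows.span_mono assms by blast

section \<open>Linear combinations in an abelian group\<close>

fun lin :: "('a, 'b) monoid_scheme \<Rightarrow> int list \<Rightarrow> 'a list \<Rightarrow> 'a" where
  "lin T (c # cs) (x # xs) = x [^]\<^bsub>T\<^esub> c \<otimes>\<^bsub>T\<^esub> lin T cs xs"
| "lin T [] xs = \<one>\<^bsub>T\<^esub>"
| "lin T (c # cs) [] = \<one>\<^bsub>T\<^esub>"

context comm_group
begin

lemma lin_closed [simp, intro]: "set xs \<subseteq> carrier G \<Longrightarrow> lin G c xs \<in> carrier G"
  by (induction xs arbitrary: c) (case_tac [!] c, auto)

lemma lin_axpy:
  assumes "length u = length xs" "length v = length xs" "set xs \<subseteq> carrier G"
  shows "lin G (axpy k u v) xs = lin G u xs [^] k \<otimes> lin G v xs"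
  using assms
proof (induction xs arbitrary: u v)
  case Nil
  then show ?case by simp
next
  case (Cons x xs)
  obtain a u' b v' where uv: "u = a # u'" "v = b # v'"
    using Cons.prems by (metis length_Suc_conv)
  have x: "x \<in> carrier G" and xs: "set xs \<subseteq> carrier G" using Cons.prems by auto
  have IH: "lin G (axpy k u' v') xs = lin G u' xs [^] k \<otimes> lin G v' xs"
    using Cons uv by auto
  have "x [^] (k * a + b) = (x [^] a) [^] k \<otimes> x [^] b"
    using x by (simp add: int_pow_mult int_pow_pow mult.commute)
  then show ?case
    using x xs by (simp add: uv IH int_pow_distrib m_ac)
qed

lemma lin_zero [simp]: "set xs \<subseteq> carrier G \<Longrightarrow> lin G (replicate n 0) xs = \<one>"
  by (induction xs arbitrary: n) (case_tac [!] n, auto)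

lemma lin_append:
  "length c = length xs \<Longrightarrow> set xs \<subseteq> carrier G \<Longrightarrow> set ys \<subseteq> carrier G \<Longrightarrow>
    lin G (c @ d) (xs @ ys) = lin G c xs \<otimes> lin G d ys"
  by (induction c xs rule: list_induct2) (auto simp: m_assoc)

end

text \<open>
  A basis with orders \<open>ds\<close> exhibits the group as a direct sum of cyclic groups: order \<open>0\<close> stands
  for an infinite summand, and \<open>1\<close> and negative orders are permitted because the
  diagonalization produces them.
\<close>
definition basis :: "('a, 'b) monoid_scheme \<Rightarrow> 'a list \<Rightarrow> int list \<Rightarrow> bool" where
  "basis T ys ds \<longleftrightarrow> length ys = length ds \<and> set ys \<subseteq> carrier T \<and>
    (\<forall>t\<in>carrier T. \<exists>c. length c = length ds \<and> t = lin T c ys) \<and>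
    (\<forall>c. length c = length ds \<longrightarrow> (lin T c ys = \<one>\<^bsub>T\<^esub> \<longleftrightarrow> list_all2 (dvd) ds c))"

text \<open>
  The part \<open>ys\<close> of the generators has been split off with orders \<open>ds\<close>; the relations among the other
  generators \<open>xs\<close> are the span of \<open>S\<close>. The initial situation has \<open>ds = []\<close>, the final one \<open>n = 0\<close>.
\<close>
definition presents ::
  "('a, 'b) monoid_scheme \<Rightarrow> int list \<Rightarrow> nat \<Rightarrow> int list set \<Rightarrow> bool" where
  "presents T ds n S \<longleftrightarrow> (\<exists>ys xs. length ys = length ds \<and> length xs = n \<and>
    set ys \<subseteq> carrier T \<and> set xs \<subseteq> carrier T \<and>
    (\<forall>t\<in>carrier T. \<exists>e c. length e = length ds \<and> length c = n \<and> t = lin T e ys \<otimes>\<^bsub>T\<^esub> lin T c xs) \<and>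
    (\<forall>e c. length e = length ds \<longrightarrow> length c = n \<longrightarrow>
      (lin T e ys \<otimes>\<^bsub>T\<^esub> lin T c xs = \<one>\<^bsub>T\<^esub> \<longleftrightarrow> list_all2 (dvd) ds e \<and> int_span n S c)))"

section \<open>Diagonalization of relation matrices\<close>

fun dvd_row :: "int \<Rightarrow> int list \<Rightarrow> bool" where
  "dvd_row g [] = True"
| "dvd_row g (x # xs) = (x mod g = 0 \<and> dvd_row g xs)"

fun mod_row :: "int \<Rightarrow> int list \<Rightarrow> int list" where
  "mod_row g [] = []"
| "mod_row g (x # xs) = (x mod g) # mod_row g xs"

fun div_row :: "int \<Rightarrow> int list \<Rightarrow> int list" where
  "div_row g [] = []"
| "div_row g (x # xs) = (x div g) # div_row g xs"

text \<open>
  Euclid's algorithm on the leading entries \<open>g\<close> and \<open>h\<close> of two rows with tails \<open>v\<close> and \<open>w\<close>. The Boolean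
  argument records whether \<open>h = 0\<close>. It ends with the rows \<open>g # v\<close> and \<open>0 # w\<close>.
\<close>
function euclid :: "bool \<Rightarrow> int \<Rightarrow> int list \<Rightarrow> int \<Rightarrow> int list \<Rightarrow> (int \<times> int list) \<times> int list" where
  "euclid True g v h w = ((g, v), w)"
| "euclid False g v h w = euclid (g mod h = 0) h w (g mod h) (axpy (- (g div h)) w v)"
  by pat_completeness auto
termination
  by (relation "measure (\<lambda>(b, g, v, h, w).
        if b then 0 else if h = 0 then nat \<bar>g\<bar> + 2 else nat \<bar>h\<bar> + 1)")
    (auto simp: abs_mod_less nat_less_iff)

fun zeros :: "int list \<Rightarrow> int list" where
  "zeros [] = []"
| "zeros (x # xs) = 0 # zeros xs"

fun append_row :: "(int \<times> int list) \<times> int list \<Rightarrow> int list list \<Rightarrow> (int \<times> int list) \<times> int list list" where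
  "append_row (p, w) rest = (p, w # rest)"

fun pivot :: "(int \<times> int list) \<times> int list list \<Rightarrow> int \<Rightarrow> int list \<Rightarrow> (int \<times> int list) \<times> int list list" where
  "pivot ((g, v), rest) h w = append_row (euclid (h = 0) g v h w) rest"

text \<open>
  Clears the first column: the result \<open>((g, v), rest)\<close> stands for the pivot row \<open>g # v\<close> together with
  the rows \<open>0 # r\<close> for \<open>r\<close> in \<open>rest\<close>. The argument \<open>z\<close> is a zero row.
\<close>
fun eliminate :: "int list \<Rightarrow> int list list \<Rightarrow> (int \<times> int list) \<times> int list list" where
  "eliminate z [] = ((0, z), [])"
| "eliminate z ([] # rows) = eliminate z rows"
| "eliminate z ((h # w) # rows) = pivot (eliminate z rows) h w"

fun snoc_zero :: "int list list \<Rightarrow> int list list" where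
  "snoc_zero [] = []"
| "snoc_zero (r # rs) = (r @ [0]) # snoc_zero rs"

text \<open>
  If the pivot divides the rest of its row, then a change of basis splits off a cyclic summand.
  Otherwise the rest is reduced modulo the pivot and the first column is moved to the end: the
  nonzero remainders are smaller than the pivot, so that the process ends after few rounds. The number
  \<open>f\<close> bounds the rounds; \<open>None\<close> reports that it was too small, so that correctness does not depend on it.
\<close>
fun diagonalize :: "nat \<Rightarrow> int list \<Rightarrow> (int \<times> int list) \<times> int list list \<Rightarrow> int list option"
  and diagonalize_step :: "nat \<Rightarrow> int list \<Rightarrow> bool \<Rightarrow> int \<Rightarrow> int list \<Rightarrow> int list list \<Rightarrow> int list option" where
  "diagonalize f ds ((g, v), rest) = diagonalize_step f ds (dvd_row g v) g v rest"
| "diagonalize_step 0 ds b g v rest = None"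
| "diagonalize_step (Suc f) ds True g [] rest = Some (g # ds)"
| "diagonalize_step (Suc f) ds True g (x # v) rest = diagonalize f (g # ds) (eliminate (zeros v) rest)"
| "diagonalize_step (Suc f) ds False g v rest =
    diagonalize f ds (eliminate (zeros v) ((mod_row g v @ [g]) # snoc_zero rest))"

lemma length_mod_row [simp]: "length (mod_row g v) = length v" by (induction v) auto
lemma length_div_row [simp]: "length (div_row g v) = length v" by (induction v) auto
lemma zeros_eq [simp]: "zeros v = replicate (length v) 0" by (induction v) auto
lemma set_snoc_zero [simp]: "set (snoc_zero rs) = (\<lambda>r. r @ [0]) ` set rs" by (induction rs) auto

lemma div_mod_row: "axpy g (div_row g v) (mod_row g v) = v"
  by (induction v) (auto simp: mult.commute)

lemma mod_row_dvd: "dvd_row g v \<Longrightarrow> mod_row g v = replicate (length v) 0"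
  by (induction v) auto

lemma int_rows_insert [simp]: "int_rows n (insert r S) \<longleftrightarrow> length r = n \<and> int_rows n S"
  by (auto simp: int_rows_def)

lemma int_rows_empty [simp]: "int_rows n {}"
  by (auto simp: int_rows_def)

lemma int_rows_image_Cons [simp]: "int_rows (Suc n) ((#) a ` S) \<longleftrightarrow> int_rows n S"
  by (auto simp: int_rows_def)

lemma int_span_superset:
  assumes "int_rows n S'" "S \<subseteq> S'" "int_span n S v"
  shows "int_span n S' v"
proof -
  interpret int_rows n S using assms by (auto simp: int_rows_def)
  show ?thesis using span_mono[OF assms(1) _ assms(3)] int_rows.row_in_span[OF assms(1)] assms(2) by blast
qed

lemma int_span_Un_cong:
  assumes "int_span n S = int_span n S'" "int_rows n S" "int_rows n S'" "int_rows n X"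
  shows "int_span n (X \<union> S) = int_span n (X \<union> S')"
proof -
  have *: "int_rows n (X \<union> S)" "int_rows n (X \<union> S')" using assms by (auto simp: int_rows_def)
  have "int_span n (X \<union> S') r" if "r \<in> X \<union> S" for r
    using that assms(1) int_rows.row_in_span[OF assms(2)] int_rows.row_in_span[OF *(2)]
      int_span_superset[OF *(2), of S'] by auto
  moreover have "int_span n (X \<union> S) r" if "r \<in> X \<union> S'" for r
    using that assms(1) int_rows.row_in_span[OF assms(3)] int_rows.row_in_span[OF *(1)]
      int_span_superset[OF *(1), of S] by auto
  ultimately show ?thesis using int_span_eqI[OF *] by blast
qed

lemma int_span_replace_row:
  assumes "length r = n" "length s = n"
  shows "int_span n {s, r} = int_span n {s, axpy k s r}"
proof (rule int_span_eqI)
  have undo: "axpy (- k) s (axpy k s r) = r"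
    by (rule nth_equalityI) (use assms in \<open>auto simp: nth_axpy\<close>)
  show 1: "int_rows n {s, r}" and 2: "int_rows n {s, axpy k s r}" using assms by auto
  show "int_span n {s, axpy k s r} t" if "t \<in> {s, r}" for t
    using that int_rows.row_in_span[OF 2] int_rows.span_axpy[OF 2, of s "axpy k s r" "- k"] undo
    by auto
  show "int_span n {s, r} t" if "t \<in> {s, axpy k s r}" for t
    using that int_rows.row_in_span[OF 1] int_rows.span_axpy[OF 1, of s r k] by auto
qed

lemma euclid_span:
  assumes "euclid b g v h w = ((g', v'), w')" "b \<longrightarrow> h = 0" "length v = m" "length w = m"
  shows "length v' = m \<and> length w' = m \<and>
    int_span (Suc m) {g # v, h # w} = int_span (Suc m) {g' # v', 0 # w'}"
  using assms
proof (induction b g v h w rule: euclid.induct)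
  case (1 g v h w)
  then show ?case by auto
next
  case (2 g v h w)
  let ?u = "axpy (- (g div h)) w v"
  have "(g mod h) # ?u = axpy (- (g div h)) (h # w) (g # v)"
    by (simp add: minus_div_mult_eq_mod[symmetric])
  then have "int_span (Suc m) {h # w, g # v} = int_span (Suc m) {h # w, (g mod h) # ?u}"
    using int_span_replace_row[of "g # v" "Suc m" "h # w" "- (g div h)"] 2 by simp
  with 2 show ?case by (simp add: insert_commute)
qed

lemma eliminate_span:
  assumes "eliminate (replicate m 0) rows = ((g, v), rest)" "int_rows (Suc m) (set rows)"
  shows "length v = m \<and> int_rows m (set rest) \<and>
    int_span (Suc m) (set rows) = int_span (Suc m) (insert (g # v) ((#) 0 ` set rest))"
  using assms
proof (induction "replicate m (0::int)" rows arbitrary: g v rest rule: eliminate.induct)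
  case 1
  have "int_span (Suc m) {} = int_span (Suc m) {replicate (Suc m) 0}"
    by (rule int_span_eqI) (auto simp: int_span.zero simp del: replicate_Suc)
  with 1 show ?case by auto
next
  case (2 rows)
  then show ?case by auto
next
  case (3 h w rows)
  obtain g1 v1 rest1 where e: "eliminate (replicate m 0) rows = ((g1, v1), rest1)"
    by (metis prod.exhaust)
  have IH: "length v1 = m" "int_rows m (set rest1)"
    "int_span (Suc m) (set rows) = int_span (Suc m) (insert (g1 # v1) ((#) 0 ` set rest1))"
    using 3 e by auto
  obtain w' where eu: "euclid (h = 0) g1 v1 h w = ((g, v), w')" and rest: "rest = w' # rest1"
    using "3.prems"(1) e by (cases "euclid (h = 0) g1 v1 h w") auto
  have w: "length w = m" using 3 by auto
  note E = euclid_span[OF eu _ IH(1) w, simplified]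
  have "int_span (Suc m) (set ((h # w) # rows)) = int_span (Suc m) ({h # w} \<union> set rows)" by simp
  also have "\<dots> = int_span (Suc m) ({h # w} \<union> (insert (g1 # v1) ((#) 0 ` set rest1)))"
    by (rule int_span_Un_cong[OF IH(3)]) (use "3.prems" IH w in auto)
  also have "\<dots> = int_span (Suc m) (((#) 0 ` set rest1) \<union> {g1 # v1, h # w})"
    by (simp add: insert_commute)
  also have "\<dots> = int_span (Suc m) (((#) 0 ` set rest1) \<union> {g # v, 0 # w'})"
    using int_span_Un_cong[of "Suc m" "{g1 # v1, h # w}" "{g # v, 0 # w'}"] E IH w by simp
  finally show ?case using E IH rest by (auto simp: insert_commute)
qed

text \<open>
  The coefficient \<open>j\<close> of the pivot row can be read off from the first coordinate, except when
  \<open>g = 0\<close>; hence the existential quantifier.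
\<close>
lemma span_pivot:
  assumes S: "int_rows m S" and v: "length v = m" and c: "length c = m"
  shows "int_span (Suc m) (insert (g # v) ((#) 0 ` S)) (k # c) \<longleftrightarrow>
    (\<exists>j. k = j * g \<and> int_span m S (axpy (- j) v c))"
proof
  let ?R = "insert (g # v) ((#) 0 ` S)"
  interpret S: int_rows m S by fact
  interpret R: int_rows "Suc m" ?R using S v by simp
  have "\<exists>j. hd u = j * g \<and> int_span m S (axpy (- j) v (tl u))" if "int_span (Suc m) ?R u" for u
    using that
  proof (induction rule: int_span.induct)
    case zero
    have "axpy 0 v (replicate m 0) = replicate m 0"
      by (rule nth_equalityI) (use v in \<open>auto simp: nth_axpy\<close>)
    then show ?case by (auto intro!: exI[of _ 0] simp: int_span.zero)
  next
    case (step u r i)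
    then obtain j where j: "hd u = j * g" "int_span m S (axpy (- j) v (tl u))" by blast
    obtain a u' where u: "u = a # u'" "length u' = m"
      using R.length_span[OF step.hyps(1)] by (metis length_Suc_conv)
    from step.hyps(2) consider "r = g # v" | s where "s \<in> S" "r = 0 # s" by auto
    then show ?case
    proof cases
      case 1
      have "axpy (- (i + j)) v (axpy i v u') = axpy (- j) v u'"
        by (rule nth_equalityI) (use v u in \<open>auto simp: nth_axpy algebra_simps\<close>)
      then show ?thesis using 1 u j by (intro exI[of _ "i + j"]) (auto simp: algebra_simps)
    next
      case 2
      have "axpy (- j) v (axpy i s u') = axpy i s (axpy (- j) v u')"
        by (rule nth_equalityI) (use v u S.length_row[OF 2(1)] in \<open>auto simp: nth_axpy algebra_simps\<close>)
      then show ?thesis using 2 u j int_span.step[OF j(2) 2(1)] by (intro exI[of _ j]) auto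
    qed
  qed
  from this[of "k # c"] show "int_span (Suc m) ?R (k # c) \<Longrightarrow>
      \<exists>j. k = j * g \<and> int_span m S (axpy (- j) v c)" by simp
  assume "\<exists>j. k = j * g \<and> int_span m S (axpy (- j) v c)"
  then obtain j where j: "k = j * g" "int_span m S (axpy (- j) v c)" by blast
  have "int_span (Suc m) ?R (0 # axpy (- j) v c)"
    by (rule S.span_image[OF _ _ R.int_rows_axioms _ j(2)]) (auto intro: R.row_in_span)
  then have "int_span (Suc m) ?R (axpy j (g # v) (0 # axpy (- j) v c))"
    using R.span_axpy[OF R.row_in_span] by blast
  moreover have "axpy j v (axpy (- j) v c) = c"
    by (rule nth_equalityI) (use v c in \<open>auto simp: nth_axpy\<close>)
  ultimately show "int_span (Suc m) ?R (k # c)" using j by simp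
qed

context comm_group
begin

text \<open>
  Here a row with a single entry becomes a cyclic summand. The proof runs against the algorithm: the
  last summand is taken back among the generators.
\<close>
lemma presents_split:
  assumes "presents G (g # ds) m S" "int_rows m S"
  shows "presents G ds (Suc m) (insert (g # replicate m 0) ((#) 0 ` S))"
proof -
  obtain ys0 xs where len: "length ys0 = Suc (length ds)" "length xs = m"
    and carr: "set ys0 \<subseteq> carrier G" "set xs \<subseteq> carrier G"
    and gen: "\<And>t. t \<in> carrier G \<Longrightarrow> \<exists>e c. length e = Suc (length ds) \<and> length c = m \<and> t = lin G e ys0 \<otimes> lin G c xs"
    and ker: "\<And>e c. length e = Suc (length ds) \<Longrightarrow> length c = m \<Longrightarrow>
      lin G e ys0 \<otimes> lin G c xs = \<one> \<longleftrightarrow> list_all2 (dvd) (g # ds) e \<and> int_span m S c"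
    using assms(1) unfolding presents_def by fastforce
  obtain y ys where ys0: "ys0 = y # ys" using len(1) by (metis length_Suc_conv)
  have y: "y \<in> carrier G" and ys: "set ys \<subseteq> carrier G" using carr(1) ys0 by auto
  have key: "lin G e ys \<otimes> lin G (k # c) (y # xs) = lin G (k # e) ys0 \<otimes> lin G c xs" for e k c
    using y ys carr(2) by (simp add: ys0 m_ac)
  have "\<exists>e c. length e = length ds \<and> length c = Suc m \<and> t = lin G e ys \<otimes> lin G c (y # xs)"
    if t: "t \<in> carrier G" for t
  proof -
    obtain e0 c where ec: "length e0 = Suc (length ds)" "length c = m" "t = lin G e0 ys0 \<otimes> lin G c xs"
      using gen[OF t] by blast
    obtain k e where "e0 = k # e" "length e = length ds" using ec(1) by (metis length_Suc_conv)
    then show ?thesis using ec key[of e k c] by (intro exI[of _ e] exI[of _ "k # c"]) simp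
  qed
  moreover have "lin G e ys \<otimes> lin G c (y # xs) = \<one> \<longleftrightarrow>
      list_all2 (dvd) ds e \<and> int_span (Suc m) (insert (g # replicate m 0) ((#) 0 ` S)) c"
    if e: "length e = length ds" and c0: "length c = Suc m" for e c
  proof -
    obtain k c' where c: "c = k # c'" "length c' = m" using c0 by (metis length_Suc_conv)
    have "axpy (- j) (replicate m 0) c' = c'" for j using c by simp
    then have "int_span (Suc m) (insert (g # replicate m 0) ((#) 0 ` S)) c \<longleftrightarrow> g dvd k \<and> int_span m S c'"
      using span_pivot[OF assms(2) length_replicate c(2), of g 0 k] c
      by (auto simp: dvd_def mult.commute)
    then show ?thesis using key[of e k c'] ker[of "k # e" c'] e c by auto
  qed
  ultimately show ?thesis
    unfolding presents_def using len carr y ys ys0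
    by (intro exI[of _ ys] exI[of _ "y # xs"]) auto
qed

text \<open>
  Subtracting multiples of the first column from the others changes only the pivot row, since all other
  rows begin with \<open>0\<close>. To undo this, the first generator \<open>x\<close> is replaced by \<open>x - \<Sum>\<^sub>i u\<^sub>i x\<^sub>i\<close>.
\<close>
lemma presents_shear:
  assumes "presents G ds (Suc m) (insert (g # w) ((#) 0 ` S))" "int_rows m S"
    and "length w = m" "length u = m"
  shows "presents G ds (Suc m) (insert (g # axpy g u w) ((#) 0 ` S))"
proof -
  let ?R = "insert (g # w) ((#) 0 ` S)" and ?R' = "insert (g # axpy g u w) ((#) 0 ` S)"
  obtain ys xs0 where len: "length ys = length ds" "length xs0 = Suc m"
    and carr: "set ys \<subseteq> carrier G" "set xs0 \<subseteq> carrier G"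
    and gen: "\<And>t. t \<in> carrier G \<Longrightarrow> \<exists>e c. length e = length ds \<and> length c = Suc m \<and> t = lin G e ys \<otimes> lin G c xs0"
    and ker: "\<And>e c. length e = length ds \<Longrightarrow> length c = Suc m \<Longrightarrow>
      lin G e ys \<otimes> lin G c xs0 = \<one> \<longleftrightarrow> list_all2 (dvd) ds e \<and> int_span (Suc m) ?R c"
    using assms(1) unfolding presents_def by blast
  obtain x xs where xs0: "xs0 = x # xs" using len(2) by (metis length_Suc_conv)
  have x: "x \<in> carrier G" and xs: "set xs \<subseteq> carrier G" "length xs = m" using carr(2) xs0 len by auto
  define x' where "x' = x \<otimes> inv (lin G u xs)"
  have x': "x' \<in> carrier G" using x xs by (simp add: x'_def)
  have key: "lin G (k # c) (x' # xs) = lin G (k # axpy (- k) u c) xs0" if "length c = m" for k c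
    using x xs that assms(4)
    by (simp add: xs0 x'_def lin_axpy int_pow_distrib int_pow_inv int_pow_neg m_assoc)
  have "\<exists>e c. length e = length ds \<and> length c = Suc m \<and> t = lin G e ys \<otimes> lin G c (x' # xs)"
    if t: "t \<in> carrier G" for t
  proof -
    obtain e c0 where ec: "length e = length ds" "length c0 = Suc m" "t = lin G e ys \<otimes> lin G c0 xs0"
      using gen[OF t] by blast
    obtain k c where c0: "c0 = k # c" "length c = m" using ec(2) by (metis length_Suc_conv)
    have "axpy (- k) u (axpy k u c) = c"
      by (rule nth_equalityI) (use c0 assms(4) in \<open>auto simp: nth_axpy\<close>)
    then show ?thesis using ec c0 assms(4) key[of "axpy k u c" k]
      by (intro exI[of _ e] exI[of _ "k # axpy k u c"]) simp
  qed
  moreover have "lin G e ys \<otimes> lin G c (x' # xs) = \<one> \<longleftrightarrow>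
      list_all2 (dvd) ds e \<and> int_span (Suc m) ?R' c"
    if e: "length e = length ds" and c0: "length c = Suc m" for e c
  proof -
    obtain k c' where c: "c = k # c'" "length c' = m" using c0 by (metis length_Suc_conv)
    have "axpy (- j) (axpy g u w) c' = axpy (- j) w (axpy (- (j * g)) u c')" for j
      by (rule nth_equalityI) (use c assms(3,4) in \<open>auto simp: nth_axpy algebra_simps\<close>)
    then have "int_span (Suc m) ?R' (k # c') \<longleftrightarrow> int_span (Suc m) ?R (k # axpy (- k) u c')"
      using span_pivot[OF assms(2), of "axpy g u w" c' g k] c assms(3,4)
        span_pivot[OF assms(2), of w "axpy (- k) u c'" g k] by auto
    then show ?thesis using key[of c' k] ker[of e "k # axpy (- k) u c'"] e c assms(4) by auto
  qed
  ultimately show ?thesis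
    unfolding presents_def using len carr x' xs
    by (intro exI[of _ ys] exI[of _ "x' # xs"]) auto
qed

lemma presents_rotate:
  assumes "presents G ds (Suc m) ((\<lambda>v. tl v @ [hd v]) ` S)" and S: "int_rows (Suc m) S"
  shows "presents G ds (Suc m) S"
proof -
  let ?\<phi> = "\<lambda>v::int list. tl v @ [hd v]" and ?\<psi> = "\<lambda>v::int list. last v # butlast v"
  interpret S: int_rows "Suc m" S by fact
  interpret R: int_rows "Suc m" "?\<phi> ` S" using S.length_row by unfold_locales auto
  have inv: "?\<psi> (?\<phi> v) = v" if "length v = Suc m" for v using that by (cases v) auto
  have lin_\<phi>: "?\<phi> (axpy k u v) = axpy k (?\<phi> u) (?\<phi> v)" if "length u = Suc m" "length v = Suc m" for k u v
    using that by (cases u; cases v) (auto simp: axpy_snoc)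
  have lin_\<psi>: "?\<psi> (axpy k u v) = axpy k (?\<psi> u) (?\<psi> v)" if "length u = Suc m" "length v = Suc m" for k u v
    using that by (cases u rule: rev_cases; cases v rule: rev_cases)
      (auto simp: axpy_snoc)
  have span: "int_span (Suc m) (?\<phi> ` S) (?\<phi> c) \<longleftrightarrow> int_span (Suc m) S c" if c: "length c = Suc m" for c
  proof
    assume "int_span (Suc m) (?\<phi> ` S) (?\<phi> c)"
    then have "int_span (Suc m) S (?\<psi> (?\<phi> c))"
      by (rule R.span_image[rotated -1])
        (use lin_\<psi> inv S.length_row S.row_in_span S.int_rows_axioms in \<open>auto simp: replicate_append_same[symmetric] simp del: butlast_append\<close>)
    then show "int_span (Suc m) S c" using inv[OF c] by simp
  next
    assume "int_span (Suc m) S c"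
    then show "int_span (Suc m) (?\<phi> ` S) (?\<phi> c)"
      by (rule S.span_image[rotated -1])
        (use lin_\<phi> R.row_in_span R.int_rows_axioms in \<open>auto simp: replicate_append_same\<close>)
  qed
  obtain ys xs0 where len: "length ys = length ds" "length xs0 = Suc m"
    and carr: "set ys \<subseteq> carrier G" "set xs0 \<subseteq> carrier G"
    and gen: "\<And>t. t \<in> carrier G \<Longrightarrow> \<exists>e c. length e = length ds \<and> length c = Suc m \<and> t = lin G e ys \<otimes> lin G c xs0"
    and ker: "\<And>e c. length e = length ds \<Longrightarrow> length c = Suc m \<Longrightarrow>
      lin G e ys \<otimes> lin G c xs0 = \<one> \<longleftrightarrow> list_all2 (dvd) ds e \<and> int_span (Suc m) (?\<phi> ` S) c"
    using assms(1) unfolding presents_def by blast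
  obtain xs x where xs0: "xs0 = xs @ [x]" using len(2) by (metis length_Suc_conv_rev)
  have x: "x \<in> carrier G" and xs: "set xs \<subseteq> carrier G" "length xs = m" using carr(2) xs0 len by auto
  have key: "lin G (?\<phi> c) xs0 = lin G c (x # xs)" if "length c = Suc m" for c
    using that x xs by (cases c) (auto simp: xs0 lin_append m_comm)
  have "\<exists>e c. length e = length ds \<and> length c = Suc m \<and> t = lin G e ys \<otimes> lin G c (x # xs)"
    if t: "t \<in> carrier G" for t
  proof -
    obtain e c where ec: "length e = length ds" "length c = Suc m" "t = lin G e ys \<otimes> lin G c xs0"
      using gen[OF t] by blast
    have "?\<phi> (?\<psi> c) = c" using ec(2) by (cases c rule: rev_cases) auto
    then show ?thesis using ec key[of "?\<psi> c"] by (intro exI[of _ e] exI[of _ "?\<psi> c"]) auto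
  qed
  moreover have "lin G e ys \<otimes> lin G c (x # xs) = \<one> \<longleftrightarrow>
      list_all2 (dvd) ds e \<and> int_span (Suc m) S c"
    if "length e = length ds" "length c = Suc m" for e c
    using that key[of c] ker[of e "?\<phi> c"] span[of c] by auto
  ultimately show ?thesis
    unfolding presents_def using len carr x xs
    by (intro exI[of _ ys] exI[of _ "x # xs"]) auto
qed

lemma presents_of_basis:
  assumes "basis G ys ds"
  shows "presents G ds 0 S"
  using assms unfolding basis_def presents_def
  by (intro exI[of _ ys] exI[of _ "[]"]) (fastforce intro: int_span.zero[of 0, simplified])

lemma presents_cong:
  "int_span n S = int_span n S' \<Longrightarrow> presents G ds n S \<longleftrightarrow> presents G ds n S'"
  by (simp add: presents_def)

theorem diagonalize_presents:
  assumes "basis G ys ds'"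
  shows "diagonalize f ds st = Some ds' \<Longrightarrow> st = ((g, v), rest) \<Longrightarrow> int_rows (length v) (set rest) \<Longrightarrow>
      presents G ds (Suc (length v)) (insert (g # v) ((#) 0 ` set rest))"
    and "diagonalize_step f ds b g v rest = Some ds' \<Longrightarrow> int_rows (length v) (set rest) \<Longrightarrow> b \<longrightarrow> dvd_row g v \<Longrightarrow>
      presents G ds (Suc (length v)) (insert (g # v) ((#) 0 ` set rest))"
proof (induction f ds st and f ds b g v rest arbitrary: g v rest and rule: diagonalize_diagonalize_step.induct)
  case (1 f ds g v rest)
  then show ?case by auto
next
  case (2 ds b g v rest)
  then show ?case by simp
next
  case (3 f ds g rest)
  then have "presents G (g # ds) 0 (set rest)" using presents_of_basis[OF assms] by simp
  then show ?case using presents_split[of g ds 0 "set rest"] 3 by simp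
next
  case (4 f ds g x v rest)
  let ?m = "length v"
  obtain g' v' rest' where e: "eliminate (replicate ?m 0) rest = ((g', v'), rest')"
    by (metis prod.exhaust)
  note E = eliminate_span[OF e] 
  have "presents G (g # ds) (Suc ?m) (set rest)"
    using 4 e E presents_cong by (metis diagonalize_step.simps(3) length_Cons zeros_eq)
  from presents_split[OF this]
  have "presents G ds (Suc (Suc ?m)) (insert (g # replicate (Suc ?m) 0) ((#) 0 ` set rest))"
    using 4 by simp
  from presents_shear[OF this, of "div_row g (x # v)"]
  have "presents G ds (Suc (Suc ?m)) (insert (g # axpy g (div_row g (x # v)) (mod_row g (x # v))) ((#) 0 ` set rest))"
    using 4 mod_row_dvd[of g "x # v"] by simp
  then show ?case by (simp only: div_mod_row length_Cons)
next
  case (5 f ds g v rest)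
  let ?m = "length v"
  let ?rows = "(mod_row g v @ [g]) # snoc_zero rest"
  obtain g' v' rest' where e: "eliminate (replicate ?m 0) ?rows = ((g', v'), rest')"
    by (metis prod.exhaust)
  have rows: "int_rows (Suc ?m) (set ?rows)" using 5 by (auto simp: int_rows_def)
  note E = eliminate_span[OF e rows]
  have "presents G ds (Suc ?m) (set ?rows)"
    using 5 e E presents_cong by (metis diagonalize_step.simps(4) zeros_eq)
  moreover have "set ?rows = (\<lambda>v. tl v @ [hd v]) ` (insert (g # mod_row g v) ((#) 0 ` set rest))"
    by (auto simp: image_image)
  ultimately have "presents G ds (Suc ?m) (insert (g # mod_row g v) ((#) 0 ` set rest))"
    using presents_rotate[of ds ?m "insert (g # mod_row g v) ((#) 0 ` set rest)"] 5 by simp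
  from presents_shear[OF this, of "div_row g v"] show ?case using 5 by (simp add: div_mod_row)
qed

end

text \<open>Forty rounds are ample for matrices with at most sixteen columns and small entries.\<close>
definition diagonal_form :: "int list list \<Rightarrow> int list option" where
  "diagonal_form rows = diagonalize 40 [] (eliminate (zeros (tl (hd rows))) rows)"

lemma (in comm_group) diagonal_form_presents:
  assumes "diagonal_form rows = Some ds" "basis G ys ds" "int_rows n (set rows)" "rows \<noteq> []" "n > 0"
  shows "presents G [] n (set rows)"
proof -
  obtain m where n: "n = Suc m" using assms by (cases n) auto
  have "length (tl (hd rows)) = m" using assms n by (auto simp: int_rows_def)
  moreover obtain g v rest where e: "eliminate (replicate m 0) rows = ((g, v), rest)"
    by (metis prod.exhaust)
  ultimately show ?thesis
    using eliminate_span[OF e] assms n diagonalize_presents(1)[OF assms(2), of 40 "[]" _ g v rest]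
      presents_cong[of n "set rows"]
    unfolding diagonal_form_def by auto
qed

section \<open>Bases with prescribed orders\<close>

definition has_basis :: "('a, 'b) monoid_scheme \<Rightarrow> int list \<Rightarrow> bool" where
  "has_basis T ds \<longleftrightarrow> (\<exists>ys. basis T ys ds)"

lemma list_all2_dvd_zero: "list_all2 (dvd) ds (replicate (length ds) (0::int))"
  by (induction ds) auto

context comm_group
begin

lemma lin_finprod:
  assumes "length c = length ys" "set ys \<subseteq> carrier G"
  shows "lin G c ys = finprod G (\<lambda>i. ys ! i [^] c ! i) {..<length ys}"
  using assms
proof (induction c ys rule: list_induct2)
  case Nil
  then show ?case by simp
next
  case (Cons k c y ys)
  have mem: "ys ! i \<in> carrier G" if "i < length ys" for i using Cons.prems that by auto
  have y: "y \<in> carrier G" using Cons.prems by auto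
  have eq: "{..<length (y # ys)} = insert 0 (Suc ` {..<length ys})"
    by (auto simp: image_iff less_Suc_eq_0_disj)
  have "finprod G (\<lambda>i. (y # ys) ! i [^] (k # c) ! i) {..<length (y # ys)} =
    y [^] k \<otimes> finprod G (\<lambda>i. (y # ys) ! i [^] (k # c) ! i) (Suc ` {..<length ys})"
    using mem y by (subst eq, subst finprod_insert) auto
  also have "finprod G (\<lambda>i. (y # ys) ! i [^] (k # c) ! i) (Suc ` {..<length ys}) =
    finprod G (\<lambda>i. ys ! i [^] c ! i) {..<length ys}"
    using mem by (subst finprod_reindex) auto
  finally show ?case using Cons by simp
qed

lemma lin_permute:
  assumes "p permutes {..<length ys}" "length c = length ys" "set ys \<subseteq> carrier G"
  shows "lin G (permute_list p c) (permute_list p ys) = lin G c ys"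
proof -
  have mem: "ys ! i \<in> carrier G" if "i < length ys" for i using assms(3) that by auto
  have img: "p ` {..<length ys} = {..<length ys}" using assms(1) by (rule permutes_image)
  have "lin G (permute_list p c) (permute_list p ys) =
      finprod G (\<lambda>i. ys ! p i [^] c ! p i) {..<length ys}"
    using assms mem permutes_in_image[OF assms(1)]
    by (subst lin_finprod) (auto simp: permute_list_nth intro!: finprod_cong)
  also have "\<dots> = finprod G (\<lambda>i. ys ! i [^] c ! i) (p ` {..<length ys})"
    by (rule finprod_reindex[symmetric, OF _ permutes_inj_on[OF assms(1)]]) (use mem img in auto)
  finally show ?thesis using img lin_finprod[OF assms(2,3)] by simp
qed

lemma has_basis_permute:
  assumes "has_basis G ds" "mset ds' = mset ds"
  shows "has_basis G ds'"
proof -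
  obtain ys where b: "basis G ys ds" using assms(1) by (auto simp: has_basis_def)
  obtain p where p: "p permutes {..<length ds}" "permute_list p ds = ds'"
    using mset_eq_permutation[OF assms(2)] by blast
  have len: "length ys = length ds" and carr: "set ys \<subseteq> carrier G" using b by (auto simp: basis_def)
  have p': "p permutes {..<length ys}" using p len by simp
  have surj: "\<exists>c'. length c' = length ds \<and> permute_list p c' = c" if "length c = length ds" for c
  proof -
    have "permute_list p (permute_list (Hilbert_Choice.inv p) c) = c"
      using p(1) that permute_list_compose[of p c "Hilbert_Choice.inv p"]
      by (simp add: permutes_inv_o)
    then show ?thesis using that by (intro exI[of _ "permute_list (Hilbert_Choice.inv p) c"]) simp
  qed
  have "\<exists>c. length c = length ds' \<and> t = lin G c (permute_list p ys)" if t: "t \<in> carrier G" for t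
  proof -
    obtain c where "length c = length ds" "t = lin G c ys" using b t by (auto simp: basis_def)
    then show ?thesis using lin_permute[OF p', of c] len carr p
      by (intro exI[of _ "permute_list p c"]) auto
  qed
  moreover have "lin G c (permute_list p ys) = \<one> \<longleftrightarrow> list_all2 (dvd) ds' c"
    if c: "length c = length ds'" for c
  proof -
    have "length c = length ds" using c p by auto
    from surj[OF this] obtain c' where c': "length c' = length ds" "permute_list p c' = c" by blast
    have "list_all2 (dvd) ds' c \<longleftrightarrow> list_all2 (dvd) ds c'"
      using list_all2_permute_list_iff[OF p(1), of "(dvd)" c'] unfolding p(2) c'(2) .
    then show ?thesis using lin_permute[OF p', of c'] c' len carr b by (auto simp: basis_def)
  qed
  ultimately have "basis G (permute_list p ys) ds'"
    using len carr p p' by (auto simp: basis_def)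
  then show ?thesis by (auto simp: has_basis_def)
qed

lemma has_basis_insert_one:
  assumes "has_basis G ds"
  shows "has_basis G (1 # ds)"
proof -
  obtain ys where b: "basis G ys ds" using assms by (auto simp: has_basis_def)
  have carr: "set ys \<subseteq> carrier G" using b by (auto simp: basis_def)
  have "\<exists>c. length c = Suc (length ds) \<and> t = lin G c (\<one> # ys)" if t: "t \<in> carrier G" for t
  proof -
    obtain c where "length c = length ds" "t = lin G c ys" using b t by (auto simp: basis_def)
    then show ?thesis using carr by (intro exI[of _ "0 # c"]) auto
  qed
  then have "basis G (\<one> # ys) (1 # ds)"
    using b carr by (auto simp: basis_def length_Suc_conv)
  then show ?thesis by (auto simp: has_basis_def)
qed

text \<open>The Chinese remainder theorem: \<open>x + y\<close> has order \<open>m n\<close> and generates the sum of the two summands.\<close>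
lemma has_basis_merge:
  assumes "has_basis G (m # n # ds)" "coprime m n"
  shows "has_basis G (m * n # ds)"
proof -
  obtain ys0 where b0: "basis G ys0 (m # n # ds)" using assms(1) by (auto simp: has_basis_def)
  then have "length ys0 = Suc (Suc (length ds))" by (simp add: basis_def)
  then obtain x y ys where ys0: "ys0 = x # y # ys" by (metis length_Suc_conv)
  note b = b0[unfolded ys0]
  have carr: "x \<in> carrier G" "y \<in> carrier G" "set ys \<subseteq> carrier G" using b by (auto simp: basis_def)
  have key: "lin G (c # cs) (x \<otimes> y # ys) = lin G (c # c # cs) (x # y # ys)" for c cs
    using carr by (simp add: int_pow_distrib m_ac)
  have "\<exists>c. length c = Suc (length ds) \<and> t = lin G c (x \<otimes> y # ys)" if t: "t \<in> carrier G" for t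
  proof -
    obtain c0 where c0: "length c0 = Suc (Suc (length ds))" "t = lin G c0 (x # y # ys)"
      using b t by (auto simp: basis_def)
    then obtain a e cs where c0': "c0 = a # e # cs" "length cs = length ds" by (metis length_Suc_conv nat.inject)
    obtain u v where uv: "u * m + v * n = 1" using assms(2) bezout_int[of m n] by (metis coprime_imp_gcd_eq_1)
    define c where "c = a * v * n + e * u * m"
    \<comment> \<open>Chinese remaindering: the exponent \<open>c\<close> is congruent to \<open>a\<close> mod \<open>m\<close> and to \<open>e\<close> mod \<open>n\<close>.\<close>
    have "c - a = m * (u * (e - a))" "c - e = n * (v * (a - e))"
      using uv unfolding c_def by algebra+
    then have "list_all2 (dvd) (m # n # ds) ((c - a) # (c - e) # replicate (length ds) 0)"
      by (simp add: list_all2_dvd_zero)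
    moreover have "length ((c - a) # (c - e) # replicate (length ds) 0) = length (m # n # ds)"
      by simp
    ultimately have "lin G ((c - a) # (c - e) # replicate (length ds) 0) (x # y # ys) = \<one>"
      using b unfolding basis_def by blast
    then have one: "x [^] (c - a) \<otimes> y [^] (c - e) = \<one>" using carr by simp
    have "x [^] c \<otimes> y [^] c = (x [^] (c - a) \<otimes> y [^] (c - e)) \<otimes> (x [^] a \<otimes> y [^] e)"
    proof -
      have "x [^] c = x [^] (c - a) \<otimes> x [^] a" "y [^] c = y [^] (c - e) \<otimes> y [^] e"
        using carr by (simp_all flip: int_pow_mult)
      then show ?thesis using carr by (simp add: m_ac)
    qed
    then have "x [^] c \<otimes> y [^] c = x [^] a \<otimes> y [^] e" using one carr by simp
    then have "lin G (c # cs) (x \<otimes> y # ys) = t"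
      using c0 c0' carr key by (simp flip: m_assoc)
    then show ?thesis using c0' by (intro exI[of _ "c # cs"]) auto
  qed
  moreover have "lin G c (x \<otimes> y # ys) = \<one> \<longleftrightarrow> list_all2 (dvd) (m * n # ds) c"
    if c: "length c = Suc (length ds)" for c
  proof -
    obtain k cs where c': "c = k # cs" "length cs = length ds" using c by (metis length_Suc_conv)
    have "m * n dvd k \<longleftrightarrow> m dvd k \<and> n dvd k"
      using assms(2) by (auto intro: divides_mult dvd_mult_left dvd_mult_right)
    moreover have "lin G (k # k # cs) (x # y # ys) = \<one> \<longleftrightarrow> list_all2 (dvd) (m # n # ds) (k # k # cs)"
      using b c' unfolding basis_def by (metis length_Cons)
    ultimately show ?thesis using key[of k cs] c' by auto
  qed
  ultimately have "basis G (x \<otimes> y # ys) (m * n # ds)" using b carr by (auto simp: basis_def)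
  then show ?thesis by (auto simp: has_basis_def)
qed

end

text \<open>
  The orders in question have the form \<open>2\<^sup>i\<close> or \<open>3 \<cdot> 2\<^sup>i\<close>, so separating a single factor \<open>3\<close> already
  gives the decomposition into prime powers.
\<close>
definition split3 :: "int \<Rightarrow> int list" where
  "split3 d = (if d mod 3 = 0 \<and> (d div 3) mod 3 \<noteq> 0 then [3, d div 3] else [d])"

fun drop_ones :: "int list \<Rightarrow> int list" where
  "drop_ones [] = []"
| "drop_ones (d # ds) = (if d = 1 then drop_ones ds else d # drop_ones ds)"

text \<open>
  A normal form for lists of orders: signs and trivial summands are irrelevant, and so is the order
  of the summands.
\<close>
definition primary_form :: "int list \<Rightarrow> int list" where
  "primary_form ds = sort (drop_ones (concat (map split3 (map abs ds))))"

context comm_group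
begin

lemma has_basis_drop_ones: "has_basis G (drop_ones ds @ es) \<Longrightarrow> has_basis G (ds @ es)"
proof (induction ds arbitrary: es)
  case (Cons d ds)
  show ?case
  proof (cases "d = 1")
    case True
    then show ?thesis using Cons has_basis_insert_one by auto
  next
    case False
    then have "has_basis G (drop_ones ds @ (d # es))"
      using has_basis_permute[OF Cons.prems] by simp
    from Cons.IH[OF this] show ?thesis using has_basis_permute by simp
  qed
qed simp

lemma has_basis_split3: "has_basis G (concat (map split3 ds) @ es) \<Longrightarrow> has_basis G (ds @ es)"
proof (induction ds arbitrary: es)
  case (Cons d ds)
  have "has_basis G (d # concat (map split3 ds) @ es)"
  proof (cases "d mod 3 = 0 \<and> (d div 3) mod 3 \<noteq> 0")
    case True
    let ?x = "d div 3"
    have "1 = ?x - 3 * (?x div 3) \<or> 1 = 3 * (?x div 3 + 1) - ?x" using True by presburger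
    then have "coprime 3 ?x" by (intro coprimeI) (metis dvd_diff dvd_mult2)
    moreover have "split3 d = [3, ?x]" "3 * ?x = d" using True by (auto simp: split3_def)
    ultimately show ?thesis
      using Cons.prems has_basis_merge[of 3 ?x "concat (map split3 ds) @ es"] by simp
  qed (use Cons.prems in \<open>auto simp: split3_def[of d]\<close>)
  then have "has_basis G (concat (map split3 ds) @ (d # es))"
    using has_basis_permute by simp
  from Cons.IH[OF this] show ?case using has_basis_permute by simp
qed simp

lemma has_basis_abs: "has_basis G (map abs ds) \<Longrightarrow> has_basis G ds"
  unfolding has_basis_def basis_def list_all2_map1 length_map abs_dvd_iff .

lemma has_basis_primary_form:
  assumes "primary_form ds = sort es" "has_basis G es"
  shows "has_basis G ds"
proof -
  have "has_basis G (drop_ones (concat (map split3 (map abs ds))))"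
    using assms has_basis_permute[OF assms(2)] unfolding primary_form_def by (metis mset_sort)
  then have "has_basis G (concat (map split3 (map abs ds)))"
    using has_basis_drop_ones[of _ "[]"] by (simp only: append_Nil2)
  then have "has_basis G (map abs ds)"
    using has_basis_split3[of _ "[]"] by (simp only: append_Nil2)
  then show ?thesis by (rule has_basis_abs)
qed

end

lemma comm_group_abelian_type: "comm_group (abelian_type k qs)"
proof (rule group.group_comm_groupI)
  show "group (abelian_type k qs)" unfolding abelian_type_def
    by (intro DirProd_group product_group group_integer_group group_integer_mod_group)
  show "\<And>x y. x \<in> carrier (abelian_type k qs) \<Longrightarrow> y \<in> carrier (abelian_type k qs) \<Longrightarrow>
      x \<otimes>\<^bsub>abelian_type k qs\<^esub> y = y \<otimes>\<^bsub>abelian_type k qs\<^esub> x"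
    by (auto simp: abelian_type_def add.commute)
qed

lemma hom_lin:
  assumes "comm_group G" "comm_group H" "h \<in> hom G H" "set xs \<subseteq> carrier G"
  shows "h (lin G c xs) = lin H c (map h xs)"
proof -
  interpret G: comm_group G by fact
  interpret H: comm_group H by fact
  interpret group_hom G H h using assms(3) by unfold_locales
  show ?thesis using assms(4)
  proof (induction xs arbitrary: c)
    case Nil
    then show ?case by (cases c) auto
  next
    case (Cons x xs)
    then show ?case by (cases c) (auto simp: hom_int_pow)
  qed
qed

lemma lin_integer_mod_group:
  assumes "length c = length zs" "set zs \<subseteq> carrier (integer_mod_group q)"
  shows "lin (integer_mod_group q) c zs = (\<Sum>i<length zs. c ! i * zs ! i) mod int q"
  using assms
proof (induction c zs rule: list_induct2)
  case Nil
  then show ?case by simp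
next
  case (Cons c cs z zs)
  then show ?case
    by (simp add: int_pow_integer_mod_group sum.lessThan_Suc_shift mod_simps del: sum.lessThan_Suc)
qed

lemma all_less_add: "(\<forall>i<k + l. P i) \<longleftrightarrow> (\<forall>i<k. P i) \<and> (\<forall>i<l. P (k + i))" for k l :: nat
  by (metis add_diff_inverse_nat nat_add_left_cancel_less trans_less_add1)

lemma has_basis_abelian_type: "has_basis (abelian_type k qs) (replicate k 0 @ map int qs)"
proof -
  let ?T = "abelian_type k qs" and ?l = "length qs"
  define ds where "ds = replicate k 0 @ map int qs"
  define e :: "nat \<Rightarrow> (nat \<Rightarrow> int) \<times> (nat \<Rightarrow> int)" where
    "e j = (\<lambda>i\<in>{..<k}. if i = j then 1 else 0, \<lambda>i\<in>{..<?l}. (if k + i = j then 1 else 0) mod int (qs ! i))" for j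
  define ys where "ys = map e [0..<k + ?l]"
  interpret T: comm_group ?T by (rule comm_group_abelian_type)
  have len: "length ys = length ds" "length ds = k + ?l" by (auto simp: ys_def ds_def)
  have carr: "set ys \<subseteq> carrier ?T"
  proof -
    have "e j \<in> carrier ?T" for j
      by (simp add: e_def abelian_type_def carrier_integer_mod_group)
    then show ?thesis by (auto simp: ys_def)
  qed
  have fst_hom: "(\<lambda>t. fst t i) \<in> hom ?T (integer_mod_group 0)" if "i < k" for i
    using that by (auto simp: hom_def abelian_type_def carrier_integer_mod_group PiE_iff)
  have snd_hom: "(\<lambda>t. snd t i) \<in> hom ?T (integer_mod_group (qs ! i))" if "i < ?l" for i
    using that by (auto simp: hom_def abelian_type_def PiE_iff)
  have fst_lin: "fst (lin ?T c ys) i = c ! i" if c: "length c = k + ?l" and i: "i < k" for c i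
  proof -
    let ?zs = "map (\<lambda>t. fst t i) ys"
    have "fst (lin ?T c ys) i = lin (integer_mod_group 0) c ?zs"
      using hom_lin[OF T.comm_group_axioms abelian_integer_mod_group fst_hom[OF i] carr] .
    also have "\<dots> = (\<Sum>j<length ?zs. c ! j * ?zs ! j) mod int 0"
      by (rule lin_integer_mod_group) (auto simp: c len carrier_integer_mod_group)
    also have "\<dots> = (\<Sum>j<k + ?l. c ! j * (if i = j then 1 else 0))"
      using i by (auto simp: ys_def e_def intro!: sum.cong)
    also have "\<dots> = c ! i" using i by (simp add: if_distrib cong: if_cong)
    finally show ?thesis .
  qed
  have snd_lin: "snd (lin ?T c ys) i = c ! (k + i) mod int (qs ! i)"
    if c: "length c = k + ?l" and i: "i < ?l" for c i
  proof -
    let ?zs = "map (\<lambda>t. snd t i) ys"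
    have "snd (lin ?T c ys) i = lin (integer_mod_group (qs ! i)) c ?zs"
      using hom_lin[OF T.comm_group_axioms abelian_integer_mod_group snd_hom[OF i] carr] .
    also have "\<dots> = (\<Sum>j<length ?zs. c ! j * ?zs ! j) mod int (qs ! i)"
      by (rule lin_integer_mod_group) (use i in \<open>auto simp: c len ys_def e_def carrier_integer_mod_group\<close>)
    also have "\<dots> = (\<Sum>j<k + ?l. c ! j * ((if k + i = j then 1 else 0) mod int (qs ! i))) mod int (qs ! i)"
      using i by (auto simp: ys_def e_def intro!: sum.cong arg_cong[where f = "\<lambda>x. x mod _"])
    also have "\<dots> = (\<Sum>j<k + ?l. c ! j * (if k + i = j then 1 else 0)) mod int (qs ! i)"
      by (subst (1 2) mod_sum_eq[symmetric]) (simp add: mod_mult_right_eq)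
    also have "\<dots> = c ! (k + i) mod int (qs ! i)" using i by (simp add: if_distrib cong: if_cong)
    finally show ?thesis .
  qed
  have ext: "s = t" if "s \<in> carrier ?T" "t \<in> carrier ?T"
      "\<And>i. i < k \<Longrightarrow> fst s i = fst t i" "\<And>i. i < ?l \<Longrightarrow> snd s i = snd t i" for s t
  proof (rule prod_eqI)
    show "fst s = fst t"
      by (rule PiE_ext[of _ "{..<k}" "\<lambda>_. UNIV"]) (use that in \<open>auto simp: abelian_type_def\<close>)
    show "snd s = snd t"
      by (rule PiE_ext[of _ "{..<?l}" "\<lambda>i. carrier (integer_mod_group (qs ! i))"])
        (use that in \<open>auto simp: abelian_type_def\<close>)
  qed
  have "\<exists>c. length c = length ds \<and> t = lin ?T c ys" if t: "t \<in> carrier ?T" for t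
  proof -
    let ?c = "map (fst t) [0..<k] @ map (snd t) [0..<?l]"
    have "snd t i mod int (qs ! i) = snd t i" if i: "i < ?l" for i
    proof -
      have "snd t i \<in> carrier (integer_mod_group (qs ! i))"
        using t i by (auto simp: abelian_type_def PiE_iff)
      then show ?thesis by (cases "qs ! i = 0") (auto simp: carrier_integer_mod_group)
    qed
    then have "t = lin ?T ?c ys"
      by (intro ext t T.lin_closed carr) (simp_all add: fst_lin snd_lin nth_append)
    then show ?thesis by (intro exI[of _ ?c]) (simp add: len)
  qed
  moreover have "lin ?T c ys = \<one>\<^bsub>?T\<^esub> \<longleftrightarrow> list_all2 (dvd) ds c" if "length c = length ds" for c
  proof -
    have c: "length c = k + ?l" using that len by simp
    have "lin ?T c ys = \<one>\<^bsub>?T\<^esub> \<longleftrightarrow>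
      (\<forall>i<k. fst (lin ?T c ys) i = 0) \<and> (\<forall>i<?l. snd (lin ?T c ys) i = 0)"
      using ext[OF T.lin_closed[OF carr] T.one_closed, of c] by (auto simp: abelian_type_def)
    also have "\<dots> \<longleftrightarrow> (\<forall>i<k. c ! i = 0) \<and> (\<forall>i<?l. int (qs ! i) dvd c ! (k + i))"
      by (simp add: fst_lin snd_lin c dvd_eq_mod_eq_0)
    also have "\<dots> \<longleftrightarrow> (\<forall>i<k + ?l. ds ! i dvd c ! i)"
      using all_less_add[of k ?l "\<lambda>i. ds ! i dvd c ! i"] by (simp add: ds_def nth_append)
    also have "\<dots> \<longleftrightarrow> list_all2 (dvd) ds c" using c len by (auto simp: list_all2_conv_all_nth)
    finally show ?thesis .
  qed
  ultimately have "basis ?T ys ds" using len carr by (auto simp: basis_def)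
  then show ?thesis by (auto simp: has_basis_def ds_def)
qed

definition has_type :: "int list list \<Rightarrow> nat \<Rightarrow> nat list \<Rightarrow> bool" where
  "has_type rows k qs \<longleftrightarrow>
    map_option primary_form (diagonal_form rows) = Some (sort (replicate k 0 @ map int qs))"

text \<open>
  The bridge from computation to groups. The unit vectors of \<open>abelian_type k qs\<close> form a basis with
  the tabulated orders; rearranging and merging it gives a basis with the computed orders, and
  running the diagonalization backwards gives generators whose relations are the given rows.
\<close>
theorem has_type_presents:
  assumes "has_type rows k qs" "int_rows n (set rows)" "rows \<noteq> []" "n > 0"
  shows "presents (abelian_type k qs) [] n (set rows)"
proof -
  interpret T: comm_group "abelian_type k qs" by (rule comm_group_abelian_type)
  obtain ds where ds: "diagonal_form rows = Some ds" "primary_form ds = sort (replicate k 0 @ map int qs)"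
    using assms(1) by (auto simp: has_type_def)
  obtain ys where "basis (abelian_type k qs) ys ds"
    using T.has_basis_primary_form[OF ds(2) has_basis_abelian_type] by (auto simp: has_basis_def)
  then show ?thesis using T.diagonal_form_presents[OF ds(1)] assms by blast
qed

lemma presents_generators:
  assumes "presents T [] n S" "comm_group T"
  obtains xs where "length xs = n" "set xs \<subseteq> carrier T"
    "\<And>t. t \<in> carrier T \<Longrightarrow> \<exists>c. length c = n \<and> t = lin T c xs"
    "\<And>c. length c = n \<Longrightarrow> lin T c xs = \<one>\<^bsub>T\<^esub> \<longleftrightarrow> int_span n S c"
proof -
  interpret T: comm_group T by fact
  obtain xs where xs: "length xs = n" "set xs \<subseteq> carrier T"
    and gen: "\<And>t. t \<in> carrier T \<Longrightarrow> \<exists>c. length c = n \<and> t = \<one>\<^bsub>T\<^esub> \<otimes>\<^bsub>T\<^esub> lin T c xs"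
    and ker: "\<And>c. length c = n \<Longrightarrow> \<one>\<^bsub>T\<^esub> \<otimes>\<^bsub>T\<^esub> lin T c xs = \<one>\<^bsub>T\<^esub> \<longleftrightarrow> int_span n S c"
    using assms(1) unfolding presents_def by auto
  have closed: "lin T c xs \<in> carrier T" for c using xs by auto
  show ?thesis using that[of xs] xs gen ker closed by simp
qed

section \<open>Cokernels\<close>

lemma comm_group_int_vectors: "comm_group (int_vectors I)"
proof (rule group.group_comm_groupI)
  show "group (int_vectors I)" by (simp add: int_vectors_def)
qed (auto simp: int_vectors_def add.commute)

definition matrix_columns :: "('i \<Rightarrow> 'i \<Rightarrow> int) \<Rightarrow> 'i list \<Rightarrow> int list list" where
  "matrix_columns M is = map (\<lambda>r. map (\<lambda>s. M s r) is) is"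

lemma map_matrix_apply_span:
  assumes "set is = I" "distinct is"
    and "int_rows (length is) S" "set (matrix_columns M is) \<subseteq> S"
  shows "int_span (length is) S (map (matrix_apply I M v) is)"
proof -
  interpret int_rows "length is" S by fact
  have "int_span (length is) S (map (\<lambda>s. \<Sum>r\<in>F. M s r * v r) is)" if "finite F" "F \<subseteq> I" for F
    using that
  proof (induction F)
    case empty
    then show ?case using int_span.zero[of "length is" S] by (simp add: map_replicate_const)
  next
    case (insert r F)
    have "map (\<lambda>s. M s r) is \<in> S"
      using assms(1,4) insert.prems by (auto simp: matrix_columns_def)
    from int_span.step[OF insert.IH this, of "v r"] insert.prems
    have "int_span (length is) S (axpy (v r) (map (\<lambda>s. M s r) is) (map (\<lambda>s. \<Sum>r\<in>F. M s r * v r) is))"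
      by simp
    also have "axpy (v r) (map (\<lambda>s. M s r) is) (map (\<lambda>s. \<Sum>r\<in>F. M s r * v r) is) =
        map (\<lambda>s. \<Sum>r\<in>insert r F. M s r * v r) is"
      using insert by (auto intro!: nth_equalityI simp: nth_axpy)
    finally show ?case .
  qed
  from this[of I] assms(1) have "int_span (length is) S (map (\<lambda>s. \<Sum>r\<in>I. M s r * v r) is)"
    by auto
  also have "map (\<lambda>s. \<Sum>r\<in>I. M s r * v r) is = map (matrix_apply I M v) is"
    using assms(1) by (auto simp: matrix_apply_def)
  finally show ?thesis .
qed

lemma matrix_apply_add_column:
  assumes "finite I" "r \<in> I" "s \<in> I"
  shows "matrix_apply I M (v(r := v r + k)) s = k * M s r + matrix_apply I M v s"
proof -
  have "(\<Sum>t\<in>I. M s t * (v(r := v r + k)) t) = (\<Sum>t\<in>I. M s t * v t + (if t = r then M s r * k else 0))"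
    by (rule sum.cong) (auto simp: algebra_simps)
  also have "\<dots> = (\<Sum>t\<in>I. M s t * v t) + M s r * k"
    using assms by (simp add: sum.distrib)
  finally show ?thesis using assms by (simp add: matrix_apply_def mult.commute)
qed

text \<open>
  A vector \<open>v\<close> is sent to the combination with coefficients \<open>v\<close> of the generators of \<open>T\<close>. This is onto,
  and its kernel, the span of the columns of both matrices, is the image that is divided out.
\<close>
theorem coker_iso:
  assumes "set is = I" "distinct is" "comm_group T"
    and pres: "presents T [] (length is) (set (matrix_columns M is @ matrix_columns N is))"
  shows "coker (int_vectors I \<times>\<times> int_vectors I) (int_vectors I)
      (\<lambda>(v, w). matrix_apply I M v \<otimes>\<^bsub>int_vectors I\<^esub> matrix_apply I N w) \<cong> T"
proof -
  let ?V = "int_vectors I" and ?n = "length is"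
  let ?S = "set (matrix_columns M is @ matrix_columns N is)"
  let ?f = "\<lambda>(v, w). matrix_apply I M v \<otimes>\<^bsub>?V\<^esub> matrix_apply I N w"
  interpret T: comm_group T by fact
  interpret V: comm_group ?V by (rule comm_group_int_vectors)
  interpret S: int_rows ?n ?S by unfold_locales (auto simp: matrix_columns_def)
  obtain xs where xs: "length xs = ?n" "set xs \<subseteq> carrier T"
    and gen: "\<And>t. t \<in> carrier T \<Longrightarrow> \<exists>c. length c = ?n \<and> t = lin T c xs"
    and ker: "\<And>c. length c = ?n \<Longrightarrow> lin T c xs = \<one>\<^bsub>T\<^esub> \<longleftrightarrow> int_span ?n ?S c"
    using presents_generators[OF pres assms(3)] by metis
  define h where "h v = lin T (map v is) xs" for v :: "'a \<Rightarrow> int"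
  have fin: "finite I" using assms(1) by auto
  have map_mult: "map (v \<otimes>\<^bsub>?V\<^esub> w) is = axpy 1 (map v is) (map w is)" for v w
    using assms(1) by (auto intro!: nth_equalityI simp: nth_axpy int_vectors_def)
  have "h \<in> hom ?V T"
    using xs by (auto simp: hom_def h_def map_mult T.lin_axpy)
  then interpret h: group_hom ?V T h by unfold_locales
  have "\<exists>v\<in>carrier ?V. t = h v" if t: "t \<in> carrier T" for t
  proof -
    obtain c where c: "length c = ?n" "t = lin T c xs" using gen[OF t] by blast
    define v where "v = (\<lambda>i\<in>I. the (map_of (zip is c) i))"
    have "map v is = c"
      using assms(1,2) c by (auto intro!: nth_equalityI simp: v_def map_of_zip_nth)
    then show ?thesis using c by (intro bexI[of _ v]) (auto simp: h_def int_vectors_def v_def)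
  qed
  then have "h ` carrier ?V = carrier T" using h.hom_closed by blast
  from h.FactGroup_iso[OF this] have iso: "?V Mod kernel ?V T h \<cong> T" .
  have span_f: "\<exists>v w. c = map (?f (v, w)) is \<and> v \<in> carrier ?V \<and> w \<in> carrier ?V" if "int_span ?n ?S c" for c
    using that
  proof (induction rule: int_span.induct)
    case zero
    show ?case
      by (rule exI[of _ "\<lambda>i\<in>I. 0"], rule exI[of _ "\<lambda>i\<in>I. 0"])
        (use assms(1) in \<open>auto intro!: nth_equalityI simp: int_vectors_def matrix_apply_def\<close>)
  next
    case (step c row k)
    then obtain v w where vw: "c = map (?f (v, w)) is" "v \<in> carrier ?V" "w \<in> carrier ?V" by blast
    from step.hyps(2) consider r where "r \<in> I" "row = map (\<lambda>s. M s r) is"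
      | r where "r \<in> I" "row = map (\<lambda>s. N s r) is"
      using assms(1) by (auto simp: matrix_columns_def)
    then show ?case
    proof cases
      case 1
      have "axpy k row c = map (?f (v(r := v r + k), w)) is"
        using assms(1) 1 vw matrix_apply_add_column[OF fin 1(1)]
        by (auto intro!: nth_equalityI simp: nth_axpy int_vectors_def)
      moreover have "v(r := v r + k) \<in> carrier ?V" using vw 1 by (auto simp: int_vectors_def PiE_def extensional_def)
      ultimately show ?thesis using vw by blast
    next
      case 2
      have "axpy k row c = map (?f (v, w(r := w r + k))) is"
        using assms(1) 2 vw matrix_apply_add_column[OF fin 2(1)]
        by (auto intro!: nth_equalityI simp: nth_axpy int_vectors_def)
      moreover have "w(r := w r + k) \<in> carrier ?V" using vw 2 by (auto simp: int_vectors_def PiE_def extensional_def)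
      ultimately show ?thesis using vw by blast
    qed
  qed
  have f_closed: "?f (v, w) \<in> carrier ?V" for v w by (auto simp: int_vectors_def)
  have "kernel ?V T h = ?f ` carrier (?V \<times>\<times> ?V)"
  proof (intro equalityI subsetI)
    fix u assume "u \<in> kernel ?V T h"
    then have u: "u \<in> carrier ?V" "int_span ?n ?S (map u is)" using ker by (auto simp: kernel_def h_def)
    obtain v w where vw: "map u is = map (?f (v, w)) is" "v \<in> carrier ?V" "w \<in> carrier ?V"
      using span_f[OF u(2)] by blast
    have "u = ?f (v, w)"
      by (rule PiE_ext[of _ I "\<lambda>_. UNIV"])
        (use u vw f_closed[of v w] assms(1) in \<open>auto simp: int_vectors_def\<close>)
    then show "u \<in> ?f ` carrier (?V \<times>\<times> ?V)" using vw by auto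
  next
    fix u assume "u \<in> ?f ` carrier (?V \<times>\<times> ?V)"
    then obtain v w where u: "u = ?f (v, w)" by auto
    have "int_span ?n ?S (axpy 1 (map (matrix_apply I M v) is) (map (matrix_apply I N w) is))"
      by (intro S.span_axpy map_matrix_apply_span[OF assms(1,2)] S.int_rows_axioms) auto
    then have "int_span ?n ?S (map u is)" using u map_mult by simp
    then show "u \<in> kernel ?V T h" using ker f_closed u by (auto simp: kernel_def h_def)
  qed
  then show ?thesis using iso by (simp add: coker_def)
qed

lemma (in comm_group) lin_axpy_eq_one:
  assumes "length u = length xs" "length v = length xs" "set xs \<subseteq> carrier G"
  shows "lin G u xs = \<one> \<Longrightarrow> lin G v xs = \<one> \<Longrightarrow> lin G (axpy k u v) xs = \<one>"
    and "lin G (axpy (- 1) u v) xs = \<one> \<longleftrightarrow> lin G u xs = lin G v xs"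
proof -
  have "inv x \<otimes> y = \<one> \<longleftrightarrow> x = y" if "x \<in> carrier G" "y \<in> carrier G" for x y
    using that by (metis inv_closed inv_equality inv_inv l_inv m_comm)
  then show "lin G (axpy (- 1) u v) xs = \<one> \<longleftrightarrow> lin G u xs = lin G v xs"
    using assms by (simp add: lin_axpy int_pow_neg)
qed (use assms in \<open>simp add: lin_axpy\<close>)

section \<open>Abelianized presentations\<close>

definition exponents :: "'g list \<Rightarrow> 'g word \<Rightarrow> int list" where
  "exponents gs u = map (\<lambda>g. \<Sum>(x, e)\<leftarrow>u. if x = g then (if e then 1 else - 1) else 0) gs"

lemma length_exponents [simp]: "length (exponents gs u) = length gs"
  by (simp add: exponents_def)

lemma exponents_append: "exponents gs (u @ v) = axpy 1 (exponents gs u) (exponents gs v)"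
  by (rule nth_equalityI) (auto simp: exponents_def nth_axpy)

lemma exponents_Nil: "exponents gs [] = replicate (length gs) 0"
  by (simp add: exponents_def map_replicate_const)

lemma (in comm_group) lin_exponents_letter:
  assumes "distinct gs" "i < length gs" "length xs = length gs" "set xs \<subseteq> carrier G"
  shows "lin G (exponents gs [(gs ! i, e)]) xs = (if e then xs ! i else inv (xs ! i))"
proof -
  have mem: "xs ! j \<in> carrier G" if "j < length gs" for j using assms that by auto
  have "lin G (exponents gs [(gs ! i, e)]) xs =
      finprod G (\<lambda>j. if i = j then (if e then xs ! j else inv (xs ! j)) else \<one>) {..<length gs}"
    using assms mem by (subst lin_finprod)
      (auto simp: exponents_def nth_eq_iff_index_eq int_pow_neg intro!: finprod_cong')
  also have "\<dots> = (if e then xs ! i else inv (xs ! i))"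
    using mem assms(2) by (subst finprod_singleton) auto
  finally show ?thesis .
qed

locale presentation =
  fixes S :: "'g set" and rels :: "('g word \<times> 'g word) set"
begin

abbreviation cong where "cong \<equiv> presentation_cong S rels"
abbreviation "G \<equiv> presented_group S rels"

definition words :: "'g word set" where
  "words = lists (S \<times> UNIV)"

lemma words_simps [simp]:
  "[] \<in> words" "a # u \<in> words \<longleftrightarrow> fst a \<in> S \<and> u \<in> words" "u @ v \<in> words \<longleftrightarrow> u \<in> words \<and> v \<in> words"
  by (auto simp: words_def mem_Times_iff)

lemma cong_refl: "u \<in> words \<Longrightarrow> cong u u"
  by (simp add: words_def presentation_cong.refl)

definition cls :: "'g word \<Rightarrow> 'g word set" where
  "cls u = {(u, v). cong u v} `` {u}"

lemma cong_words: "cong u v \<Longrightarrow> u \<in> words \<and> v \<in> words"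
  by (induction rule: presentation_cong.induct) (auto simp: words_def)

lemma equiv_cong: "equiv (words) {(u, v). cong u v}"
  by (rule equivI)
    (auto simp: refl_on_def sym_def trans_def dest: cong_words intro: cong_refl presentation_cong.sym presentation_cong.trans)

lemma cls_eq_iff: "u \<in> words \<Longrightarrow> v \<in> words \<Longrightarrow> cls u = cls v \<longleftrightarrow> cong u v"
  unfolding cls_def using eq_equiv_class_iff[OF equiv_cong] by auto

lemma in_cls: "v \<in> cls u \<longleftrightarrow> cong u v"
  by (auto simp: cls_def)

lemma carrier_presented: "carrier G = cls ` words"
  by (auto simp: presented_group_def Let_def cls_def quotient_def words_def)

lemma cls_closed: "u \<in> words \<Longrightarrow> cls u \<in> carrier G"
  unfolding carrier_presented by (rule imageI)

lemma one_presented: "\<one>\<^bsub>G\<^esub> = cls []"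
  by (simp add: presented_group_def Let_def cls_def)

lemma mult_presented:
  assumes "u \<in> words" "v \<in> words"
  shows "cls u \<otimes>\<^bsub>G\<^esub> cls v = cls (u @ v)"
proof -
  have "cls u \<otimes>\<^bsub>G\<^esub> cls v = (\<Union>x\<in>cls u. \<Union>y\<in>cls v. cls (x @ y))"
    by (simp add: presented_group_def Let_def cls_def)
  also have "\<dots> = (\<Union>x\<in>cls u. \<Union>y\<in>cls v. cls (u @ v))"
  proof -
    have "cls (x @ y) = cls (u @ v)" if "x \<in> cls u" "y \<in> cls v" for x y
    proof -
      have "cong (u @ v) (x @ y)" using that by (auto simp: in_cls intro: presentation_cong.append)
      then show ?thesis using cls_eq_iff cong_words by metis
    qed
    then show ?thesis by auto
  qed
  also have "\<dots> = cls (u @ v)"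
    using cong_refl[OF assms(1)] cong_refl[OF assms(2)] unfolding in_cls[symmetric] by blast
  finally show ?thesis .
qed

lemma cong_inverse:
  "u \<in> words \<Longrightarrow> cong (rev (map (\<lambda>(g, e). (g, \<not> e)) u) @ u) []"
proof (induction u)
  case Nil
  show ?case by (simp add: cong_refl)
next
  case (Cons a u)
  obtain g e where a: "a = (g, e)" by (cases a)
  let ?w = "rev (map (\<lambda>(g, e). (g, \<not> e)) u)"
  have g: "g \<in> S" and u: "u \<in> words" using Cons.prems a by auto
  have w: "?w \<in> words" using u by (auto simp: words_def)
  have "cong [(g, \<not> e), (g, e)] []" using presentation_cong.cancel[OF g, of rels "\<not> e"] by simp
  then have "cong (?w @ ([(g, \<not> e), (g, e)] @ u)) (?w @ ([] @ u))"
    using u w g by (intro presentation_cong.append cong_refl) auto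
  then show ?case using Cons.IH[OF u] presentation_cong.trans by (fastforce simp: a)
qed

lemma group_presented: "group G"
proof (rule groupI)
  fix x assume "x \<in> carrier G"
  then obtain u where u: "u \<in> words" "x = cls u" by (auto simp: carrier_presented)
  define w where "w = rev (map (\<lambda>(g, e). (g, \<not> e)) u)"
  have w: "w \<in> words" using u by (auto simp: w_def words_def)
  have "cong (w @ u) []" using cong_inverse u by (simp add: w_def)
  then have "cls w \<otimes>\<^bsub>G\<^esub> x = \<one>\<^bsub>G\<^esub>"
    using u w mult_presented cls_eq_iff by (simp add: one_presented)
  then show "\<exists>y\<in>carrier G. y \<otimes>\<^bsub>G\<^esub> x = \<one>\<^bsub>G\<^esub>" using w by (auto simp: carrier_presented)
qed (auto simp: carrier_presented one_presented mult_presented)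

end

text \<open>The rows are the exponent vectors of the relators \<open>u v\<^sup>-\<^sup>1\<close>.\<close>
locale finite_presentation = presentation S rels
  for S :: "'g set" and rels :: "('g word \<times> 'g word) set" +
  fixes gs :: "'g list" and rows :: "int list set"
  assumes gs: "set gs = S" "distinct gs"
    and rels_words: "(u, v) \<in> rels \<Longrightarrow> u \<in> words \<and> v \<in> words"
    and rows: "rows = (\<lambda>(u, v). axpy (- 1) (exponents gs v) (exponents gs u)) ` rels"
begin

sublocale int_rows "length gs" rows
  by unfold_locales (auto simp: rows)

lemma cong_exponents:
  "cong u v \<Longrightarrow> int_span (length gs) rows (axpy (- 1) (exponents gs v) (exponents gs u))"
proof (induction rule: presentation_cong.induct)
  case (refl u)
  have "axpy (- 1) (exponents gs u) (exponents gs u) = replicate (length gs) 0"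
    by (rule nth_equalityI) (auto simp: nth_axpy)
  then show ?case by (simp add: int_span.zero)
next
  case (sym u v)
  from span_axpy[OF sym.IH int_span.zero, of "- 1"]
  show ?case by (rule back_subst) (auto intro!: nth_equalityI simp: nth_axpy)
next
  case (trans u v w)
  from span_axpy[OF trans.IH, of 1]
  show ?case by (rule back_subst) (auto intro!: nth_equalityI simp: nth_axpy)
next
  case (append u u' v v')
  from span_axpy[OF append.IH, of 1]
  show ?case by (rule back_subst) (auto intro!: nth_equalityI simp: nth_axpy exponents_append)
next
  case (cancel x e)
  have "axpy (- 1) (exponents gs []) (exponents gs [(x, e), (x, \<not> e)]) = replicate (length gs) 0"
    by (rule nth_equalityI) (auto simp: nth_axpy exponents_def)
  then show ?case by (simp add: int_span.zero)
next
  case (relation u v)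
  then show ?case by (auto simp: rows intro!: row_in_span[unfolded rows])
qed

text \<open>
  Evaluating a word in \<open>T\<close> depends only on its exponents, so it respects the relations and gives a
  homomorphism of the presented group onto \<open>T\<close>. Its kernel contains the derived subgroup because \<open>T\<close> is
  abelian. Conversely, if the exponents of a word lie in the span of the rows, then the word is trivial
  in the abelian quotient by the derived subgroup, since each row is trivial there.
\<close>
theorem abelianization_iso:
  assumes "comm_group T" and pres: "presents T [] (length gs) rows"
  shows "abelianization G \<cong> T"
proof -
  let ?n = "length gs"
  interpret T: comm_group T by fact
  interpret G: group G by (rule group_presented)
  obtain xs where xs: "length xs = ?n" "set xs \<subseteq> carrier T"
    and gen: "\<And>t. t \<in> carrier T \<Longrightarrow> \<exists>c. length c = ?n \<and> t = lin T c xs"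
    and ker: "\<And>c. length c = ?n \<Longrightarrow> lin T c xs = \<one>\<^bsub>T\<^esub> \<longleftrightarrow> int_span ?n rows c"
    using presents_generators[OF pres assms(1)] by metis
  define val where "val u = lin T (exponents gs u) xs" for u :: "'g word"
  have val_closed: "val u \<in> carrier T" for u using xs by (auto simp: val_def)
  have val_append: "val (u @ v) = val u \<otimes>\<^bsub>T\<^esub> val v" for u v
    using xs by (simp add: val_def exponents_append T.lin_axpy)
  have val_cong: "val u = val v" if "cong u v" for u v
  proof -
    have "lin T (axpy (- 1) (exponents gs v) (exponents gs u)) xs = \<one>\<^bsub>T\<^esub>"
      using cong_exponents[OF that] ker by simp
    then show ?thesis using xs by (simp add: T.lin_axpy_eq_one val_def)
  qed
  define \<Phi> where "\<Phi> X = val (SOME u. u \<in> X)" for X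
  have \<Phi>: "\<Phi> (cls u) = val u" if "u \<in> words" for u
  proof -
    have "u \<in> cls u" using that by (simp add: in_cls cong_refl)
    then have "(SOME v. v \<in> cls u) \<in> cls u" by (rule someI)
    then show ?thesis using val_cong unfolding \<Phi>_def in_cls by metis
  qed
  have "\<Phi> \<in> hom G T"
    by (rule homI)
      (auto simp: carrier_presented \<Phi> mult_presented val_closed val_append)
  then interpret \<Phi>: group_hom G T \<Phi> by unfold_locales
  have img: "subgroup (\<Phi> ` carrier G) T" by (rule \<Phi>.img_is_subgroup)
  have "lin T c zs \<in> \<Phi> ` carrier G" if "set zs \<subseteq> \<Phi> ` carrier G" for c zs
    using that
  proof (induction zs arbitrary: c)
    case Nil
    then show ?case using subgroup.one_closed[OF img] by (cases c) auto
  next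
    case (Cons z zs)
    then show ?case using subgroup.one_closed[OF img] subgroup.m_closed[OF img] T.subgroup_int_pow_closed[OF img]
      by (cases c) auto
  qed
  moreover have "set xs \<subseteq> \<Phi> ` carrier G"
  proof
    fix x assume "x \<in> set xs"
    then obtain i where i: "i < ?n" "x = xs ! i" using xs(1) by (metis in_set_conv_nth)
    let ?w = "[(gs ! i, True)]"
    have w: "?w \<in> words" using gs i by auto
    have "val ?w = x"
      unfolding val_def i(2) using T.lin_exponents_letter[OF gs(2) i(1) xs, of True] by simp
    then have "x = \<Phi> (cls ?w)" using \<Phi>[OF w] by simp
    then show "x \<in> \<Phi> ` carrier G" using cls_closed[OF w] by (rule image_eqI)
  qed
  ultimately have surj: "\<Phi> ` carrier G = carrier T"
    using gen \<Phi>.hom_closed by blast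
  let ?D = "derived G (carrier G)"
  let ?Q = "G Mod ?D"
  interpret D: normal ?D G by (rule G.derived_self_is_normal)
  interpret Q: comm_group ?Q by (rule G.derived_quot_is_comm_group)
  define \<pi> where "\<pi> g = ?D #>\<^bsub>G\<^esub> g" for g
  have "\<pi> \<in> hom G ?Q" unfolding \<pi>_def by (rule D.r_coset_hom_Mod)
  then interpret \<pi>: group_hom G ?Q \<pi> by unfold_locales
  define zs where "zs = map (\<lambda>g. \<pi> (cls [(g, True)])) gs"
  have "\<pi> (cls [(g, True)]) \<in> carrier ?Q" if "g \<in> S" for g
    using that by (intro \<pi>.hom_closed cls_closed) simp
  then have "set zs \<subseteq> carrier ?Q" unfolding zs_def set_map gs(1) by blast
  then have zs: "length zs = ?n" "set zs \<subseteq> carrier ?Q" by (simp_all add: zs_def)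
  have \<pi>_word: "\<pi> (cls u) = lin ?Q (exponents gs u) zs" if "u \<in> words" for u
    using that
  proof (induction u)
    case Nil
    then show ?case using zs \<pi>.hom_one by (simp add: exponents_Nil one_presented)
  next
    case (Cons a u)
    obtain g e where a: "a = (g, e)" "g \<in> S" using Cons by (cases a) auto
    then obtain i where i: "i < ?n" "g = gs ! i" using gs by (metis in_set_conv_nth)
    have W: "[a] \<in> words" "[(g, True)] \<in> words" "[(g, False)] \<in> words" "u \<in> words" using a Cons by auto
    have "\<pi> (cls [a]) = (if e then zs ! i else inv\<^bsub>?Q\<^esub> (zs ! i))"
    proof (cases e)
      case True
      then show ?thesis using a i by (simp add: zs_def)
    next
      case False
      have "cls [(g, False)] \<otimes>\<^bsub>G\<^esub> cls [(g, True)] = \<one>\<^bsub>G\<^esub>"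
        using W presentation_cong.cancel[OF a(2), of rels False] by (simp add: mult_presented one_presented cls_eq_iff)
      then have "inv\<^bsub>G\<^esub> (cls [(g, True)]) = cls [(g, False)]"
        using W by (intro G.inv_equality cls_closed)
      then have "\<pi> (cls [(g, False)]) = inv\<^bsub>?Q\<^esub> (\<pi> (cls [(g, True)]))"
        using \<pi>.hom_inv[OF cls_closed[OF W(2)]] by simp
      then show ?thesis using False a i by (simp add: zs_def)
    qed
    also have "\<dots> = lin ?Q (exponents gs [a]) zs"
      using Q.lin_exponents_letter[OF gs(2) i(1) zs] a i by simp
    finally have 1: "\<pi> (cls [a]) = lin ?Q (exponents gs [a]) zs" .
    have "\<pi> (cls (a # u)) = \<pi> (cls [a]) \<otimes>\<^bsub>?Q\<^esub> \<pi> (cls u)"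
      using mult_presented[OF W(1,4)] \<pi>.hom_mult[OF cls_closed[OF W(1)] cls_closed[OF W(4)]] by simp
    also have "\<dots> = lin ?Q (exponents gs [a]) zs \<otimes>\<^bsub>?Q\<^esub> lin ?Q (exponents gs u) zs"
      using 1 Cons W by simp
    also have "\<dots> = lin ?Q (exponents gs ([a] @ u)) zs"
      using zs by (simp only: exponents_append) (simp add: Q.lin_axpy)
    finally show ?case by simp
  qed
  have span_one: "lin ?Q c zs = \<one>\<^bsub>?Q\<^esub>" if "int_span ?n rows c" for c
    using that
  proof (induction rule: int_span.induct)
    case zero
    then show ?case using zs by simp
  next
    case (step c r k)
    then obtain u v where uv: "(u, v) \<in> rels" "r = axpy (- 1) (exponents gs v) (exponents gs u)"
      by (auto simp: rows)
    have W: "u \<in> words" "v \<in> words" using rels_words[OF uv(1)] by auto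
    have "cls u = cls v" using W uv(1) by (simp add: cls_eq_iff presentation_cong.relation[of u v rels S, folded words_def])
    then have "lin ?Q (exponents gs u) zs = lin ?Q (exponents gs v) zs"
      using \<pi>_word[OF W(1)] \<pi>_word[OF W(2)] by metis
    then have "lin ?Q r zs = \<one>\<^bsub>?Q\<^esub>"
      using Q.lin_axpy_eq_one(2)[of "exponents gs v" zs "exponents gs u"] zs uv by simp
    then show ?case
      using Q.lin_axpy_eq_one(1)[of r zs c k] step.IH zs length_span[OF step.hyps(1)] length_row[OF step.hyps(2)]
      by simp
  qed
  have "kernel G T \<Phi> = ?D"
  proof
    have "\<Phi> ` ?D = {\<one>\<^bsub>T\<^esub>}"
      using \<Phi>.derived_img[of "carrier G"] T.derived_eq_singleton[of "carrier T"] surj by simp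
    then show "?D \<subseteq> kernel G T \<Phi>"
      using D.subset by (auto simp: kernel_def)
  next
    show "kernel G T \<Phi> \<subseteq> ?D"
    proof
      fix X assume X: "X \<in> kernel G T \<Phi>"
      then obtain u where u: "u \<in> words" "X = cls u" by (auto simp: kernel_def carrier_presented)
      then have "int_span ?n rows (exponents gs u)" using X \<Phi> ker by (auto simp: kernel_def val_def)
      then have "\<pi> X = ?D" using \<pi>_word span_one u by (simp add: FactGroup_def)
      then show "X \<in> ?D" using G.coset_join1[of ?D X] X D.subgroup_axioms by (simp add: \<pi>_def kernel_def)
    qed
  qed
  then show ?thesis using \<Phi>.FactGroup_iso[OF surj] by (simp add: abelianization_def)
qed

end

section \<open>Counting the relation sets\<close>

definition gens_A_list :: "int list" where "gens_A_list = [1, -1, 2, -2]"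
definition gens_B_list :: "int list" where "gens_B_list = [3, -3, 4, -4]"

fun quads_of_square :: "int quad \<Rightarrow> int quad list" where
  "quads_of_square (a, b, b', a') = [(a, b, b', a'), (- a, b', b, - a'), (- a', - b', - b, - a), (a', - b, - b', a)]"

fun relation_quads :: "int quad list \<Rightarrow> int quad list" where
  "relation_quads [] = []"
| "relation_quads ((a, b, a', b') # rs) = quads_of_square (a, b, - b', - a') @ relation_quads rs"

definition gens_A :: "int set" where "gens_A = {1, - 1, 2, - 2}"
definition gens_B :: "int set" where "gens_B = {3, - 3, 4, - 4}"
abbreviation "quads \<equiv> gens_A \<times> gens_B \<times> gens_B \<times> gens_A"

lemma set_gens_lists: "set gens_A_list = gens_A" "set gens_B_list = gens_B"
  by (auto simp: gens_A_list_def gens_B_list_def gens_A_def gens_B_def)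

lemma finite_gens [simp]: "finite gens_A" "finite gens_B"
  by (auto simp: gens_A_def gens_B_def)

lemma minus_gens [simp]: "a \<in> gens_A \<Longrightarrow> - a \<in> gens_A" "b \<in> gens_B \<Longrightarrow> - b \<in> gens_B"
  by (auto simp: gens_A_def gens_B_def)

lemma gens_nonzero: "a \<in> gens_A \<Longrightarrow> a \<noteq> 0" "b \<in> gens_B \<Longrightarrow> b \<noteq> 0"
  by (auto simp: gens_A_def gens_B_def)

fun cell :: "int quad \<Rightarrow> int \<times> int" where "cell (a, b, b', a') = (a, b)"

fun nondegenerate :: "int quad \<Rightarrow> bool" where
  "nondegenerate (a, b, b', a') \<longleftrightarrow> \<not> (a' = - a \<and> b' = - b)"

abbreviation "square \<equiv> BM_square (uminus :: int \<Rightarrow> int)"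

lemma square_self: "r \<in> square r"
  by (cases r) auto

lemma square_eq: "s \<in> square r \<Longrightarrow> square s = square r"
  by (cases r, simp, elim disjE) (simp_all, blast+)

lemma square_subset_quads: "r \<in> quads \<Longrightarrow> square r \<subseteq> quads"
  by (cases r) auto

lemma square_nondegenerate: "nondegenerate r \<Longrightarrow> s \<in> square r \<Longrightarrow> nondegenerate s"
  by (cases r) auto

lemma square_cells:
  assumes "r \<in> quads" "nondegenerate r"
  shows "inj_on cell (square r)" "card (square r) = 4"
proof -
  obtain a b b' a' where r: "r = (a, b, b', a')" "a \<noteq> 0" "a' \<noteq> 0" "b \<noteq> 0" "b' \<noteq> 0"
    using assms gens_nonzero by (metis mem_Sigma_iff prod.collapse)
  show inj: "inj_on cell (square r)" using r assms(2) by (auto simp: inj_on_def)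
  have "cell ` square r = {(a, b), (- a, b'), (- a', - b'), (a', - b)}" using r by auto
  moreover have "card \<dots> = 4" using r assms(2) by (auto simp: card_insert_if)
  ultimately show "card (square r) = 4" using card_image[OF inj] by simp
qed

text \<open>A tuple \<open>(a, b, b\<^sup>-\<^sup>1, a\<^sup>-\<^sup>1)\<close> is fixed by one of the symmetries, so its square collapses.\<close>
lemma degenerate_card:
  assumes "\<not> nondegenerate r"
  shows "card (square r) \<noteq> 4"
proof -
  obtain a b b' a' where r: "r = (a, b, b', a')" by (cases r)
  then have "square r = {(a, b, - b, - a), (- a, - b, b, a)}" using assms by auto
  then have "card (square r) \<le> 2" by (simp add: card_insert_if)
  then show ?thesis by simp
qed

text \<open>
  The members of \<open>covers D\<close> are the unions of disjoint squares that lie bijectively over the set \<open>D\<close> of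
  cells. Admitting partial sets \<open>D\<close> makes induction over the free cells possible.
\<close>
definition covers :: "(int \<times> int) set \<Rightarrow> int quad set set" where
  "covers D = {R. R \<subseteq> quads \<and> (\<forall>r\<in>R. square r \<subseteq> R) \<and> (\<forall>r\<in>R. nondegenerate r) \<and> bij_betw cell R D}"

text \<open>
  Each of the four projections of a relation set is the first one composed with a symmetry of the
  squares and a relabelling of the cells, so bijectivity of the first one implies that of all.
\<close>
lemma bij_betw_symmetric:
  assumes "bij_betw f R D" "\<And>r. r \<in> R \<Longrightarrow> \<sigma> r \<in> R" "\<And>r. r \<in> R \<Longrightarrow> \<sigma> (\<sigma> r) = r"
    and "bij_betw \<tau> D E" "\<And>r. r \<in> R \<Longrightarrow> \<tau> (f (\<sigma> r)) = g r"
  shows "bij_betw g R E"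
proof -
  have "bij_betw \<sigma> R R" by (rule bij_betwI[where g = \<sigma>]) (use assms in auto)
  then have "bij_betw (\<tau> \<circ> (f \<circ> \<sigma>)) R E" using assms(1,4) by (blast intro: bij_betw_trans)
  then show ?thesis by (rule bij_betw_cong[THEN iffD1, rotated]) (simp add: assms(5))
qed

lemma BM_relation_sets_covers: "BM_relation_sets uminus gens_A gens_B = covers (gens_A \<times> gens_B)"
proof (intro equalityI subsetI)
  fix R assume "R \<in> BM_relation_sets uminus gens_A gens_B"
  then have R: "R \<subseteq> quads" "\<forall>r\<in>R. square r \<subseteq> R" "\<forall>r\<in>R. card (square r) = 4"
    "bij_betw (\<lambda>(a, b, b', a'). (a, b)) R (gens_A \<times> gens_B)"
    unfolding BM_relation_sets_def BM_relation_set_def by blast+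
  moreover have "(\<lambda>(a, b, b', a'). (a, b)) = cell" by (auto simp: fun_eq_iff)
  moreover have "\<forall>r\<in>R. nondegenerate r" using degenerate_card R(3) by blast
  ultimately show "R \<in> covers (gens_A \<times> gens_B)" by (simp add: covers_def)
next
  fix R assume "R \<in> covers (gens_A \<times> gens_B)"
  then have R: "R \<subseteq> quads" "\<And>r. r \<in> R \<Longrightarrow> square r \<subseteq> R" "\<And>r. r \<in> R \<Longrightarrow> nondegenerate r"
    "bij_betw cell R (gens_A \<times> gens_B)"
    by (auto simp: covers_def)
  have generators: "BM_generators uminus gens_A gens_B"
    by (auto simp: BM_generators_def fixed_point_free_involution_def gens_A_def gens_B_def)
  have 1: "bij_betw (\<lambda>(a, b, b', a'). (a, b)) R (gens_A \<times> gens_B)"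
    by (rule bij_betw_cong[THEN iffD1, OF _ R(4)]) auto
  have 2: "bij_betw (\<lambda>(a, b, b', a'). (a, b')) R (gens_A \<times> gens_B)"
    by (rule bij_betw_symmetric[OF R(4), where \<sigma> = "\<lambda>(a, b, b', a'). (- a, b', b, - a')" and \<tau> = "\<lambda>(a, b). (- a, b)"])
      (use R(2) in \<open>force+, auto intro!: bij_betwI[where g = "\<lambda>(a, b). (- a, b)"]\<close>)
  have 3: "bij_betw (\<lambda>(a, b, b', a'). (b, a')) R (gens_B \<times> gens_A)"
    by (rule bij_betw_symmetric[OF R(4), where \<sigma> = "\<lambda>(a, b, b', a'). (a', - b, - b', a)" and \<tau> = "\<lambda>(a, b). (- b, a)"])
      (use R(2) in \<open>force+, auto intro!: bij_betwI[where g = "\<lambda>(b, a). (a, - b)"]\<close>)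
  have 4: "bij_betw (\<lambda>(a, b, b', a'). (b', a')) R (gens_B \<times> gens_A)"
    by (rule bij_betw_symmetric[OF R(4), where \<sigma> = "\<lambda>(a, b, b', a'). (- a', - b', - b, - a)" and \<tau> = "\<lambda>(a, b). (- b, - a)"])
      (use R(2) in \<open>force+, auto intro!: bij_betwI[where g = "\<lambda>(b, a). (- a, - b)"]\<close>)
  have card: "\<forall>r\<in>R. card (square r) = 4" using square_cells(2) R(1,3) by blast
  show "R \<in> BM_relation_sets uminus gens_A gens_B"
    unfolding BM_relation_sets_def BM_relation_set_def using generators R(1,2) card 1 2 3 4 by blast
qed

lemma finite_covers: "finite (covers D)"
proof (rule finite_subset)
  show "covers D \<subseteq> Pow quads" by (auto simp: covers_def)
qed simp

lemma covers_remove_square: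
  assumes R: "R \<in> covers D" and q: "q \<in> R"
  shows "R - square q \<in> covers (D - cell ` square q)" "cell ` square q \<subseteq> D"
proof -
  have R': "R \<subseteq> quads" "\<And>r. r \<in> R \<Longrightarrow> square r \<subseteq> R" "\<And>r. r \<in> R \<Longrightarrow> nondegenerate r" "inj_on cell R" "cell ` R = D"
    using R by (auto simp: covers_def bij_betw_def)
  have sub: "square q \<subseteq> R" using R'(2) q by blast
  then show "cell ` square q \<subseteq> D" using R'(5) by blast
  have "cell ` (R - square q) = D - cell ` square q"
    using inj_on_image_set_diff[OF R'(4) _ sub, of R] R'(5) by simp
  then have "bij_betw cell (R - square q) (D - cell ` square q)"
    unfolding bij_betw_def using inj_on_diff[OF R'(4)] by blast
  moreover have "square r \<subseteq> R - square q" if "r \<in> R - square q" for r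
  proof
    fix s assume s: "s \<in> square r"
    have "s \<notin> square q"
      using s that square_eq[of s r] square_eq[of s q] square_self[of r] by auto
    then show "s \<in> R - square q" using R'(2)[of r] that s by blast
  qed
  ultimately show "R - square q \<in> covers (D - cell ` square q)"
    using R'(1,3) unfolding covers_def by blast
qed

lemma covers_add_square:
  assumes R: "R \<in> covers D" and q: "q \<in> quads" "nondegenerate q" and disj: "D \<inter> cell ` square q = {}"
  shows "square q \<union> R \<in> covers (D \<union> cell ` square q)"
proof -
  have R': "R \<subseteq> quads" "\<And>r. r \<in> R \<Longrightarrow> square r \<subseteq> R" "\<And>r. r \<in> R \<Longrightarrow> nondegenerate r" "bij_betw cell R D"
    using R by (auto simp: covers_def)
  have "bij_betw cell (square q) (cell ` square q)" using square_cells(1)[OF q] by (simp add: bij_betw_def)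
  then have "bij_betw cell (square q \<union> R) (cell ` square q \<union> D)"
    using R'(4) disj by (intro bij_betw_combine) auto
  moreover have "square r \<subseteq> square q \<union> R" if "r \<in> square q \<union> R" for r
    using that R'(2)[of r] square_eq[of r q] by blast
  moreover have "nondegenerate r" if "r \<in> square q \<union> R" for r
    using that R'(3) square_nondegenerate[OF q(2)] by blast
  ultimately show ?thesis
    using R'(1) square_subset_quads[OF q(1)] unfolding covers_def by (simp add: Un_commute)
qed

fun mem_cell :: "int \<Rightarrow> int \<Rightarrow> (int \<times> int) list \<Rightarrow> bool" where
  "mem_cell a b [] = False"
| "mem_cell a b ((c, d) # cs) = ((a = c \<and> b = d) \<or> mem_cell a b cs)"

text \<open>
  The square of \<open>(a, b, b', a')\<close> can be used over the free cell \<open>(a, b)\<close> if it is nondegenerate and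
  its three other cells are among the remaining free cells \<open>cs\<close>.
\<close>
definition admissible :: "int \<Rightarrow> int \<Rightarrow> int \<Rightarrow> int \<Rightarrow> (int \<times> int) list \<Rightarrow> bool" where
  "admissible a b b' a' cs \<longleftrightarrow> \<not> (a' = - a \<and> b' = - b) \<and>
    mem_cell (- a) b' cs \<and> mem_cell a' (- b) cs \<and> mem_cell (- a') (- b') cs"

definition uncovered :: "int \<Rightarrow> int \<Rightarrow> int \<Rightarrow> int \<Rightarrow> (int \<times> int) list \<Rightarrow> (int \<times> int) list" where
  "uncovered a b b' a' cs = filter (\<lambda>c. c \<noteq> (- a, b') \<and> c \<noteq> (a', - b) \<and> c \<noteq> (- a', - b')) cs"

function cover_count :: "(int \<times> int) list \<Rightarrow> int" where
  "cover_count [] = 1"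
| "cover_count ((a, b) # cs) =
    (\<Sum>(b', a')\<leftarrow>List.product gens_B_list gens_A_list.
      if admissible a b b' a' cs then cover_count (uncovered a b b' a' cs) else 0)"
  by pat_completeness auto
termination
  by (relation "measure length") (auto simp: uncovered_def less_Suc_eq_le)

lemma cover_count_all: "cover_count (List.product gens_A_list gens_B_list) = 541"
  by code_simp

lemma mem_cell_iff: "mem_cell a b cs \<longleftrightarrow> (a, b) \<in> set cs"
  by (induction a b cs rule: mem_cell.induct) auto

text \<open>
  The recursion behind the count: some tuple lies over the first cell, its square belongs to the
  relation set, and removing the square leaves a cover of the other cells.
\<close>
lemma covers_Cons:
  assumes "distinct ((a, b) # cs)" "set ((a, b) # cs) \<subseteq> gens_A \<times> gens_B"
  shows "covers (set ((a, b) # cs)) =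
    (\<Union>(b', a')\<in>{(b', a') \<in> gens_B \<times> gens_A. admissible a b b' a' cs}.
       (\<union>) (square (a, b, b', a')) ` covers (set (uncovered a b b' a' cs)))"
    (is "?L = (\<Union>(b', a')\<in>?O. ?F b' a')")
proof -
  have ab: "a \<in> gens_A" "b \<in> gens_B" "(a, b) \<notin> set cs" using assms by auto
  have cells: "cell ` square (a, b, b', a') = {(a, b), (- a, b'), (- a', - b'), (a', - b)}" for b' a' by auto
  have rest: "set ((a, b) # cs) - cell ` square (a, b, b', a') = set (uncovered a b b' a' cs)" for b' a'
    using ab(3) unfolding cells uncovered_def by auto
  have adm: "admissible a b b' a' cs \<longleftrightarrow>
      nondegenerate (a, b, b', a') \<and> cell ` square (a, b, b', a') \<subseteq> set ((a, b) # cs)" if "b' \<in> gens_B" "a' \<in> gens_A" for b' a'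
    using ab(1,2) that gens_nonzero[of a] gens_nonzero[of b] gens_nonzero[of a'] gens_nonzero[of b']
    unfolding cells admissible_def mem_cell_iff by auto
  show ?thesis
  proof (intro equalityI subsetI)
    fix R assume R: "R \<in> ?L"
    then have "(a, b) \<in> cell ` R" by (auto simp: covers_def bij_betw_def)
    then obtain b' a' where q: "(a, b, b', a') \<in> R" by auto
    then have q': "b' \<in> gens_B" "a' \<in> gens_A" "nondegenerate (a, b, b', a')" and sub: "square (a, b, b', a') \<subseteq> R"
      using R unfolding covers_def by blast+
    have "R - square (a, b, b', a') \<in> covers (set (uncovered a b b' a' cs))"
      using covers_remove_square(1)[OF R q] rest by metis
    moreover have "R = square (a, b, b', a') \<union> (R - square (a, b, b', a'))" using sub by blast
    ultimately have "R \<in> ?F b' a'" by (metis imageI)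
    moreover have "admissible a b b' a' cs" using covers_remove_square(2)[OF R q] q' adm by blast
    ultimately show "R \<in> (\<Union>(b', a')\<in>?O. ?F b' a')" using q' by blast
  next
    fix R assume "R \<in> (\<Union>(b', a')\<in>?O. ?F b' a')"
    then obtain b' a' X where X: "b' \<in> gens_B" "a' \<in> gens_A" "admissible a b b' a' cs"
      "X \<in> covers (set (uncovered a b b' a' cs))" "R = square (a, b, b', a') \<union> X" by blast
    have q: "(a, b, b', a') \<in> quads" "nondegenerate (a, b, b', a')"
      using X ab adm by blast+
    have "set (uncovered a b b' a' cs) \<union> cell ` square (a, b, b', a') = set ((a, b) # cs)"
      using rest[of b' a'] adm X(1-3) by blast
    then show "R \<in> ?L"
      using covers_add_square[OF X(4) q] rest[of b' a'] X(5) by auto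
  qed
qed

lemma card_covers:
  "distinct cs \<Longrightarrow> set cs \<subseteq> gens_A \<times> gens_B \<Longrightarrow> int (card (covers (set cs))) = cover_count cs"
proof (induction cs rule: cover_count.induct)
  case 1
  have "covers {} = {{}}" by (auto simp: covers_def bij_betw_def)
  then show ?case by simp
next
  case (2 a b cs)
  let ?O = "{(b', a') \<in> gens_B \<times> gens_A. admissible a b b' a' cs}"
  let ?F = "\<lambda>(b', a'). (\<union>) (square (a, b, b', a')) ` covers (set (uncovered a b b' a' cs))"
  have first: "b1 = b2 \<and> a1 = a2"
    if "R \<in> covers D" "(a, b, b1, a1) \<in> R" "(a, b, b2, a2) \<in> R" for R D b1 a1 b2 a2
  proof -
    have "inj_on cell R" using that(1) by (simp add: covers_def bij_betw_def)
    from inj_onD[OF this _ that(2,3)] show ?thesis by simp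
  qed
  have F_sub: "?F o' \<subseteq> covers (set ((a, b) # cs))" if "o' \<in> ?O" for o'
    using covers_Cons[OF "2.prems"] that by blast
  have in_F: "(a, b, b', a') \<in> R" if R: "R \<in> ?F (b', a')" for R b' a'
  proof -
    obtain X where "R = square (a, b, b', a') \<union> X" using R unfolding case_prod_conv by blast
    then show ?thesis using square_self[of "(a, b, b', a')"] by blast
  qed
  have disj: "?F x \<inter> ?F y = {}" if "x \<in> ?O" "y \<in> ?O" "x \<noteq> y" for x y
  proof (rule ccontr)
    assume "?F x \<inter> ?F y \<noteq> {}"
    then obtain R where R: "R \<in> ?F x" "R \<in> ?F y" by blast
    obtain b1 a1 where x: "x = (b1, a1)" by (cases x)
    obtain b2 a2 where y: "y = (b2, a2)" by (cases y)
    have "(a, b, b1, a1) \<in> R" "(a, b, b2, a2) \<in> R" using R in_F unfolding x y by blast+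
    moreover have "R \<in> covers (set ((a, b) # cs))" using F_sub[OF that(1)] R(1) by blast
    ultimately show False using first that(3) unfolding x y by blast
  qed
  have card_F: "int (card (?F (b', a'))) = cover_count (uncovered a b b' a' cs)" if o: "(b', a') \<in> ?O" for b' a'
  proof -
    have "X \<inter> square (a, b, b', a') = {}" if "X \<in> covers (set (uncovered a b b' a' cs))" for X
    proof -
      have "cell ` X = set (uncovered a b b' a' cs)" using that by (auto simp: covers_def bij_betw_def)
      moreover have "set (uncovered a b b' a' cs) \<inter> cell ` square (a, b, b', a') = {}"
        using "2.prems" by (auto simp: uncovered_def)
      ultimately show ?thesis by blast
    qed
    then have "inj_on ((\<union>) (square (a, b, b', a'))) (covers (set (uncovered a b b' a' cs)))"
      by (intro inj_onI) blast
    then have "card (?F (b', a')) = card (covers (set (uncovered a b b' a' cs)))"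
      unfolding case_prod_conv by (rule card_image)
    moreover have "distinct (uncovered a b b' a' cs)" "set (uncovered a b b' a' cs) \<subseteq> gens_A \<times> gens_B"
      using "2.prems" by (auto simp: uncovered_def)
    ultimately show ?thesis
      using "2.IH"[of "(b', a')" b' a'] o set_gens_lists by simp
  qed
  have "finite ?O" by (rule finite_subset[of _ "gens_B \<times> gens_A"]) auto
  then have "card (covers (set ((a, b) # cs))) = (\<Sum>x\<in>?O. card (?F x))"
    unfolding covers_Cons[OF "2.prems"]
  proof (rule card_UN_disjoint)
    show "\<forall>x\<in>?O. finite (?F x)" by (simp add: finite_covers case_prod_beta del: BM_square.simps)
    show "\<forall>x\<in>?O. \<forall>y\<in>?O. x \<noteq> y \<longrightarrow> ?F x \<inter> ?F y = {}" using disj by blast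
  qed
  then have "int (card (covers (set ((a, b) # cs)))) = (\<Sum>x\<in>?O. int (card (?F x)))" by simp
  also have "\<dots> = (\<Sum>(b', a')\<in>?O. cover_count (uncovered a b b' a' cs))"
    using card_F by (intro sum.cong) auto
  also have "\<dots> = (\<Sum>(b', a')\<in>gens_B \<times> gens_A. if admissible a b b' a' cs then cover_count (uncovered a b b' a' cs) else 0)"
    by (rule sum.mono_neutral_cong_left) (auto split: if_splits)
  also have "\<dots> = cover_count ((a, b) # cs)"
  proof -
    have "distinct (List.product gens_B_list gens_A_list)"
      by (intro distinct_product) (auto simp: gens_A_list_def gens_B_list_def)
    then show ?thesis
      using sum_list_distinct_conv_sum_set[of "List.product gens_B_list gens_A_list"
          "\<lambda>(b', a'). if admissible a b b' a' cs then cover_count (uncovered a b b' a' cs) else 0"]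
      by (simp add: set_gens_lists)
  qed
  finally show ?case .
qed

lemma card_BM_relation_sets: "card (BM_relation_sets uminus gens_A gens_B) = 541"
proof -
  have "distinct (List.product gens_A_list gens_B_list)"
    by (intro distinct_product) (auto simp: gens_A_list_def gens_B_list_def)
  then show ?thesis
    using card_covers[of "List.product gens_A_list gens_B_list"] cover_count_all
    by (simp add: set_gens_lists BM_relation_sets_covers)
qed

section \<open>The equivalence by permuting generators\<close>

abbreviation "\<S> \<equiv> BM_relation_sets uminus gens_A gens_B"
abbreviation "\<E> \<equiv> BM_equivalence uminus gens_A gens_B"

definition transport :: "bool \<Rightarrow> ('g \<Rightarrow> 'g) \<Rightarrow> 'g quad \<Rightarrow> 'g quad" where
  "transport s \<theta> = (\<lambda>(a, b, b', a'). if s then (\<theta> b', \<theta> a', \<theta> a, \<theta> b) else (\<theta> a, \<theta> b, \<theta> b', \<theta> a'))"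

text \<open>The flag \<open>s\<close> tells whether the renaming interchanges \<open>A\<close> and \<open>B\<close>.\<close>
definition renaming :: "('g \<Rightarrow> 'g) \<Rightarrow> 'g set \<Rightarrow> 'g set \<Rightarrow> bool \<Rightarrow> ('g \<Rightarrow> 'g) \<Rightarrow> bool" where
  "renaming \<iota> A B s \<theta> \<longleftrightarrow> bij_betw \<theta> (A \<union> B) (A \<union> B) \<and> (\<forall>x\<in>A \<union> B. \<theta> (\<iota> x) = \<iota> (\<theta> x)) \<and>
    (if s then \<theta> ` A = B \<and> \<theta> ` B = A else \<theta> ` A = A \<and> \<theta> ` B = B)"

lemma BM_equivalent_iff:
  "BM_equivalent \<iota> A B R R' \<longleftrightarrow> (\<exists>s \<theta>. renaming \<iota> A B s \<theta> \<and> R' = transport s \<theta> ` R)"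
  unfolding BM_equivalent_def renaming_def transport_def by (simp add: ex_bool_eq) blast

lemma BM_equivalent_refl: "BM_equivalent \<iota> A B R R"
  unfolding BM_equivalent_iff
  by (intro exI[of _ False] exI[of _ id]) (auto simp: renaming_def transport_def image_def)

lemma BM_equivalent_trans:
  assumes "BM_equivalent \<iota> A B R R'" "BM_equivalent \<iota> A B R' R''"
  shows "BM_equivalent \<iota> A B R R''"
proof -
  obtain s \<theta> t \<eta> where \<theta>: "renaming \<iota> A B s \<theta>" "R' = transport s \<theta> ` R"
    and \<eta>: "renaming \<iota> A B t \<eta>" "R'' = transport t \<eta> ` R'"
    using assms unfolding BM_equivalent_iff by blast
  have \<theta>_mem: "\<theta> x \<in> A \<union> B" if "x \<in> A \<union> B" for x
    using \<theta>(1) that unfolding renaming_def by (metis bij_betwE)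
  have "bij_betw (\<eta> \<circ> \<theta>) (A \<union> B) (A \<union> B)"
    using \<theta>(1) \<eta>(1) bij_betw_trans unfolding renaming_def by blast
  moreover have "(\<eta> \<circ> \<theta>) (\<iota> x) = \<iota> ((\<eta> \<circ> \<theta>) x)" if "x \<in> A \<union> B" for x
    using \<theta>(1) \<eta>(1) that \<theta>_mem[OF that] unfolding renaming_def by simp
  moreover have "if s \<noteq> t then (\<eta> \<circ> \<theta>) ` A = B \<and> (\<eta> \<circ> \<theta>) ` B = A else (\<eta> \<circ> \<theta>) ` A = A \<and> (\<eta> \<circ> \<theta>) ` B = B"
    using \<theta>(1) \<eta>(1) unfolding renaming_def image_comp[symmetric] by (cases s; cases t) simp_all
  ultimately have "renaming \<iota> A B (s \<noteq> t) (\<eta> \<circ> \<theta>)" unfolding renaming_def by blast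
  moreover have "R'' = transport (s \<noteq> t) (\<eta> \<circ> \<theta>) ` R"
    unfolding \<eta>(2) \<theta>(2) image_image by (rule image_cong) (auto simp: transport_def)
  ultimately show ?thesis unfolding BM_equivalent_iff by blast
qed

lemma BM_equivalent_sym:
  assumes "BM_equivalent \<iota> A B R R'" "R \<subseteq> A \<times> B \<times> B \<times> A" "\<And>x. x \<in> A \<union> B \<Longrightarrow> \<iota> x \<in> A \<union> B"
  shows "BM_equivalent \<iota> A B R' R"
proof -
  obtain s \<theta> where \<theta>: "renaming \<iota> A B s \<theta>" "R' = transport s \<theta> ` R"
    using assms(1) unfolding BM_equivalent_iff by blast
  define \<eta> where "\<eta> = inv_into (A \<union> B) \<theta>"
  have bij: "bij_betw \<theta> (A \<union> B) (A \<union> B)" using \<theta>(1) by (simp add: renaming_def)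
  then have \<eta>\<theta>: "\<eta> (\<theta> x) = x" if "x \<in> A \<union> B" for x
    using that unfolding \<eta>_def by (simp add: bij_betw_inv_into_left)
  have bij': "bij_betw \<eta> (A \<union> B) (A \<union> B)" unfolding \<eta>_def by (rule bij_betw_inv_into[OF bij])
  have \<theta>\<iota>: "\<theta> (\<iota> x) = \<iota> (\<theta> x)" if "x \<in> A \<union> B" for x
    using \<theta>(1) that by (simp add: renaming_def)
  have "\<eta> (\<iota> y) = \<iota> (\<eta> y)" if y: "y \<in> A \<union> B" for y
  proof -
    have "y \<in> \<theta> ` (A \<union> B)" using y bij by (simp add: bij_betw_def)
    then obtain x where x: "x \<in> A \<union> B" "y = \<theta> x" by blast
    then show ?thesis using \<theta>\<iota>[OF x(1)] \<eta>\<theta>[OF x(1)] \<eta>\<theta>[OF assms(3)[OF x(1)]] by simp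
  qed
  moreover have img: "\<eta> ` \<theta> ` X = X" if "X \<subseteq> A \<union> B" for X
  proof -
    have "(\<lambda>x. \<eta> (\<theta> x)) ` X = (\<lambda>x. x) ` X" using that \<eta>\<theta> by (intro image_cong) auto
    then show ?thesis by (simp add: image_image)
  qed
  moreover have "if s then \<eta> ` A = B \<and> \<eta> ` B = A else \<eta> ` A = A \<and> \<eta> ` B = B"
    using \<theta>(1) img[of A] img[of B] unfolding renaming_def by (cases s) auto
  ultimately have "renaming \<iota> A B s \<eta>" using bij' unfolding renaming_def by blast
  moreover have "R = transport s \<eta> ` R'"
  proof -
    have "transport s \<eta> (transport s \<theta> r) = r" if "r \<in> R" for r
      using subsetD[OF assms(2) that] by (cases s) (auto simp: transport_def \<eta>\<theta>)
    then have "(\<lambda>r. transport s \<eta> (transport s \<theta> r)) ` R = (\<lambda>r. r) ` R" by (intro image_cong) auto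
    then show ?thesis by (simp add: \<theta>(2) image_image)
  qed
  ultimately show ?thesis unfolding BM_equivalent_iff by blast
qed

lemma BM_relation_set_subset: "R \<in> BM_relation_sets \<iota> A B \<Longrightarrow> R \<subseteq> A \<times> B \<times> B \<times> A"
  by (simp add: BM_relation_sets_def BM_relation_set_def)

lemma equiv_BM_equivalence: "equiv \<S> \<E>"
proof (rule equivI)
  show "\<E> \<subseteq> \<S> \<times> \<S>" by (auto simp: BM_equivalence_def)
  show "refl_on \<S> \<E>"
    by (auto simp: refl_on_def BM_equivalence_def BM_equivalent_refl)
  have "BM_equivalent uminus gens_A gens_B R' R" if "R \<in> \<S>" "BM_equivalent uminus gens_A gens_B R R'" for R R'
    using BM_equivalent_sym[OF that(2) BM_relation_set_subset[OF that(1)]] minus_gens by blast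
  then show "sym \<E>" unfolding BM_equivalence_def sym_def by blast
  show "trans \<E>" unfolding BM_equivalence_def trans_def using BM_equivalent_trans by blast
qed

text \<open>
  A renaming is determined by the images \<open>(p, q, r, s)\<close> of \<open>1, 2, 3, 4\<close>, which makes it a signed
  permutation.
\<close>
fun positive_image :: "int quad \<Rightarrow> int \<Rightarrow> int" where
  "positive_image (p, q, r, s) x = (if x = 1 then p else if x = 2 then q else if x = 3 then r else s)"

definition permute :: "int quad \<Rightarrow> int \<Rightarrow> int" where
  "permute p x = (if x < 0 then - positive_image p (- x) else positive_image p x)"

fun act :: "bool \<times> int quad \<Rightarrow> int quad \<Rightarrow> int quad" where
  "act (False, p) (a, b, b', a') = (permute p a, permute p b, permute p b', permute p a')"
| "act (True, p) (a, b, b', a') = (permute p b', permute p a', permute p a, permute p b)"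

text \<open>
  Sign changes of single generators, the transpositions within \<open>A\<close> and within \<open>B\<close>, and one interchange of
  \<open>A\<close> and \<open>B\<close>. Applied in this order, each of them at most once, they give every renaming.
\<close>
definition symmetry_factors :: "(bool \<times> int quad) list" where
  "symmetry_factors = [(False, - 1, 2, 3, 4), (False, 1, - 2, 3, 4), (False, 1, 2, - 3, 4), (False, 1, 2, 3, - 4),
     (False, 2, 1, 3, 4), (False, 1, 2, 4, 3), (True, 3, 4, 1, 2)]"

definition symmetry :: "bool \<times> int quad \<Rightarrow> bool" where
  "symmetry = (\<lambda>(s, p). renaming uminus gens_A gens_B s (permute p))"

lemma act_transport: "act (s, p) = transport s (permute p)"
  by (cases s) (auto simp: transport_def fun_eq_iff)

lemma permute_minus: "x \<noteq> 0 \<Longrightarrow> permute p (- x) = - permute p x"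
  by (simp add: permute_def)

lemma letter_cases:
  assumes "x \<in> gens_A \<union> gens_B"
  obtains "x = 1" | "x = - 1" | "x = 2" | "x = - 2" | "x = 3" | "x = - 3" | "x = 4" | "x = - 4"
  using assms by (auto simp: gens_A_def gens_B_def)

lemma gens_union_nonzero: "x \<in> gens_A \<union> gens_B \<Longrightarrow> x \<noteq> 0"
  using gens_nonzero by blast

lemma symmetryI:
  assumes "if s then permute p ` gens_A = gens_B \<and> permute p ` gens_B = gens_A else permute p ` gens_A = gens_A \<and> permute p ` gens_B = gens_B"
  shows "symmetry (s, p)"
proof -
  have "permute p ` (gens_A \<union> gens_B) = gens_A \<union> gens_B" using assms unfolding image_Un by (cases s) (simp_all add: Un_commute)
  then have "bij_betw (permute p) (gens_A \<union> gens_B) (gens_A \<union> gens_B)"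
    by (simp add: bij_betw_def eq_card_imp_inj_on)
  moreover have "\<forall>x\<in>gens_A \<union> gens_B. permute p (- x) = - permute p x"
    using permute_minus gens_union_nonzero by blast
  ultimately show ?thesis
    unfolding symmetry_def renaming_def case_prod_conv using assms by blast
qed

lemma symmetry_factors: "g \<in> set symmetry_factors \<Longrightarrow> symmetry g"
  by (auto simp: symmetry_factors_def gens_A_def gens_B_def permute_def intro!: symmetryI)

lemma renaming_transport:
  assumes "renaming uminus gens_A gens_B s \<theta>"
  shows "inj_on (transport s \<theta>) quads" "transport s \<theta> ` quads \<subseteq> quads"
    "q \<in> quads \<Longrightarrow> square (transport s \<theta> q) = transport s \<theta> ` square q"
proof -
  have inj: "inj_on \<theta> (gens_A \<union> gens_B)" using assms by (simp add: renaming_def bij_betw_def)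
  show "inj_on (transport s \<theta>) quads"
    by (rule inj_onI) (auto simp: transport_def split: if_splits dest: inj_onD[OF inj])
  show "transport s \<theta> ` quads \<subseteq> quads"
    using assms by (cases s) (auto simp: transport_def renaming_def)
  have minus: "\<theta> (- x) = - \<theta> x" if "x \<in> gens_A \<union> gens_B" for x
    using assms that by (simp add: renaming_def)
  show "square (transport s \<theta> q) = transport s \<theta> ` square q" if "q \<in> quads"
    using that by (cases q, cases s) (auto simp: transport_def minus)
qed

lemma symmetry_act:
  assumes "symmetry g"
  shows "inj_on (act g) quads" "act g ` quads \<subseteq> quads"
    "q \<in> quads \<Longrightarrow> square (act g q) = act g ` square q" "BM_equivalent uminus gens_A gens_B R (act g ` R)"
  using assms renaming_transport[of "fst g" "permute (snd g)"]
  by (cases g; auto simp: symmetry_def act_transport BM_equivalent_iff)+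

definition signed_pairs :: "int \<Rightarrow> int \<Rightarrow> (int \<times> int) list" where
  "signed_pairs x y = [(x, y), (x, - y), (- x, y), (- x, - y), (y, x), (y, - x), (- y, x), (- y, - x)]"

definition symmetries :: "(bool \<times> int quad) list" where
  "symmetries =
    map (\<lambda>((p, q), (r, s)). (False, p, q, r, s)) (List.product (signed_pairs 1 2) (signed_pairs 3 4)) @
    map (\<lambda>((p, q), (r, s)). (True, r, s, p, q)) (List.product (signed_pairs 1 2) (signed_pairs 3 4))"

text \<open>
  Injectivity together with compatibility with the sign leaves eight choices for the images of each
  of the pairs \<open>1, 2\<close> and \<open>3, 4\<close>.
\<close>
lemma renaming_symmetry:
  assumes "renaming uminus gens_A gens_B s \<theta>"
  shows "\<exists>p. (s, p) \<in> set symmetries \<and> (\<forall>x\<in>gens_A \<union> gens_B. \<theta> x = permute p x)"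
proof -
  let ?p = "(\<theta> 1, \<theta> 2, \<theta> 3, \<theta> 4)"
  have minus: "\<theta> (- x) = - \<theta> x" if "x \<in> gens_A \<union> gens_B" for x
    using assms that by (simp add: renaming_def)
  have "\<theta> x = permute ?p x" if "x \<in> gens_A \<union> gens_B" for x
    using that minus[of 1] minus[of 2] minus[of 3] minus[of 4]
    by (cases x rule: letter_cases) (auto simp: permute_def gens_A_def gens_B_def)
  moreover have ne: "\<theta> y \<noteq> \<theta> x \<and> \<theta> y \<noteq> - \<theta> x" if "x \<in> gens_A \<union> gens_B" "y \<in> gens_A \<union> gens_B" "y \<noteq> x" "y \<noteq> - x" for x y
  proof -
    have inj: "inj_on \<theta> (gens_A \<union> gens_B)" using assms by (simp add: renaming_def bij_betw_def)
    have "- x \<in> gens_A \<union> gens_B" using that(1) minus_gens by blast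
    then show ?thesis using that minus[OF that(1)] inj_onD[OF inj] by metis
  qed
  have pair: "(u, v) \<in> set (signed_pairs 1 2)" if "u \<in> gens_A" "v \<in> gens_A" "v \<noteq> u \<and> v \<noteq> - u" for u v
    using that by (auto simp: gens_A_def signed_pairs_def)
  have pair': "(u, v) \<in> set (signed_pairs 3 4)" if "u \<in> gens_B" "v \<in> gens_B" "v \<noteq> u \<and> v \<noteq> - u" for u v
    using that by (auto simp: gens_B_def signed_pairs_def)
  have mem: "1 \<in> gens_A" "2 \<in> gens_A" "3 \<in> gens_B" "4 \<in> gens_B" by (auto simp: gens_A_def gens_B_def)
  have "(s, ?p) \<in> set symmetries"
  proof (cases s)
    case True
    then have "\<theta> 1 \<in> gens_B" "\<theta> 2 \<in> gens_B" "\<theta> 3 \<in> gens_A" "\<theta> 4 \<in> gens_A"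
      using assms mem by (auto simp: renaming_def)
    then have "(\<theta> 1, \<theta> 2) \<in> set (signed_pairs 3 4)" "(\<theta> 3, \<theta> 4) \<in> set (signed_pairs 1 2)"
      using ne[of 1 2] ne[of 3 4] pair pair' mem by simp_all
    then show ?thesis unfolding symmetries_def set_append set_map set_product
      by (intro UnI2 image_eqI[of _ _ "((\<theta> 3, \<theta> 4), (\<theta> 1, \<theta> 2))"]) (simp_all add: True)
  next
    case False
    then have "\<theta> 1 \<in> gens_A" "\<theta> 2 \<in> gens_A" "\<theta> 3 \<in> gens_B" "\<theta> 4 \<in> gens_B"
      using assms mem by (auto simp: renaming_def)
    then have "(\<theta> 1, \<theta> 2) \<in> set (signed_pairs 1 2)" "(\<theta> 3, \<theta> 4) \<in> set (signed_pairs 3 4)"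
      using ne[of 1 2] ne[of 3 4] pair pair' mem by simp_all
    then show ?thesis unfolding symmetries_def set_append set_map set_product
      by (intro UnI1 image_eqI[of _ _ "((\<theta> 1, \<theta> 2), (\<theta> 3, \<theta> 4))"]) (simp_all add: False)
  qed
  ultimately show ?thesis by blast
qed

fun compose_symmetry :: "bool \<times> int quad \<Rightarrow> bool \<times> int quad \<Rightarrow> bool \<times> int quad" where
  "compose_symmetry (s, p) (t, x, y, z, w) = (s \<noteq> t, permute p x, permute p y, permute p z, permute p w)"

text \<open>All products of sublists, where factors earlier in the list are applied first.\<close>
fun products :: "(bool \<times> int quad) list \<Rightarrow> (bool \<times> int quad) list" where
  "products [] = [(False, 1, 2, 3, 4)]"
| "products (g # gs) = products gs @ map (\<lambda>h. compose_symmetry h g) (products gs)"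

lemma symmetries_products: "list_all (\<lambda>g. List.member (products symmetry_factors) g) symmetries"
  by code_simp

lemma act_compose:
  assumes "symmetry g" "q \<in> quads"
  shows "act (compose_symmetry h g) q = act h (act g q)"
proof -
  obtain s p where h: "h = (s, p)" by (cases h)
  obtain t x y z w where g: "g = (t, x, y, z, w)" by (cases g)
  let ?r = "(permute p x, permute p y, permute p z, permute p w)"
  have im: "permute (x, y, z, w) u \<in> gens_A \<union> gens_B" if "u \<in> gens_A \<union> gens_B" for u
  proof -
    have "bij_betw (permute (x, y, z, w)) (gens_A \<union> gens_B) (gens_A \<union> gens_B)"
      using assms(1) unfolding g symmetry_def renaming_def by simp
    then show ?thesis using that bij_betwE by blast
  qed
  have nz: "x \<noteq> 0" "y \<noteq> 0" "z \<noteq> 0" "w \<noteq> 0"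
    using gens_union_nonzero[OF im[of 1]] gens_union_nonzero[OF im[of 2]]
      gens_union_nonzero[OF im[of 3]] gens_union_nonzero[OF im[of 4]]
    by (auto simp: permute_def gens_A_def gens_B_def)
  have "permute ?r u = permute p (permute (x, y, z, w) u)" if "u \<in> gens_A \<union> gens_B" for u
    using that by (cases u rule: letter_cases) (simp_all add: permute_def[of ?r] permute_def[of "(x, y, z, w)"] permute_minus nz)
  then show ?thesis
    using assms(2) by (cases q, cases s, auto simp: h g act_transport transport_def simp del: act.simps)
qed

text \<open>One doubling for each factor; this mirrors \<open>products\<close> on the level of relation sets.\<close>
fun images_under :: "(bool \<times> int quad) list \<Rightarrow> int quad set set \<Rightarrow> int quad set set" where
  "images_under [] X = X"
| "images_under (g # gs) X = images_under gs (X \<union> (\<lambda>R. act g ` R) ` X)"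

lemma act_identity: "q \<in> quads \<Longrightarrow> act (False, 1, 2, 3, 4) q = q"
proof -
  have "permute (1, 2, 3, 4) x = x" if "x \<in> gens_A \<union> gens_B" for x
    using that by (cases x rule: letter_cases) (simp_all add: permute_def)
  then show "q \<in> quads \<Longrightarrow> act (False, 1, 2, 3, 4) q = q" by (cases q) auto
qed

lemma images_under_products:
  assumes "\<And>g. g \<in> set gs \<Longrightarrow> symmetry g" "R \<in> X" "R \<subseteq> quads" "h \<in> set (products gs)"
  shows "act h ` R \<in> images_under gs X"
  using assms
proof (induction gs arbitrary: R X h)
  case Nil
  then have "act h ` R = (\<lambda>q. q) ` R" by (intro image_cong) (use act_identity in auto)
  then show ?case using Nil by simp
next
  case (Cons g gs)
  from Cons.prems(4) consider "h \<in> set (products gs)" | k where "k \<in> set (products gs)" "h = compose_symmetry k g"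
    by auto
  then show ?case
  proof cases
    case 1
    then show ?thesis using Cons.IH[of R "X \<union> (\<lambda>R. act g ` R) ` X" h] Cons.prems by simp
  next
    case 2
    have g: "symmetry g" using Cons.prems by simp
    have "act h ` R = act k ` act g ` R"
    proof -
      have "act (compose_symmetry k g) q = act k (act g q)" if "q \<in> R" for q
        using act_compose[OF g subsetD[OF Cons.prems(3) that]] .
      then show ?thesis unfolding 2(2) image_image by (rule image_cong[OF HOL.refl])
    qed
    moreover have "act g ` R \<subseteq> quads" using symmetry_act(2)[OF g] Cons.prems(3) by blast
    ultimately show ?thesis
      using Cons.IH[of "act g ` R" "X \<union> (\<lambda>R. act g ` R) ` X" k] Cons.prems 2 by auto
  qed
qed

lemma class_subset_images:
  assumes "(R, R') \<in> \<E>"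
  shows "R' \<in> images_under symmetry_factors {R}"
proof -
  have "R \<in> \<S>" using assms by (simp add: BM_equivalence_def)
  then have R: "R \<subseteq> quads" by (rule BM_relation_set_subset)
  obtain s \<theta> where \<theta>: "renaming uminus gens_A gens_B s \<theta>" "R' = transport s \<theta> ` R"
    using assms by (auto simp: BM_equivalence_def BM_equivalent_iff)
  obtain p where p: "(s, p) \<in> set symmetries" "\<forall>x\<in>gens_A \<union> gens_B. \<theta> x = permute p x"
    using renaming_symmetry[OF \<theta>(1)] by blast
  have "R' = act (s, p) ` R"
    unfolding \<theta>(2) act_transport by (rule image_cong) (use R p(2) in \<open>auto simp: transport_def\<close>)
  moreover have "(s, p) \<in> set (products symmetry_factors)"
    using symmetries_products p(1) by (auto simp: list_all_iff)
  ultimately show ?thesis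
    using images_under_products[of symmetry_factors R "{R}"] symmetry_factors R by auto
qed

section \<open>Orbits\<close>

fun act_all :: "bool \<times> int quad \<Rightarrow> int quad list \<Rightarrow> int quad list" where
  "act_all g [] = []"
| "act_all g (q # qs) = act g q # act_all g qs"

text \<open>
  The five arguments are quantities of a tuple that are preserved by the symmetries of its square, or
  change sign together in such a way that this polynomial is preserved. The coefficients and the cube
  are chosen such that the sums over the squares separate all relation sets.
\<close>
fun hash_form :: "int \<Rightarrow> int \<Rightarrow> int \<Rightarrow> int \<Rightarrow> int \<Rightarrow> int" where
  "hash_form u v w x y = u - (v + v) + w * x - y * (w + x)"

fun cube :: "int \<Rightarrow> int" where "cube x = x * (x * x)"

fun weight :: "int quad \<Rightarrow> int" where
  "weight (a, b, b', a') = cube (hash_form (a * a') (b * b') (a - a') (b - b') ((a + a') * (b + b')))"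

fun total_weight :: "int quad list \<Rightarrow> int" where
  "total_weight [] = 0"
| "total_weight (q # qs) = weight q + total_weight qs"

fun weighted :: "int quad list \<Rightarrow> int \<times> int quad list" where
  "weighted qs = (total_weight qs, qs)"

fun images_of :: "bool \<times> int quad \<Rightarrow> (int \<times> int quad list) list \<Rightarrow> (int \<times> int quad list) list" where
  "images_of g [] = []"
| "images_of g ((k, qs) # xs) = weighted (act_all g qs) # images_of g xs"

fun mem_key :: "bool \<Rightarrow> int \<Rightarrow> (int \<times> 'a) list \<Rightarrow> bool" where
  "mem_key True k xs = True"
| "mem_key False k [] = False"
| "mem_key False k ((l, y) # xs) = mem_key (k = l) k xs"

fun add_unless :: "bool \<Rightarrow> 'a \<Rightarrow> 'a list \<Rightarrow> 'a list" where
  "add_unless True x xs = xs"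
| "add_unless False x xs = x # xs"

text \<open>Entries are identified by their keys alone: an entry whose key is already present is discarded.\<close>
fun add_new :: "(int \<times> 'a) list \<Rightarrow> (int \<times> 'a) list \<Rightarrow> (int \<times> 'a) list" where
  "add_new [] acc = acc"
| "add_new ((k, x) # xs) acc = add_new xs (add_unless (mem_key False k acc) (k, x) acc)"

text \<open>
  A relation set is represented by one tuple from each of its squares, together with its weight as key.
\<close>
fun orbit :: "(bool \<times> int quad) list \<Rightarrow> (int \<times> int quad list) list \<Rightarrow> (int \<times> int quad list) list" where
  "orbit [] xs = xs"
| "orbit (g # gs) xs = orbit gs (add_new (images_of g xs) xs)"

fun representatives :: "int quad list \<Rightarrow> int quad list" where
  "representatives [] = []"
| "representatives ((a, b, a', b') # rs) = (a, b, - b', - a') # representatives rs"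

fun keys_distinct :: "(int \<times> 'a) list \<Rightarrow> bool" where
  "keys_distinct [] = True"
| "keys_distinct ((k, x) # xs) = (\<not> mem_key False k xs \<and> keys_distinct xs)"

fun int_length :: "'a list \<Rightarrow> int" where
  "int_length [] = 0"
| "int_length (x # xs) = 1 + int_length xs"

definition squares_union :: "int quad list \<Rightarrow> int quad set" where
  "squares_union qs = (\<Union>q\<in>set qs. square q)"

text \<open>
  The cardinality says at once that the listed squares are pairwise disjoint and nondegenerate. In this
  form the condition is visibly invariant under renamings.
\<close>
definition disjoint_squares :: "int quad list \<Rightarrow> bool" where
  "disjoint_squares qs \<longleftrightarrow> set qs \<subseteq> quads \<and> card (squares_union qs) = 4 * length qs"

declare BM_square.simps [simp del] weight.simps [simp del]

lemma set_quads_of_square: "set (quads_of_square q) = square q"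
  by (cases q) (simp add: BM_square.simps)

lemma length_quads_of_square: "length (quads_of_square q) = 4"
  by (cases q) simp

declare quads_of_square.simps [simp del]

lemma weight_square:
  assumes "r \<in> square q"
  shows "weight r = weight q"
proof -
  obtain a b b' a' where q: "q = (a, b, b', a')" by (cases q)
  have "weight (- a, b', b, - a') = weight q" "weight (- a', - b', - b, - a) = weight q"
    "weight (a', - b, - b', a) = weight q"
    unfolding q weight.simps by (rule arg_cong[where f = cube], simp add: algebra_simps)+
  then show ?thesis using assms unfolding q BM_square.simps by blast
qed

text \<open>
  The weight computed from one tuple of each square depends only on the union of the squares, since all
  four tuples of a square have equal weight. This justifies distinguishing relation sets by weight.
\<close>
lemma total_weight_eq:
  assumes "disjoint_squares qs"
  shows "(\<Sum>r\<in>squares_union qs. weight r) = 4 * total_weight qs"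
proof -
  let ?xs = "concat (map quads_of_square qs)"
  have set: "set ?xs = squares_union qs" by (auto simp: squares_union_def set_quads_of_square)
  have "length ?xs = 4 * length qs" by (induction qs) (auto simp: length_quads_of_square)
  then have "distinct ?xs" using assms set by (intro card_distinct) (simp add: disjoint_squares_def)
  then have "(\<Sum>r\<in>squares_union qs. weight r) = sum_list (map weight ?xs)"
    unfolding set[symmetric] by (rule sum_list_distinct_conv_sum_set[symmetric])
  also have "\<dots> = 4 * total_weight qs"
  proof (induction qs)
    case Nil
    show ?case by simp
  next
    case (Cons q qs)
    have "map weight (quads_of_square q) = map (\<lambda>_. weight q) (quads_of_square q)"
      by (rule map_cong) (simp_all add: weight_square set_quads_of_square)
    then have "sum_list (map weight (quads_of_square q)) = 4 * weight q"
      by (simp add: map_replicate_const length_quads_of_square sum_list_replicate)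
    then show ?case using Cons by (simp)
  qed
  finally show ?thesis .
qed

lemma act_all_map: "act_all g qs = map (act g) qs"
  by (induction qs) auto

lemma squares_union_act:
  assumes "symmetry g" "set qs \<subseteq> quads"
  shows "squares_union (act_all g qs) = act g ` squares_union qs"
proof -
  have "squares_union (act_all g qs) = (\<Union>q\<in>set qs. square (act g q))"
    unfolding squares_union_def act_all_map by simp
  also have "\<dots> = (\<Union>q\<in>set qs. act g ` square q)"
    by (rule SUP_cong[OF HOL.refl]) (rule symmetry_act(3)[OF assms(1)], use assms(2) in blast)
  also have "\<dots> = act g ` squares_union qs" unfolding squares_union_def by blast
  finally show ?thesis .
qed

lemma squares_union_quads: "set qs \<subseteq> quads \<Longrightarrow> squares_union qs \<subseteq> quads"
  using square_subset_quads unfolding squares_union_def by blast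

lemma disjoint_squares_act:
  assumes "symmetry g" "disjoint_squares qs"
  shows "disjoint_squares (act_all g qs)"
proof -
  have qs: "set qs \<subseteq> quads" using assms(2) by (simp add: disjoint_squares_def)
  have "card (act g ` squares_union qs) = card (squares_union qs)"
    by (rule card_image) (rule inj_on_subset[OF symmetry_act(1)[OF assms(1)] squares_union_quads[OF qs]])
  moreover have "set (act_all g qs) \<subseteq> quads"
    using qs symmetry_act(2)[OF assms(1)] by (auto simp: act_all_map)
  ultimately show ?thesis
    using assms(2) squares_union_act[OF assms(1) qs] by (simp add: disjoint_squares_def act_all_map)
qed

text \<open>
  For a renaming that interchanges \<open>A\<close> and \<open>B\<close>, the projection to cells of the image comes from the
  projection \<open>(b', a')\<close> of the original relation set.
\<close>
lemma act_relation_set: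
  assumes g: "symmetry g" and R: "R \<in> \<S>"
  shows "act g ` R \<in> \<S>"
proof -
  obtain s p where gp: "g = (s, p)" by (cases g)
  let ?\<theta> = "permute p"
  have ren: "renaming uminus gens_A gens_B s ?\<theta>" using g by (simp add: symmetry_def gp)
  have Rc: "R \<in> covers (gens_A \<times> gens_B)" using R by (simp add: BM_relation_sets_covers)
  have sub: "R \<subseteq> quads" using R by (rule BM_relation_set_subset)
  have inj: "inj_on (act g) R" by (rule inj_on_subset[OF symmetry_act(1)[OF g] sub])
  have closed: "square r \<subseteq> act g ` R" "nondegenerate r" if r: "r \<in> act g ` R" for r
  proof -
    obtain q where q: "q \<in> R" "r = act g q" using r by blast
    have square: "square q \<subseteq> R" "nondegenerate q" "q \<in> quads" using Rc q(1) sub by (auto simp: covers_def)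
    have eq: "square r = act g ` square q" unfolding q(2) by (rule symmetry_act(3)[OF g square(3)])
    then show "square r \<subseteq> act g ` R" using square(1) by blast
    have "card (square r) = card (square q)" unfolding eq by (rule card_image) (rule inj_on_subset[OF inj square(1)])
    then show "nondegenerate r" using degenerate_card[of r] square_cells(2)[OF square(3,2)] by metis
  qed
  have inj\<theta>: "inj_on ?\<theta> X" if "X \<subseteq> gens_A \<union> gens_B" for X
    using ren that unfolding renaming_def bij_betw_def by (blast intro: inj_on_subset)
  have "bij_betw (cell \<circ> act g) R (gens_A \<times> gens_B)"
  proof (cases s)
    case True
    have "bij_betw (\<lambda>(a, b, b', a'). (b', a')) R (gens_B \<times> gens_A)"
      using R by (simp add: BM_relation_sets_def BM_relation_set_def)
    moreover have "bij_betw (map_prod ?\<theta> ?\<theta>) (gens_B \<times> gens_A) (gens_A \<times> gens_B)"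
      using ren inj\<theta>[of gens_A] inj\<theta>[of gens_B] True
      by (auto simp: renaming_def bij_betw_def intro!: map_prod_inj_on map_prod_surj_on)
    ultimately have "bij_betw (map_prod ?\<theta> ?\<theta> \<circ> (\<lambda>(a, b, b', a'). (b', a'))) R (gens_A \<times> gens_B)"
      by (rule bij_betw_trans)
    then show ?thesis
      by (rule bij_betw_cong[THEN iffD1, rotated]) (auto simp: gp True)
  next
    case False
    have "bij_betw (\<lambda>(a, b, b', a'). (a, b)) R (gens_A \<times> gens_B)"
      using R by (simp add: BM_relation_sets_def BM_relation_set_def)
    moreover have "bij_betw (map_prod ?\<theta> ?\<theta>) (gens_A \<times> gens_B) (gens_A \<times> gens_B)"
      using ren inj\<theta>[of gens_A] inj\<theta>[of gens_B] False
      by (auto simp: renaming_def bij_betw_def intro!: map_prod_inj_on map_prod_surj_on)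
    ultimately have "bij_betw (map_prod ?\<theta> ?\<theta> \<circ> (\<lambda>(a, b, b', a'). (a, b))) R (gens_A \<times> gens_B)"
      by (rule bij_betw_trans)
    then show ?thesis
      by (rule bij_betw_cong[THEN iffD1, rotated]) (auto simp: gp False)
  qed
  then have "bij_betw cell (act g ` R) (gens_A \<times> gens_B)"
    using bij_betw_comp_iff[OF inj_on_imp_bij_betw[OF inj]] by blast
  moreover have "act g ` R \<subseteq> quads" using sub symmetry_act(2)[OF g] by blast
  ultimately show ?thesis using closed by (simp add: BM_relation_sets_covers covers_def)
qed

definition keyed :: "int quad set \<Rightarrow> (int \<times> int quad list) list \<Rightarrow> bool" where
  "keyed R xs \<longleftrightarrow> (\<forall>(k, qs)\<in>set xs. k = total_weight qs \<and> disjoint_squares qs \<and> (R, squares_union qs) \<in> \<E>)"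

definition relation_sets :: "(int \<times> int quad list) list \<Rightarrow> int quad set set" where
  "relation_sets xs = (squares_union \<circ> snd) ` set xs"

lemma set_images_of: "set (images_of g xs) = (\<lambda>(k, qs). weighted (act_all g qs)) ` set xs"
  by (induction g xs rule: images_of.induct) auto

lemma mem_key_iff: "mem_key b k xs \<longleftrightarrow> b \<or> k \<in> fst ` set xs"
  by (induction b k xs rule: mem_key.induct) auto

lemma add_unless_eq: "add_unless b x xs = (if b then xs else x # xs)"
  by (cases b) auto

lemma set_add_new:
  "set acc \<subseteq> set (add_new xs acc)" "set (add_new xs acc) \<subseteq> set xs \<union> set acc"
  "fst ` set xs \<subseteq> fst ` set (add_new xs acc)"
proof -
  have 1: "set acc \<subseteq> set (add_new xs acc)" for xs :: "(int \<times> 'a) list" and acc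
    by (induction xs acc rule: add_new.induct) (auto simp: add_unless_eq split: if_splits)
  show "set acc \<subseteq> set (add_new xs acc)" by (rule 1)
  show "set (add_new xs acc) \<subseteq> set xs \<union> set acc"
    by (induction xs acc rule: add_new.induct) (auto simp: add_unless_eq split: if_splits)
  show "fst ` set xs \<subseteq> fst ` set (add_new xs acc)"
  proof (induction xs acc rule: add_new.induct)
    case (2 k x xs acc)
    have "k \<in> fst ` set (add_unless (mem_key False k acc) (k, x) acc)"
      by (auto simp: add_unless_eq mem_key_iff)
    then have "k \<in> fst ` set (add_new ((k, x) # xs) acc)" using 1 by (simp, blast)
    then show ?case using 2 by simp
  qed simp
qed

lemma keyed_images_of:
  assumes "symmetry g" "keyed R xs"
  shows "keyed R (images_of g xs)"
  unfolding keyed_def set_images_of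
proof (clarsimp)
  fix k qs assume "(k, qs) \<in> set xs"
  then have qs: "disjoint_squares qs" "(R, squares_union qs) \<in> \<E>" using assms(2) by (auto simp: keyed_def)
  have eq: "squares_union (act_all g qs) = act g ` squares_union qs"
    using squares_union_act[OF assms(1)] qs(1) by (simp add: disjoint_squares_def)
  have "squares_union qs \<in> \<S>" using qs(2) by (simp add: BM_equivalence_def)
  then have "(squares_union qs, act g ` squares_union qs) \<in> \<E>"
    using act_relation_set[OF assms(1)] symmetry_act(4)[OF assms(1)] by (simp add: BM_equivalence_def)
  moreover have "trans \<E>" using equiv_BM_equivalence by (simp add: equiv_def)
  ultimately show "disjoint_squares (act_all g qs) \<and> (R, squares_union (act_all g qs)) \<in> \<E>"
    using qs disjoint_squares_act[OF assms(1)] unfolding eq by (blast dest: transD)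
qed

lemma keyed_subset: "keyed R xs \<Longrightarrow> keyed R ys \<Longrightarrow> set zs \<subseteq> set xs \<union> set ys \<Longrightarrow> keyed R zs"
  unfolding keyed_def by blast

lemma keyed_orbit:
  "(\<And>g. g \<in> set gs \<Longrightarrow> symmetry g) \<Longrightarrow> keyed R xs \<Longrightarrow> keyed R (orbit gs xs)"
proof (induction gs arbitrary: xs)
  case (Cons g gs)
  have "keyed R (add_new (images_of g xs) xs)"
    using keyed_subset[OF keyed_images_of[of g R xs] Cons.prems(2) set_add_new(2)] Cons.prems by simp
  then show ?case using Cons by simp
qed simp

text \<open>
  When the weight is injective on relation sets, a discarded entry represents a relation set
  that is already present, and no image is lost.
\<close>
lemma orbit_complete:
  assumes "inj_on (sum weight) \<S>"
  shows "(\<And>g. g \<in> set gs \<Longrightarrow> symmetry g) \<Longrightarrow> keyed R xs \<Longrightarrow> X \<subseteq> relation_sets xs \<Longrightarrow>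
    images_under gs X \<subseteq> relation_sets (orbit gs xs)"
proof (induction gs arbitrary: X xs)
  case Nil
  then show ?case by simp
next
  case (Cons g gs)
  let ?ys = "images_of g xs" and ?zs = "add_new (images_of g xs) xs"
  have g: "symmetry g" using Cons.prems by simp
  have ys: "keyed R ?ys" by (rule keyed_images_of[OF g Cons.prems(2)])
  have zs: "keyed R ?zs" by (rule keyed_subset[OF ys Cons.prems(2) set_add_new(2)])
  have old: "relation_sets xs \<subseteq> relation_sets ?zs"
    unfolding relation_sets_def using set_add_new(1) by (rule image_mono)
  have "relation_sets ?ys \<subseteq> relation_sets ?zs"
  proof
    fix P assume "P \<in> relation_sets ?ys"
    then obtain k qs where kq: "(k, qs) \<in> set ?ys" "P = squares_union qs" by (auto simp: relation_sets_def)
    then have "k \<in> fst ` set ?zs" using set_add_new(3)[of ?ys xs] by force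
    then obtain qs' where kq': "(k, qs') \<in> set ?zs" by auto
    have eq: "total_weight qs' = k" "disjoint_squares qs'" "squares_union qs' \<in> \<S>"
      using zs kq' by (auto simp: keyed_def BM_equivalence_def)
    have eq': "total_weight qs = k" "disjoint_squares qs" "squares_union qs \<in> \<S>"
      using ys kq(1) by (auto simp: keyed_def BM_equivalence_def)
    have "squares_union qs' = squares_union qs"
      using inj_onD[OF assms _ eq(3) eq'(3)] total_weight_eq[OF eq(2)] total_weight_eq[OF eq'(2)] eq(1) eq'(1)
      by simp
    then show "P \<in> relation_sets ?zs" using kq' kq(2) by (force simp: relation_sets_def)
  qed
  moreover have "(\<lambda>R. act g ` R) ` X \<subseteq> relation_sets ?ys"
  proof
    fix P assume "P \<in> (\<lambda>R. act g ` R) ` X"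
    then obtain k qs where kq: "(k, qs) \<in> set xs" "P = act g ` squares_union qs"
      using Cons.prems(3) by (auto simp: relation_sets_def)
    have "disjoint_squares qs" using Cons.prems(2) kq(1) by (auto simp: keyed_def)
    then have "P = squares_union (act_all g qs)"
      using kq(2) squares_union_act[OF g] by (simp add: disjoint_squares_def)
    then show "P \<in> relation_sets ?ys" using kq(1) by (force simp: relation_sets_def set_images_of)
  qed
  ultimately have "X \<union> (\<lambda>R. act g ` R) ` X \<subseteq> relation_sets ?zs"
    using old Cons.prems(3) by blast
  then show ?case using Cons.IH[OF _ zs] Cons.prems(1) by simp
qed

section \<open>The classes in the table\<close>

abbreviation (input) "table_set j \<equiv> BM_from_relations uminus (fst (BM_table ! j))"

fun valid_quad :: "int quad \<Rightarrow> bool" where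
  "valid_quad (a, b, b', a') \<longleftrightarrow> List.member gens_A_list a \<and> List.member gens_B_list b \<and>
    List.member gens_B_list b' \<and> List.member gens_A_list a' \<and> nondegenerate (a, b, b', a')"

text \<open>Sixteen tuples over distinct cells cover all sixteen cells.\<close>
definition valid_row :: "int quad list \<Rightarrow> bool" where
  "valid_row rs \<longleftrightarrow> length rs = 4 \<and> list_all valid_quad (relation_quads rs) \<and> distinct (map cell (relation_quads rs))"

lemma rows_valid: "list_all (\<lambda>(rs, _). valid_row rs) BM_table"
  by code_simp

lemma set_relation_quads: "set (relation_quads rs) = BM_from_relations uminus rs"
  by (induction rs rule: relation_quads.induct) (simp_all add: BM_from_relations_def set_quads_of_square)

lemma squares_union_representatives: "squares_union (representatives rs) = BM_from_relations uminus rs"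
  by (induction rs rule: representatives.induct) (simp_all add: BM_from_relations_def squares_union_def)

lemma length_relation_quads: "length (relation_quads rs) = 4 * length rs"
  by (induction rs rule: relation_quads.induct) (simp_all add: length_quads_of_square)

lemma length_representatives: "length (representatives rs) = length rs"
  by (induction rs rule: representatives.induct) auto

lemma set_representatives: "set (representatives rs) \<subseteq> BM_from_relations uminus rs"
  unfolding squares_union_representatives[symmetric] squares_union_def using square_self by blast

lemma valid_row:
  assumes "valid_row rs"
  shows "BM_from_relations uminus rs \<in> \<S>" "disjoint_squares (representatives rs)"
    "distinct (relation_quads rs)" "length (relation_quads rs) = 16"
proof -
  let ?qs = "relation_quads rs"
  have v: "length rs = 4" "\<And>q. q \<in> set ?qs \<Longrightarrow> valid_quad q" "distinct (map cell ?qs)"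
    using assms by (auto simp: valid_row_def list_all_iff)
  show dist: "distinct ?qs" using v(3) by (simp add: distinct_map)
  show len: "length ?qs = 16" by (simp add: length_relation_quads v(1))
  have quad: "q \<in> quads \<and> nondegenerate q" if "q \<in> set ?qs" for q
    using v(2)[OF that] by (cases q) (auto simp: set_gens_lists)
  have "card (cell ` set ?qs) = 16" using v(3) len distinct_card[of "map cell ?qs"] by simp
  moreover have "cell ` set ?qs \<subseteq> gens_A \<times> gens_B" using quad by force
  moreover have "card (gens_A \<times> gens_B) = 16" by (simp add: gens_A_def gens_B_def card_cartesian_product)
  ultimately have "cell ` set ?qs = gens_A \<times> gens_B" by (intro card_subset_eq) auto
  then have "bij_betw cell (set ?qs) (gens_A \<times> gens_B)" using v(3) by (simp add: bij_betw_def distinct_map)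
  moreover have "square r \<subseteq> set ?qs" if "r \<in> set ?qs" for r
  proof -
    obtain q where q: "q \<in> set (representatives rs)" "r \<in> square q"
      using \<open>r \<in> set ?qs\<close> unfolding set_relation_quads squares_union_representatives[symmetric] squares_union_def by blast
    then show ?thesis
      using square_eq[OF q(2)] unfolding set_relation_quads squares_union_representatives[symmetric] squares_union_def by blast
  qed
  ultimately show "BM_from_relations uminus rs \<in> \<S>"
    using quad unfolding BM_relation_sets_covers covers_def set_relation_quads[symmetric] by blast
  show "disjoint_squares (representatives rs)"
    using set_representatives[of rs] quad distinct_card[OF dist] len
    unfolding disjoint_squares_def squares_union_representatives length_representatives v(1) set_relation_quads[symmetric]
    by auto
qed

lemma length_table: "length BM_table = 52"
  by (simp add: BM_table_def)

lemma row_valid: "j < 52 \<Longrightarrow> valid_row (fst (BM_table ! j))"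
  using rows_valid by (simp add: list_all_length length_table case_prod_beta)

definition table_orbits :: "(int \<times> int quad list) list list" where
  "table_orbits = map (\<lambda>(rs, _). orbit symmetry_factors [weighted (representatives rs)]) BM_table"

definition separated :: "(int \<times> 'a) list \<Rightarrow> bool" where
  "separated xs \<longleftrightarrow> keys_distinct xs \<and> int_length xs = 541"

text \<open>
  This evaluation decides the classification; it computes the orbits of all rows, 541 entries in total.
\<close>
lemma table_orbits_separated: "separated (concat table_orbits)"
  by code_simp

definition row_orbit :: "nat \<Rightarrow> (int \<times> int quad list) list" where
  "row_orbit j = orbit symmetry_factors [weighted (representatives (fst (BM_table ! j)))]"

lemma table_orbits_nth: "length table_orbits = 52" "j < 52 \<Longrightarrow> table_orbits ! j = row_orbit j"
  by (auto simp: table_orbits_def row_orbit_def length_table case_prod_beta)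

lemma keyed_row: "j < 52 \<Longrightarrow> keyed (table_set j) [weighted (representatives (fst (BM_table ! j)))]"
proof -
  assume j: "j < 52"
  have "refl_on \<S> \<E>" using equiv_BM_equivalence by (simp add: equiv_def)
  then show ?thesis
    using valid_row(1,2)[OF row_valid[OF j]] by (simp add: keyed_def squares_union_representatives refl_onD)
qed

lemma keyed_row_orbit: "j < 52 \<Longrightarrow> keyed (table_set j) (row_orbit j)"
  unfolding row_orbit_def by (rule keyed_orbit[OF symmetry_factors keyed_row])

lemma keys_distinct_iff: "keys_distinct xs \<longleftrightarrow> distinct (map fst xs)"
  by (induction xs rule: keys_distinct.induct) (auto simp: mem_key_iff)

lemma int_length_eq: "int_length xs = int (length xs)"
  by (induction xs) auto

lemma distinct_concat_nth:
  "distinct (concat xss) \<Longrightarrow> i < length xss \<Longrightarrow> j < length xss \<Longrightarrow> x \<in> set (xss ! i) \<Longrightarrow> x \<in> set (xss ! j) \<Longrightarrow> i = j"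
proof (induction xss arbitrary: i j)
  case (Cons xs xss)
  have "x \<notin> set xs" if "k < length xss" "x \<in> set (xss ! k)" for k
    using Cons.prems(1) that by (auto dest: nth_mem)
  then show ?case using Cons by (cases i; cases j) auto
qed simp

text \<open>
  There are 541 entries with distinct weights, hence 541 distinct relation sets, and no more exist.
  Completeness, injectivity of the weight and disjointness all follow from this coincidence.
\<close>
lemma orbits_cover:
  "inj_on (sum weight) \<S>" "\<S> = (\<Union>j<52. relation_sets (row_orbit j))"
  "i < 52 \<Longrightarrow> j < 52 \<Longrightarrow> R \<in> relation_sets (row_orbit i) \<Longrightarrow> R \<in> relation_sets (row_orbit j) \<Longrightarrow> i = j"
proof -
  let ?xs = "concat table_orbits"
  have key: "sum weight (squares_union qs) = 4 * k \<and> squares_union qs \<in> \<S>" if "(k, qs) \<in> set (row_orbit j)" "j < 52" for k qs j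
    using keyed_row_orbit[OF that(2)] that(1) total_weight_eq by (auto simp: keyed_def BM_equivalence_def)
  have all: "set ?xs = (\<Union>j<52. set (row_orbit j))"
  proof -
    have eq: "table_orbits = map row_orbit [0..<52]"
      by (rule nth_equalityI) (simp_all add: table_orbits_nth)
    show ?thesis unfolding eq set_concat set_map set_upt atLeast0LessThan by blast
  qed
  have dist: "distinct (map fst ?xs)" and len: "length ?xs = 541"
    using table_orbits_separated by (auto simp: separated_def keys_distinct_iff int_length_eq)
  let ?Rs = "map (squares_union \<circ> snd) ?xs"
  have "sum weight (squares_union (snd y)) = 4 * fst y" if "y \<in> set ?xs" for y
    using that key unfolding all by (cases y) auto
  then have weights: "map (sum weight) ?Rs = map (\<lambda>k. 4 * k) (map fst ?xs)"
    unfolding map_map by (intro map_cong HOL.refl) simp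
  have "distinct (map (\<lambda>k. 4 * k) (map fst ?xs))"
    using dist by (simp only: distinct_map[of "\<lambda>k. 4 * k"]) (auto intro: inj_onI)
  then have W: "distinct (map (sum weight) ?Rs)" unfolding weights .
  then have "distinct ?Rs" by (simp only: distinct_map)
  then have card: "card (set ?Rs) = 541" using len distinct_card[of ?Rs] by simp
  have Rs: "set ?Rs = (\<Union>j<52. relation_sets (row_orbit j))"
    unfolding set_map all relation_sets_def by (simp add: image_UN)
  have "squares_union (snd y) \<in> \<S>" if "y \<in> set ?xs" for y
    using that key unfolding all by (cases y) auto
  then have sub: "set ?Rs \<subseteq> \<S>" unfolding set_map comp_def by blast
  have "finite \<S>" by (simp add: BM_relation_sets_covers finite_covers)
  then have eq: "set ?Rs = \<S>" using sub card card_BM_relation_sets by (intro card_subset_eq) auto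
  then show "\<S> = (\<Union>j<52. relation_sets (row_orbit j))" using Rs by simp
  show "inj_on (sum weight) \<S>" using W unfolding distinct_map[of "sum weight"] eq by blast
  assume ij: "i < 52" "j < 52" and R: "R \<in> relation_sets (row_orbit i)" "R \<in> relation_sets (row_orbit j)"
  obtain k qs where 1: "(k, qs) \<in> set (row_orbit i)" "R = squares_union qs" using R(1) by (auto simp: relation_sets_def)
  obtain l qs' where 2: "(l, qs') \<in> set (row_orbit j)" "R = squares_union qs'" using R(2) by (auto simp: relation_sets_def)
  have "k = l" using key[OF 1(1) ij(1)] key[OF 2(1) ij(2)] 1(2) 2(2) by simp
  moreover have "distinct (concat (map (map fst) table_orbits))" using dist by (simp add: map_concat)
  ultimately show "i = j"
    using distinct_concat_nth[of "map (map fst) table_orbits" i j k] ij 1(1) 2(1) table_orbits_nth by force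
qed

lemma class_eq: "j < 52 \<Longrightarrow> \<E> `` {table_set j} = relation_sets (row_orbit j)"
proof (intro equalityI subsetI)
  assume j: "j < 52"
  fix R assume "R \<in> \<E> `` {table_set j}"
  then have "R \<in> images_under symmetry_factors {table_set j}" using class_subset_images by simp
  moreover have "{table_set j} \<subseteq> relation_sets [weighted (representatives (fst (BM_table ! j)))]"
    by (simp add: relation_sets_def squares_union_representatives)
  ultimately show "R \<in> relation_sets (row_orbit j)"
    using orbit_complete[OF orbits_cover(1) symmetry_factors keyed_row[OF j]] unfolding row_orbit_def by blast
next
  fix R assume "j < 52" "R \<in> relation_sets (row_orbit j)"
  then show "R \<in> \<E> `` {table_set j}" using keyed_row_orbit by (force simp: relation_sets_def keyed_def)
qed

theorem classes_bij: "bij_betw (\<lambda>j. \<E> `` {table_set j}) {..<52} (\<S> // \<E>)"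
proof (rule bij_betw_imageI)
  have self: "table_set j \<in> \<E> `` {table_set j}" if "j < 52" for j
    using equiv_class_self[OF equiv_BM_equivalence valid_row(1)[OF row_valid[OF that]]] .
  show "inj_on (\<lambda>j. \<E> `` {table_set j}) {..<52}"
  proof (rule inj_onI)
    fix i j :: nat assume ij: "i \<in> {..<52}" "j \<in> {..<52}" "\<E> `` {table_set i} = \<E> `` {table_set j}"
    then have "table_set i \<in> relation_sets (row_orbit i)" "table_set i \<in> relation_sets (row_orbit j)"
      using self[of i] class_eq by auto
    then show "i = j" using orbits_cover(3) ij by simp
  qed
  show "(\<lambda>j. \<E> `` {table_set j}) ` {..<52} = \<S> // \<E>"
  proof (intro equalityI subsetI)
    fix X assume "X \<in> (\<lambda>j. \<E> `` {table_set j}) ` {..<52}"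
    then show "X \<in> \<S> // \<E>" using valid_row(1)[OF row_valid] by (auto intro: quotientI)
  next
    fix X assume "X \<in> \<S> // \<E>"
    then obtain R where R: "R \<in> \<S>" "X = \<E> `` {R}" by (rule quotientE)
    then obtain j where j: "j < 52" "R \<in> \<E> `` {table_set j}" using orbits_cover(2) class_eq by blast
    then have "\<E> `` {table_set j} = X"
      using equiv_class_eq[OF equiv_BM_equivalence] R(2) by blast
    then show "X \<in> (\<lambda>j. \<E> `` {table_set j}) ` {..<52}" using j(1) by blast
  qed
qed

section \<open>Homology and cokernel of a row\<close>

definition all_gens :: "int list" where "all_gens = [1, -1, 2, -2, 3, -3, 4, -4]"

text \<open>
  The first family expresses that the involution gives inverses, the second one the relations
  \<open>a b = b' a'\<close>.
\<close>
definition H1_rows :: "int quad list \<Rightarrow> int list list" where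
  "H1_rows qs =
    map (\<lambda>x. axpy (- 1) (exponents all_gens []) (exponents all_gens [(x, True), (- x, True)])) all_gens @
    map (\<lambda>(a, b, b', a'). axpy (- 1) (exponents all_gens [(b', True), (a', True)]) (exponents all_gens [(a, True), (b, True)])) qs"

definition C_rows :: "int quad list \<Rightarrow> int list list" where
  "C_rows qs = matrix_columns (\<lambda>s r. identity_matrix s r - BM_matrix1 uminus s r) qs @
    matrix_columns (\<lambda>s r. identity_matrix s r - BM_matrix2 uminus s r) qs"

lemma H1_row:
  assumes "set qs = R" "R \<subseteq> quads" "has_type (H1_rows qs) h hs"
  shows "abelianization (BM_group uminus gens_A gens_B R) \<cong> abelian_type h hs"
proof -
  let ?rels = "{([(x, True), (- x, True)], []) | x. x \<in> gens_A \<union> gens_B} \<union>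
       {([(a, True), (b, True)], [(b', True), (a', True)]) | a b b' a'. (a, b, b', a') \<in> R}"
  have all_gens: "set all_gens = gens_A \<union> gens_B" "distinct all_gens" by (auto simp: all_gens_def gens_A_def gens_B_def)
  interpret finite_presentation "gens_A \<union> gens_B" ?rels all_gens "set (H1_rows qs)"
  proof
    show "set all_gens = gens_A \<union> gens_B" "distinct all_gens" by fact+
    show "u \<in> presentation.words (gens_A \<union> gens_B) \<and> v \<in> presentation.words (gens_A \<union> gens_B)"
      if "(u, v) \<in> ?rels" for u v
      using that assms(2) minus_gens by (auto simp: presentation.words_def)
    have "set (H1_rows qs) = (\<lambda>x. axpy (- 1) (exponents all_gens []) (exponents all_gens [(x, True), (- x, True)])) ` (gens_A \<union> gens_B) \<union>
      (\<lambda>(a, b, b', a'). axpy (- 1) (exponents all_gens [(b', True), (a', True)]) (exponents all_gens [(a, True), (b, True)])) ` R"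
      unfolding H1_rows_def set_append set_map all_gens(1) assms(1) ..
    also have "\<dots> = (\<lambda>(u, v). axpy (- 1) (exponents all_gens v) (exponents all_gens u)) ` ?rels"
      unfolding image_Un by (intro arg_cong2[where f = "(\<union>)"]) (force simp: image_iff)+
    finally show "set (H1_rows qs) = (\<lambda>(u, v). axpy (- 1) (exponents all_gens v) (exponents all_gens u)) ` ?rels" .
  qed
  have "presents (abelian_type h hs) [] (length all_gens) (set (H1_rows qs))"
    by (rule has_type_presents[OF assms(3) int_rows_axioms]) (simp_all add: H1_rows_def all_gens_def)
  from abelianization_iso[OF comm_group_abelian_type this] show ?thesis by (simp add: BM_group_def)
qed

lemma C_row:
  assumes "set qs = R" "distinct qs" "qs \<noteq> []" "has_type (C_rows qs) c cs"
  shows "BM_C uminus R \<cong> abelian_type c cs"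
proof -
  have "int_rows (length qs) (set (C_rows qs))"
    by unfold_locales (auto simp: C_rows_def matrix_columns_def)
  then have "presents (abelian_type c cs) [] (length qs) (set (C_rows qs))"
    by (rule has_type_presents[OF assms(4)]) (use assms(3) in \<open>simp_all add: C_rows_def matrix_columns_def\<close>)
  from coker_iso[OF assms(1,2) comm_group_abelian_type this[unfolded C_rows_def]]
  show ?thesis by (simp add: BM_C_def)
qed

lemma table_types: "list_all (\<lambda>(rs, (h, hs), (c, cs)).
    has_type (H1_rows (relation_quads rs)) h hs \<and> has_type (C_rows (relation_quads rs)) c cs) BM_table"
  by code_simp

section \<open>The theorem\<close>

theorem mainTheorem4:
  fixes A B :: "int set"
  assumes "A = {1, -1, 2, -2}" and "B = {3, -3, 4, -4}"
  shows
    "card (BM_relation_sets uminus A B) = 541 \<and>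
     card (BM_relation_sets uminus A B // BM_equivalence uminus A B) = 52 \<and>
     length BM_table = 52 \<and>
     (\<forall>(rs, _, _) \<in> set BM_table. BM_from_relations uminus rs \<in> BM_relation_sets uminus A B) \<and>
     bij_betw (\<lambda>j. BM_equivalence uminus A B `` {BM_from_relations uminus (fst (BM_table ! j))})
       {..<52} (BM_relation_sets uminus A B // BM_equivalence uminus A B) \<and>
     (\<forall>(rs, (h, hs), (c, cs)) \<in> set BM_table.
        abelianization (BM_group uminus A B (BM_from_relations uminus rs)) \<cong> abelian_type h hs \<and>
        BM_C uminus (BM_from_relations uminus rs) \<cong> abelian_type c cs)"
proof -
  have AB: "A = gens_A" "B = gens_B" using assms by (simp_all add: gens_A_def gens_B_def)
  have valid: "valid_row rs" if "(rs, hc) \<in> set BM_table" for rs hc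
    using rows_valid that by (auto simp: list_all_iff)
  have "card (\<S> // \<E>) = 52" using bij_betw_same_card[OF classes_bij] by simp
  moreover have "abelianization (BM_group uminus gens_A gens_B (BM_from_relations uminus rs)) \<cong> abelian_type h hs \<and>
      BM_C uminus (BM_from_relations uminus rs) \<cong> abelian_type c cs"
    if row: "(rs, (h, hs), (c, cs)) \<in> set BM_table" for rs h hs c cs
  proof -
    have types: "has_type (H1_rows (relation_quads rs)) h hs" "has_type (C_rows (relation_quads rs)) c cs"
      using table_types row by (auto simp: list_all_iff)
    note v = valid_row[OF valid[OF row]]
    have "relation_quads rs \<noteq> []" using v(4) by auto
    then show ?thesis
      using H1_row[OF set_relation_quads BM_relation_set_subset[OF v(1)] types(1)]
        C_row[OF set_relation_quads v(3) _ types(2)] by simp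
  qed
  ultimately show ?thesis
    unfolding AB using card_BM_relation_sets length_table classes_bij valid_row(1)[OF valid] by blast
qed

end
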